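(* Let $(\mathfrak g,\lambda^{\mathfrak g})$ and $(\mathfrak h,\lambda^{\mathfrak h})$ be $L_\infty$-algebras, and let $(\mathbb V,\rho)$ and $(\mathbb W,\tau)$ be representations up to homotopy of $\mathfrak g$ and $\mathfrak h$, respectively. If $(F,f):(\mathbb V,\rho)\to(\mathbb W,\tau)$ is a quasi-isomorphism of representations up to homotopy, then the pullback $$F^*:C(\mathfrak h,\mathbb W)\to C(\mathfrak g,\mathbb V),\qquad F^*\alpha:=f\circ\alpha\circ F,$$ is a quasi-isomorphism of cochain complexes $(C(\mathfrak h,\mathbb W),D_\tau)\to(C(\mathfrak g,\mathbb V),D_\rho)$.
   Context: Vector spaces are over $\mathbb R$. For graded vector spaces $V,W$, $\underline{\mathrm{Hom}}^p(V,W)$ is the space of linear maps $V\to W$ homogeneous of degree $p$; tensor products of homogeneous maps follow the rule $(f\otimes g)(v\otimes w)=(-1)^{|g||v|}f(v)\otimes g(w)$; $V[1]_n=V_{n+1}$. $S(V)=\bigoplus_{n\ge0}S^n(V)$ is the graded symmetric algebra with product $\vee$ (also written $\mu$) and coproduct $$\Delta(v_1\vee\cdots\vee v_n)=\sum_{k=0}^n\sum_{\sigma\in Sh(k,n-k)}\epsilon(\sigma)(v_{\sigma(1)}\vee\cdots\vee v_{\sigma(k)})\otimes(v_{\sigma(k+1)}\vee\cdots\vee v_{\sigma(n)}),$$ where $Sh(k,n-k)$ is the set of permutations increasing on $\{1,\dots,k\}$ and on $\{k+1,\dots,n\}$, and $\epsilon(\sigma)$ is the Koszul sign. An $L_\infty$-algebra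 is a graded vector space $\mathfrak g=\bigoplus_{n\le 0}\mathfrak g_n$ with degree 1 linear maps $\lambda_k:S^k(\mathfrak g[1])\to\mathfrak g[1]$, $k\ge1$, such that, with $\lambda=\sum_k\lambda_k$ ($\lambda(1)=0$), the coderivation $d_\lambda=\mu\circ(\lambda\otimes\mathrm{Id})\circ\Delta$ of $S(\mathfrak g[1])$ satisfies $d_\lambda^2=0$. Its underlying complex is $(\mathfrak g[1],\lambda_1)$ (up to shift). An $L_\infty$-morphism $F:\mathfrak g\to\mathfrak g'$ is a degree 0 coalgebra morphism $F:S(\mathfrak g[1])\to S(\mathfrak g'[1])$ with $F(1)=1$ and $F\circ d_\lambda=d_{\lambda'}\circ F$; it is determined by its components $F^1_n:S^n(\mathfrak g[1])\to\mathfrak g'[1]$, $n\ge1$. $F$ is an $L_\infty$-quasi-isomorphism if the linear part $F^1_1$ induces an isomorphism on the cohomology of the underlying complexes. A representation up to homotopy (ruth) of $(\mathfrak g,\lambda)$ on a graded vector space $\mathbb V$ is a degree 1 linear map $\rho:S(\mathfrak g[1])\otimes\mathbb V\to\mathbb V$ with $\rho\circ(d_\lambda\otimes\mathrm{Id})+\rho\circ(\mathrm{Id}\otimes\rho)\circ(\Delta\otimes\mathrm{Id})=0$. Then $\partial v:=\rho(1\otimes v)$ makes $\mathbb V$ a cochain complex (the underlying complex of $\mathbb V$). Put $C^p(\mathfrak g,\mathbb V)=\underline{\mathrm{Hom}}^p(S(\mathfrak g[1]),\mathbb V)$, $C(\mathfrak g,\mathbb V)=\bigoplus_pC^p(\mathfrak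 g,\mathbb V)$, with differential $D_\rho\alpha=\rho\circ(\mathrm{Id}\otimes\alpha)\circ\Delta-(-1)^p\alpha\circ d_\lambda$ for $\alpha\in C^p(\mathfrak g,\mathbb V)$. A ruth morphism $(F,f):(\mathbb V,\rho)\to(\mathbb V',\rho')$ between ruths of $\mathfrak g$ and $\mathfrak g'$ is an $L_\infty$-morphism $F:\mathfrak g\to\mathfrak g'$ together with a degree preserving linear map $f:\mathbb V'\to\mathbb V$ (note the direction) such that $f\circ\rho'\circ(F\otimes\mathrm{Id}_{\mathbb V'})=\rho\circ(\mathrm{Id}\otimes f)$. It is a quasi-isomorphism if $F$ is an $L_\infty$-quasi-isomorphism and $f$ is a quasi-isomorphism between the underlying complexes. *)

theory Defs
  imports
    "HOL-Analysis.Finite_Function_Topology"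
    "HOL-Library.Function_Algebras"
    "HOL-Combinatorics.Permutations"
begin

section \<open>Graded vector spaces\<close>

text \<open>
  The carrier of a graded vector space is the whole type, i.e. the direct sum of its homogeneous
  parts \<^term>\<open>gr n\<close>.
\<close>

class graded_vector = real_vector +
  fixes gr :: "int \<Rightarrow> 'a set"
  assumes gr_zero: "0 \<in> gr n"
    and gr_add: "x \<in> gr n \<Longrightarrow> y \<in> gr n \<Longrightarrow> x + y \<in> gr n"
    and gr_scaleR: "x \<in> gr n \<Longrightarrow> c *\<^sub>R x \<in> gr n"
    and gr_direct_sum:
      "\<exists>!c. (\<forall>n. c n \<in> gr n) \<and> finite {n. c n \<noteq> 0} \<and> (\<Sum>n | c n \<noteq> 0. c n) = v"

definition gr_components :: "'a::graded_vector \<Rightarrow> int \<Rightarrow> 'a" where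
  "gr_components v = (THE c. (\<forall>n. c n \<in> gr n) \<and> finite {n. c n \<noteq> 0} \<and> (\<Sum>n | c n \<noteq> 0. c n) = v)"

lemma subspace_gr: "subspace (gr n)"
  by (simp add: subspace_def gr_zero gr_add gr_scaleR)

lemma gr_components:
  shows components_gr: "gr_components v n \<in> gr n"
    and finite_components: "finite {n. gr_components v n \<noteq> 0}"
    and sum_components: "(\<Sum>n | gr_components v n \<noteq> 0. gr_components v n) = v"
  using theI'[OF gr_direct_sum[of v]] unfolding gr_components_def[symmetric] by blast+

lemma components_unique:
  assumes "\<And>n. c n \<in> gr n" "finite {n. c n \<noteq> 0}" "(\<Sum>n | c n \<noteq> 0. c n) = v"
  shows "gr_components v = c"
  unfolding gr_components_def by (rule the1_equality[OF gr_direct_sum]) (use assms in blast)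

lemma sum_components_superset:
  assumes "finite A" "{n. gr_components v n \<noteq> 0} \<subseteq> A"
  shows "(\<Sum>n\<in>A. gr_components v n) = v"
  by (metis (mono_tags, lifting) Diff_iff assms mem_Collect_eq sum.mono_neutral_right sum_components)

lemma components_unique_superset:
  assumes "\<And>n. c n \<in> gr n" "finite A" "\<And>n. n \<notin> A \<Longrightarrow> c n = 0" "(\<Sum>n\<in>A. c n) = v"
  shows "gr_components v = c"
proof (rule components_unique)
  show "finite {n. c n \<noteq> 0}"
    using assms(2,3) by (metis (mono_tags, lifting) finite_subset mem_Collect_eq subsetI)
  show "(\<Sum>n | c n \<noteq> 0. c n) = v"
    unfolding assms(4)[symmetric]
    by (rule sum.mono_neutral_left) (use assms in auto)
qed (use assms in auto)

lemma components_homogeneous: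
  assumes "v \<in> gr m" shows "gr_components v n = (if n = m then v else 0)"
proof -
  have "gr_components v = (\<lambda>n. if n = m then v else 0)"
    by (rule components_unique_superset[where A = "{m}"]) (use assms in \<open>auto simp: gr_zero\<close>)
  then show ?thesis by simp
qed

lemma components_add: "gr_components (v + w) n = gr_components v n + gr_components w n"
proof -
  let ?A = "{n. gr_components v n \<noteq> 0} \<union> {n. gr_components w n \<noteq> 0}"
  have "gr_components (v + w) = (\<lambda>n. gr_components v n + gr_components w n)"
    by (rule components_unique_superset[where A = ?A])
      (auto simp: gr_add components_gr finite_components sum.distrib sum_components_superset)
  then show ?thesis by simp
qed

lemma components_scaleR: "gr_components (c *\<^sub>R v) n = c *\<^sub>R gr_components v n"
proof -
  let ?A = "{n. gr_components v n \<noteq> 0}"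
  have "gr_components (c *\<^sub>R v) = (\<lambda>n. c *\<^sub>R gr_components v n)"
    by (rule components_unique_superset[where A = ?A])
      (auto simp: gr_scaleR components_gr finite_components scaleR_sum_right[symmetric] sum_components)
  then show ?thesis by simp
qed

definition weighted :: "(int \<Rightarrow> real) \<Rightarrow> 'a::graded_vector \<Rightarrow> 'a" where
  "weighted s v = (\<Sum>n | gr_components v n \<noteq> 0. s n *\<^sub>R gr_components v n)"

lemma weighted_superset:
  assumes "finite A" "{n. gr_components v n \<noteq> 0} \<subseteq> A"
  shows "weighted s v = (\<Sum>n\<in>A. s n *\<^sub>R gr_components v n)"
  unfolding weighted_def by (rule sum.mono_neutral_left) (use assms in auto)

lemma linear_weighted: "linear (weighted s)"
proof (rule linearI)
  fix v w :: 'a and c :: real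
  let ?A = "{n. gr_components v n \<noteq> 0} \<union> {n. gr_components w n \<noteq> 0}"
  have "finite ?A" by (simp add: finite_components)
  moreover have "{n. gr_components (v + w) n \<noteq> 0} \<subseteq> ?A" by (auto simp: components_add)
  ultimately show "weighted s (v + w) = weighted s v + weighted s w"
    by (simp add: weighted_superset[where A = ?A] components_add scaleR_add_right sum.distrib)
  have "weighted s (c *\<^sub>R v) = (\<Sum>n | gr_components v n \<noteq> 0. s n *\<^sub>R gr_components (c *\<^sub>R v) n)"
    by (rule weighted_superset) (auto simp: finite_components components_scaleR)
  also have "\<dots> = c *\<^sub>R weighted s v"
    by (simp add: weighted_def components_scaleR scaleR_sum_right mult.commute)
  finally show "weighted s (c *\<^sub>R v) = c *\<^sub>R weighted s v" .
qed

lemma weighted_homogeneous: "v \<in> gr n \<Longrightarrow> weighted s v = s n *\<^sub>R v"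
  by (subst weighted_superset[where A = "{n}"]) (auto simp: components_homogeneous split: if_splits)

lemma span_gr: "span (\<Union>n. gr n) = (UNIV :: 'a::graded_vector set)"
proof -
  have "v \<in> span (\<Union>n. gr n)" for v :: 'a
    by (subst sum_components[symmetric]) (intro span_sum span_base, use components_gr in blast)
  then show ?thesis by blast
qed

lemma eigenvectors_independent:
  fixes x :: "int \<Rightarrow> 'a::real_vector"
  assumes "linear \<phi>" "finite A" "\<And>n. n \<in> A \<Longrightarrow> \<phi> (x n) = (2 powi n) *\<^sub>R x n" "(\<Sum>n\<in>A. x n) = 0"
  shows "\<forall>n\<in>A. x n = 0"
  using assms(2-4)
proof (induction A arbitrary: x rule: finite_induct)
  case (insert m A)
  interpret linear \<phi> by fact
  define y where "y n = (2 powi n - 2 powi m) *\<^sub>R x n" for n :: int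
  have "0 = \<phi> (\<Sum>n\<in>insert m A. x n) - (2 powi m) *\<^sub>R (\<Sum>n\<in>insert m A. x n)"
    by (simp only: insert.prems(2) zero scaleR_zero_right diff_0_right)
  also have "\<dots> = (\<Sum>n\<in>insert m A. y n)"
    by (simp only: sum scaleR_sum_right sum_subtractf[symmetric])
      (intro sum.cong refl, simp add: insert.prems(1) y_def scaleR_diff_left)
  also have "\<dots> = (\<Sum>n\<in>A. y n)"
    using insert.hyps by (simp add: y_def)
  finally have "(\<Sum>n\<in>A. y n) = 0" by simp
  moreover have "\<phi> (y n) = (2 powi n) *\<^sub>R y n" if "n \<in> A" for n
    using insert.prems(1) that by (simp add: y_def scaleR mult.commute)
  ultimately have y: "\<forall>n\<in>A. y n = 0"
    using insert.IH by blast
  have "x n = 0" if "n \<in> A" for n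
  proof -
    have "n < m \<or> m < n" using insert.hyps that by (metis linorder_neqE_linordered_idom)
    then have "(2::real) powi n < 2 powi m \<or> (2::real) powi m < 2 powi n"
      by (auto intro: power_int_strict_increasing)
    then have "(2::real) powi n - 2 powi m \<noteq> 0" by auto
    moreover have "y n = 0" using y that by blast
    ultimately show ?thesis by (simp only: y_def scaleR_eq_0_iff simp_thms)
  qed
  then show ?case
    using insert.prems(2) insert.hyps by simp
qed simp

lemma direct_sum_criterion:
  fixes C :: "int \<Rightarrow> 'a::real_vector set"
  assumes "\<And>n. subspace (C n)" "span (\<Union>n. C n) = UNIV"
    and "linear \<phi>" "\<And>n x. x \<in> C n \<Longrightarrow> \<phi> x = (2 powi n) *\<^sub>R x"
  shows "\<exists>!c. (\<forall>n. c n \<in> C n) \<and> finite {n. c n \<noteq> 0} \<and> (\<Sum>n | c n \<noteq> 0. c n) = v"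
proof (rule ex_ex1I)
  have "v \<in> span (\<Union>n. C n)" using assms(2) by simp
  then show "\<exists>c. (\<forall>n. c n \<in> C n) \<and> finite {n. c n \<noteq> 0} \<and> (\<Sum>n | c n \<noteq> 0. c n) = v"
  proof (induction rule: span_induct_alt)
    case base
    show ?case
      by (rule exI[of _ "\<lambda>_. 0"]) (use assms(1) in \<open>auto simp: subspace_def\<close>)
  next
    case (step r x w)
    then obtain c m where c: "\<And>n. c n \<in> C n" "finite {n. c n \<noteq> 0}" "(\<Sum>n | c n \<noteq> 0. c n) = w"
      and m: "x \<in> C m" by blast
    define c' where "c' n = c n + (if n = m then r *\<^sub>R x else 0)" for n
    let ?A = "insert m {n. c n \<noteq> 0}"
    have fin: "finite ?A" using c by simp
    have sub: "{n. c' n \<noteq> 0} \<subseteq> ?A" by (auto simp: c'_def)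
    have "(\<Sum>n | c' n \<noteq> 0. c' n) = (\<Sum>n\<in>?A. c' n)"
      by (rule sum.mono_neutral_left[OF fin sub]) auto
    also have "\<dots> = (\<Sum>n\<in>?A. c n) + (\<Sum>n\<in>?A. if n = m then r *\<^sub>R x else 0)"
      by (simp only: c'_def sum.distrib)
    also have "(\<Sum>n\<in>?A. c n) = (\<Sum>n | c n \<noteq> 0. c n)"
      by (rule sum.mono_neutral_right) (use c in auto)
    also have "(\<Sum>n\<in>?A. if n = m then r *\<^sub>R x else 0) = r *\<^sub>R x"
      using fin by (subst sum.delta) auto
    finally have "(\<Sum>n | c' n \<noteq> 0. c' n) = r *\<^sub>R x + w" using c by simp
    moreover have "c' n \<in> C n" for n
      using c(1)[of n] m assms(1)[of n] by (auto simp: c'_def subspace_def)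
    moreover have "finite {n. c' n \<noteq> 0}"
      using fin sub finite_subset by blast
    ultimately show ?case by blast
  qed
next
  fix c d
  assume c: "(\<forall>n. c n \<in> C n) \<and> finite {n. c n \<noteq> 0} \<and> (\<Sum>n | c n \<noteq> 0. c n) = v"
  assume d: "(\<forall>n. d n \<in> C n) \<and> finite {n. d n \<noteq> 0} \<and> (\<Sum>n | d n \<noteq> 0. d n) = v"
  let ?A = "{n. c n \<noteq> 0} \<union> {n. d n \<noteq> 0}"
  have fin: "finite ?A" using c d by simp
  have "(\<Sum>n\<in>?A. c n) = (\<Sum>n | c n \<noteq> 0. c n)" "(\<Sum>n\<in>?A. d n) = (\<Sum>n | d n \<noteq> 0. d n)"
    by (rule sum.mono_neutral_right, use fin in auto)+
  then have "(\<Sum>n\<in>?A. c n - d n) = 0"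
    using c d by (simp add: sum_subtractf)
  moreover have "\<phi> (c n - d n) = (2 powi n) *\<^sub>R (c n - d n)" for n
    using c d assms(1,4) by (simp add: subspace_diff)
  ultimately have *: "\<forall>n\<in>?A. c n - d n = 0"
    by (intro eigenvectors_independent[OF assms(3) fin])
  show "c = d"
  proof
    show "c n = d n" for n
    proof (cases "n \<in> ?A")
      case True
      then have "c n - d n = 0" using * by blast
      then show ?thesis by simp
    qed simp
  qed
qed

text \<open>The shift \<open>V[1]\<close>.\<close>

datatype 'a shift = Shift (unshift: 'a)

instantiation shift :: (real_vector) real_vector
begin

definition "0 = Shift 0"
definition "x + y = Shift (unshift x + unshift y)"
definition "x - y = Shift (unshift x - unshift y)"
definition "- x = Shift (- unshift x)"
definition "c *\<^sub>R x = Shift (c *\<^sub>R unshift x)"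

instance
  by standard
    (simp_all add: zero_shift_def plus_shift_def minus_shift_def uminus_shift_def scaleR_shift_def
      algebra_simps scaleR_add_left)

end

lemma unshift_simps [simp]:
  "unshift 0 = 0" "unshift (x + y) = unshift x + unshift y" "unshift (c *\<^sub>R x) = c *\<^sub>R unshift x"
  by (simp_all add: zero_shift_def plus_shift_def scaleR_shift_def)

lemma linear_unshift: "linear unshift" and linear_Shift: "linear Shift"
  by (auto intro!: linearI simp: plus_shift_def scaleR_shift_def)

lemma surj_Shift: "surj Shift"
  by (metis shift.exhaust surj_def)

instantiation shift :: (graded_vector) graded_vector
begin

definition "gr n = Shift ` gr (n + 1)"

instance
proof
  fix n :: int and x y v :: "'a shift" and c :: real
  show "0 \<in> (gr n :: 'a shift set)"
    by (simp add: gr_shift_def zero_shift_def gr_zero)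
  show "x + y \<in> gr n" if "x \<in> gr n" "y \<in> gr n"
    using that by (auto simp: gr_shift_def plus_shift_def gr_add)
  show "c *\<^sub>R x \<in> gr n" if "x \<in> gr n"
    using that by (auto simp: gr_shift_def scaleR_shift_def gr_scaleR)
  show "\<exists>!c. (\<forall>n. c n \<in> gr n) \<and> finite {n. c n \<noteq> 0} \<and> (\<Sum>n | c n \<noteq> 0. c n) = v"
  proof (rule direct_sum_criterion[where \<phi> = "Shift \<circ> weighted (\<lambda>n. 2 powi (n - 1)) \<circ> unshift"])
    show "subspace (gr n :: 'a shift set)" for n
      unfolding gr_shift_def by (rule linear_subspace_image[OF linear_Shift subspace_gr])
    show "linear (Shift \<circ> weighted (\<lambda>n. 2 powi (n - 1)) \<circ> unshift)"
      by (intro linear_compose linear_unshift linear_weighted linear_Shift)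
    show "(Shift \<circ> weighted (\<lambda>n. 2 powi (n - 1)) \<circ> unshift) x = (2 powi n) *\<^sub>R x"
      if "x \<in> gr n" for n and x :: "'a shift"
      using that by (auto simp: gr_shift_def weighted_homogeneous scaleR_shift_def)
    have "(\<Union>n. gr n) = Shift ` (\<Union>n. gr n)"
    proof -
      have "(\<Union>n. gr n :: 'a shift set) = Shift ` (\<Union>n. gr (n + 1))"
        by (auto simp: gr_shift_def)
      also have "(\<Union>n. gr (n + 1)) = (\<Union>n. gr n :: 'a set)"
      proof (intro subset_antisym subsetI; elim UN_E)
        fix x :: 'a and n assume "x \<in> gr n"
        then show "x \<in> (\<Union>n. gr (n + 1))"
          by (intro UN_I[of "n - 1"]) simp_all
      qed blast
      finally show ?thesis .
    qed
    then show "span (\<Union>n. gr n) = (UNIV :: 'a shift set)"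
      by (simp add: linear_span_image[OF linear_Shift] span_gr surj_Shift)
  qed
qed

end

definition Hom :: "int \<Rightarrow> ('a::graded_vector \<Rightarrow> 'b::graded_vector) set" where
  "Hom p = {f. linear f \<and> (\<forall>n. f ` gr n \<subseteq> gr (n + p))}"

section \<open>Tensor products and graded symmetric algebras\<close>

definition free_lift :: "('x \<Rightarrow> 'b::real_vector) \<Rightarrow> ('x \<Rightarrow>\<^sub>0 real) \<Rightarrow> 'b" where
  "free_lift \<phi> p = (\<Sum>x\<in>Poly_Mapping.keys p. Poly_Mapping.lookup p x *\<^sub>R \<phi> x)"

abbreviation basis :: "'x \<Rightarrow> ('x \<Rightarrow>\<^sub>0 real)" where
  "basis x \<equiv> Poly_Mapping.single x 1"

lemma lookup_scaleR [simp]: "Poly_Mapping.lookup (c *\<^sub>R p) x = c * Poly_Mapping.lookup p x"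
  for p :: "'x \<Rightarrow>\<^sub>0 real"
proof -
  have "finite {i. c * Poly_Mapping.lookup p i \<noteq> 0}"
    by (rule finite_subset[OF _ finite_lookup[of p]]) auto
  then show ?thesis by (simp add: scaleR_poly_mapping_def)
qed

lemma free_lift_superset:
  assumes "finite A" "Poly_Mapping.keys p \<subseteq> A"
  shows "free_lift \<phi> p = (\<Sum>x\<in>A. Poly_Mapping.lookup p x *\<^sub>R \<phi> x)"
  unfolding free_lift_def
  by (rule sum.mono_neutral_left) (use assms in \<open>auto simp: in_keys_iff\<close>)

lemma linear_free_lift: "linear (free_lift \<phi>)"
proof (rule linearI)
  fix p q :: "'a \<Rightarrow>\<^sub>0 real" and c :: real
  let ?A = "Poly_Mapping.keys p \<union> Poly_Mapping.keys q"
  show "free_lift \<phi> (p + q) = free_lift \<phi> p + free_lift \<phi> q"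
    by (simp add: free_lift_superset[of ?A] Poly_Mapping.keys_add lookup_add scaleR_add_left sum.distrib)
  have "free_lift \<phi> (c *\<^sub>R p) = (\<Sum>x\<in>Poly_Mapping.keys p. Poly_Mapping.lookup (c *\<^sub>R p) x *\<^sub>R \<phi> x)"
    by (rule free_lift_superset) (auto simp: in_keys_iff)
  then show "free_lift \<phi> (c *\<^sub>R p) = c *\<^sub>R free_lift \<phi> p"
    by (simp add: free_lift_def scaleR_sum_right)
qed

lemma free_lift_basis [simp]: "free_lift \<phi> (basis x) = \<phi> x"
  by (simp add: free_lift_def)

lemma span_basis: "span (range basis) = (UNIV :: ('x \<Rightarrow>\<^sub>0 real) set)"
proof -
  have "free_lift basis p = p" for p :: "'x \<Rightarrow>\<^sub>0 real"
  proof (rule poly_mapping_eqI)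
    fix k
    show "Poly_Mapping.lookup (free_lift basis p) k = Poly_Mapping.lookup p k"
      by (simp add: free_lift_def lookup_sum lookup_single when_def if_distrib[where f = "\<lambda>x. _ * x"]
          in_keys_iff cong: if_cong)
  qed
  moreover have "free_lift basis p \<in> span (range basis)" for p :: "'x \<Rightarrow>\<^sub>0 real"
    unfolding free_lift_def by (intro span_sum span_scale span_base) blast
  ultimately show ?thesis by (metis UNIV_eq_I)
qed

lemma linear_eq_0_on_span_iff:
  assumes "linear L" "\<And>r. r \<in> R \<Longrightarrow> L r = 0" "p - q \<in> span R"
  shows "L p = L q"
  using linear_eq_0_on_span[OF assms(1,2,3)] linear_diff[OF assms(1)] by auto

subsection \<open>Tensor product of vector spaces\<close>

definition tensor_relations :: "('a::real_vector \<times> 'b::real_vector \<Rightarrow>\<^sub>0 real) set" where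
  "tensor_relations =
     {basis (a + a', b) - basis (a, b) - basis (a', b) | a a' b. True} \<union>
     {basis (a, b + b') - basis (a, b) - basis (a, b') | a b b'. True} \<union>
     {basis (c *\<^sub>R a, b) - c *\<^sub>R basis (a, b) | c a b. True} \<union>
     {basis (a, c *\<^sub>R b) - c *\<^sub>R basis (a, b) | c a b. True}"

quotient_type (overloaded) ('a, 'b) tensor (infixr \<open>\<otimes>\<close> 15) =
  "'a::real_vector \<times> 'b::real_vector \<Rightarrow>\<^sub>0 real" / "\<lambda>p q. p - q \<in> span tensor_relations"
proof (rule equivpI)
  show "reflp (\<lambda>p q. p - q \<in> span tensor_relations)"
    by (rule reflpI) (simp add: span_zero)
  show "symp (\<lambda>p q. p - q \<in> span tensor_relations)"
  proof (rule sympI)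
    fix p q assume "p - q \<in> span tensor_relations"
    then have "- (p - q) \<in> span tensor_relations" by (rule span_neg)
    then show "q - p \<in> span tensor_relations" by simp
  qed
  show "transp (\<lambda>p q. p - q \<in> span tensor_relations)"
  proof (rule transpI)
    fix p q r assume "p - q \<in> span tensor_relations" "q - r \<in> span tensor_relations"
    then have "(p - q) + (q - r) \<in> span tensor_relations" by (rule span_add)
    then show "p - r \<in> span tensor_relations" by simp
  qed
qed

instantiation tensor :: (real_vector, real_vector) real_vector
begin

lift_definition zero_tensor :: "'a \<otimes> 'b" is 0 .
lift_definition plus_tensor :: "'a \<otimes> 'b \<Rightarrow> 'a \<otimes> 'b \<Rightarrow> 'a \<otimes> 'b" is "(+)"
  by (metis add_diff_add span_add)
lift_definition minus_tensor :: "'a \<otimes> 'b \<Rightarrow> 'a \<otimes> 'b \<Rightarrow> 'a \<otimes> 'b" is "(-)"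
proof -
  fix p q r s :: "('a \<times> 'b) \<Rightarrow>\<^sub>0 real"
  have "p - r - (q - s) = (p - q) - (r - s)" by simp
  then show "p - q \<in> span tensor_relations \<Longrightarrow> r - s \<in> span tensor_relations \<Longrightarrow>
      p - r - (q - s) \<in> span tensor_relations"
    by (metis span_diff)
qed
lift_definition uminus_tensor :: "'a \<otimes> 'b \<Rightarrow> 'a \<otimes> 'b" is uminus
  by (metis minus_diff_minus span_neg)
lift_definition scaleR_tensor :: "real \<Rightarrow> 'a \<otimes> 'b \<Rightarrow> 'a \<otimes> 'b" is scaleR
  by (metis scaleR_diff_right span_scale)

instance
  by standard (transfer; simp add: algebra_simps scaleR_add_left scaleR_add_right span_zero)+

end

lift_definition tensor_pure :: "'a::real_vector \<Rightarrow> 'b::real_vector \<Rightarrow> 'a \<otimes> 'b"  (infixr \<open>\<otimes>\<close> 75)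
  is "\<lambda>a b. basis (a, b)" .

definition bilin :: "('a::real_vector \<Rightarrow> 'b::real_vector \<Rightarrow> 'c::real_vector) \<Rightarrow> bool" where
  "bilin B \<longleftrightarrow> (\<forall>b. linear (\<lambda>a. B a b)) \<and> (\<forall>a. linear (B a))"

definition tensor_lift :: "('a::real_vector \<Rightarrow> 'b::real_vector \<Rightarrow> 'c::real_vector) \<Rightarrow> 'a \<otimes> 'b \<Rightarrow> 'c" where
  "tensor_lift B t = free_lift (\<lambda>(a, b). B a b) (rep_tensor t)"

lemma tensor_pure_bilin: "bilin tensor_pure"
proof -
  have "(a + a') \<otimes> b = a \<otimes> b + a' \<otimes> b" for a a' :: 'a and b :: 'b
    by (transfer, rule span_base, unfold tensor_relations_def diff_diff_eq[symmetric]) blast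
  moreover have "a \<otimes> (b + b') = a \<otimes> b + a \<otimes> b'" for a :: 'a and b b' :: 'b
    by (transfer, rule span_base, unfold tensor_relations_def diff_diff_eq[symmetric]) blast
  moreover have "(c *\<^sub>R a) \<otimes> b = c *\<^sub>R (a \<otimes> b)" for c and a :: 'a and b :: 'b
    by (transfer, rule span_base, unfold tensor_relations_def) blast
  moreover have "a \<otimes> (c *\<^sub>R b) = c *\<^sub>R (a \<otimes> b)" for c and a :: 'a and b :: 'b
    by (transfer, rule span_base, unfold tensor_relations_def) blast
  ultimately show ?thesis by (simp add: bilin_def linear_iff)
qed

lemma tensor_lift_abs:
  assumes "bilin B"
  shows "tensor_lift B (abs_tensor p) = free_lift (\<lambda>(a, b). B a b) p"
  unfolding tensor_lift_def
proof (rule linear_eq_0_on_span_iff[OF linear_free_lift])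
  show "rep_tensor (abs_tensor p) - p \<in> span tensor_relations"
    using Quotient3_rep_abs[OF Quotient3_tensor, of p] by (simp add: span_zero)
next
  note lin = linear_diff[OF linear_free_lift] linear_scale[OF linear_free_lift]
  fix r :: "'a \<times> 'b \<Rightarrow>\<^sub>0 real" assume "r \<in> tensor_relations"
  then show "free_lift (\<lambda>(a, b). B a b) r = 0"
    using assms by (auto simp: tensor_relations_def lin bilin_def linear_iff)
qed

lemma tensor_lift_pure [simp]: "bilin B \<Longrightarrow> tensor_lift B (a \<otimes> b) = B a b"
  by (simp add: tensor_pure.abs_eq tensor_lift_abs)

lemma linear_tensor_lift: "bilin B \<Longrightarrow> linear (tensor_lift B)"
proof (rule linearI)
  fix s t :: "'a \<otimes> 'b" and c :: real
  assume B: "bilin B"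
  obtain p q where "s = abs_tensor p" "t = abs_tensor q"
    by (metis Quotient3_abs_rep[OF Quotient3_tensor])
  with B show "tensor_lift B (s + t) = tensor_lift B s + tensor_lift B t"
    and "tensor_lift B (c *\<^sub>R s) = c *\<^sub>R tensor_lift B s"
    by (simp_all add: plus_tensor.abs_eq scaleR_tensor.abs_eq tensor_lift_abs
        linear_add[OF linear_free_lift] linear_scale[OF linear_free_lift])
qed

lemma linear_abs_tensor: "linear abs_tensor"
  by (simp add: linear_iff plus_tensor.abs_eq scaleR_tensor.abs_eq)

lemma surj_abs_tensor: "surj abs_tensor"
  by (metis Quotient3_abs_rep[OF Quotient3_tensor] surj_def)

lemma span_tensor_pure: "span {a \<otimes> b | a b. True} = (UNIV :: ('a::real_vector \<otimes> 'b::real_vector) set)"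
proof -
  have "{a \<otimes> b | a b. True} = abs_tensor ` (range basis :: ('a \<times> 'b \<Rightarrow>\<^sub>0 real) set)"
    by (auto simp: tensor_pure.abs_eq)
  then show ?thesis
    using linear_span_image[OF linear_abs_tensor, of "range basis"] span_basis surj_abs_tensor
    by metis
qed

lemma bilinI:
  assumes "\<And>a a' b. B (a + a') b = B a b + B a' b" "\<And>c a b. B (c *\<^sub>R a) b = c *\<^sub>R B a b"
    and "\<And>a b b'. B a (b + b') = B a b + B a b'" "\<And>c a b. B a (c *\<^sub>R b) = c *\<^sub>R B a b"
  shows "bilin B"
  using assms by (simp add: bilin_def linear_iff)

lemma bilin_simps:
  assumes "bilin B"
  shows "B (a + a') b = B a b + B a' b" "B (c *\<^sub>R a) b = c *\<^sub>R B a b"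
    "B a (b + b') = B a b + B a b'" "B a (c *\<^sub>R b) = c *\<^sub>R B a b"
  using assms by (simp_all add: bilin_def linear_iff)

lemma bilin_zero: assumes "bilin B" shows "B 0 b = 0" "B a 0 = 0"
  using assms linear_0 by (auto simp: bilin_def)

lemmas tensor_pure_simps = bilin_simps[OF tensor_pure_bilin] bilin_zero[OF tensor_pure_bilin]

lemma linear_simps: assumes "linear f"
  shows "f (a + b) = f a + f b" "f (c *\<^sub>R a) = c *\<^sub>R f a"
  using assms by (simp_all add: linear_iff)

lemma bilin_tensor_pure_compose: "linear f \<Longrightarrow> linear g \<Longrightarrow> bilin (\<lambda>a b. f a \<otimes> g b)"
  by (rule bilinI) (simp_all add: linear_simps tensor_pure_simps)

lemma bilin_span_subset:
  assumes "bilin B" "a \<in> span A" "b \<in> span B'"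
  shows "B a b \<in> span {B x y | x y. x \<in> A \<and> y \<in> B'}"
  using assms(2)
proof (induction rule: span_induct_alt)
  case base
  show ?case by (simp add: bilin_zero[OF assms(1)] span_zero)
next
  case (step c x z)
  have "B x b \<in> span {B x y | x y. x \<in> A \<and> y \<in> B'}"
    using assms(3)
  proof (induction rule: span_induct_alt)
    case base
    show ?case by (simp add: bilin_zero[OF assms(1)] span_zero)
  next
    case (step d y w)
    have "B x y \<in> span {B x y | x y. x \<in> A \<and> y \<in> B'}"
      by (rule span_base) (use step \<open>x \<in> A\<close> in blast)
    then show ?case
      unfolding bilin_simps[OF assms(1)] by (intro span_add span_scale step.IH)
  qed
  then show ?case
    unfolding bilin_simps[OF assms(1)] by (intro span_add span_scale step.IH)
qed

instantiation tensor :: (graded_vector, graded_vector) graded_vector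
begin

definition "gr n = span {a \<otimes> b | a b i. a \<in> gr i \<and> b \<in> gr (n - i)}"

instance
proof
  fix n :: int and x y v :: "'a \<otimes> 'b" and c :: real
  show "0 \<in> (gr n :: ('a \<otimes> 'b) set)"
    by (simp add: gr_tensor_def span_zero)
  show "x + y \<in> gr n" if "x \<in> gr n" "y \<in> gr n"
    using that by (simp add: gr_tensor_def span_add)
  show "c *\<^sub>R x \<in> gr n" if "x \<in> gr n"
    using that by (simp add: gr_tensor_def span_scale)
  show "\<exists>!c. (\<forall>n. c n \<in> gr n) \<and> finite {n. c n \<noteq> 0} \<and> (\<Sum>n | c n \<noteq> 0. c n) = v"
  proof (rule direct_sum_criterion)
    let ?w = "weighted (\<lambda>n. 2 powi n)"
    let ?\<phi> = "tensor_lift (\<lambda>(a::'a) (b::'b). ?w a \<otimes> ?w b)"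
    have B: "bilin (\<lambda>(a::'a) (b::'b). ?w a \<otimes> ?w b)"
      by (intro bilin_tensor_pure_compose linear_weighted)
    show "linear ?\<phi>" by (rule linear_tensor_lift[OF B])
    show "subspace (gr n :: ('a \<otimes> 'b) set)" for n
      by (simp add: gr_tensor_def)
    show "?\<phi> x = (2 powi n) *\<^sub>R x" if "x \<in> gr n" for n x
    proof -
      have "linear (\<lambda>x :: 'a \<otimes> 'b. (2 powi n) *\<^sub>R x)"
        by (simp add: linear_iff scaleR_add_right)
      then show ?thesis
        by (rule linear_eq_on_span[OF \<open>linear ?\<phi>\<close> _ _ that[unfolded gr_tensor_def]])
          (auto simp: B weighted_homogeneous tensor_pure_simps power_int_add[symmetric])
    qed
    show "span (\<Union>n. gr n) = (UNIV :: ('a \<otimes> 'b) set)"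
    proof -
      have "a \<otimes> b \<in> span (\<Union>n. gr n)" for a :: 'a and b :: 'b
      proof -
        have "a \<otimes> b \<in> span {x \<otimes> y | x y. x \<in> (\<Union>n. gr n) \<and> y \<in> (\<Union>n. gr n)}"
          by (rule bilin_span_subset[OF tensor_pure_bilin]) (simp_all add: span_gr)
        also have "\<dots> \<subseteq> span (\<Union>n. gr n)"
        proof (rule span_mono, safe)
          fix x :: 'a and y :: 'b and i j assume "x \<in> gr i" "y \<in> gr j"
          then have "x \<otimes> y \<in> gr (i + j)"
            unfolding gr_tensor_def by (intro span_base) force
          then show "x \<otimes> y \<in> (\<Union>n. gr n)" by blast
        qed
        finally show ?thesis .
      qed
      then have "span {a \<otimes> b | a b. True} \<subseteq> span (\<Union>n. gr n :: ('a \<otimes> 'b) set)"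
        by (intro span_minimal) auto
      then show ?thesis using span_tensor_pure by blast
    qed
  qed
qed

end

subsection \<open>Graded symmetric algebra\<close>

text \<open>
  \<open>S(V)\<close> is the tensor algebra modulo graded commutativity. As the tensor algebra is itself the free
  vector space on words modulo multilinearity, both kinds of relations are imposed at once.
\<close>

definition sym_relations :: "('a::graded_vector list \<Rightarrow>\<^sub>0 real) set" where
  "sym_relations =
     {basis (xs @ (a + b) # ys) - basis (xs @ a # ys) - basis (xs @ b # ys) | xs a b ys. True} \<union>
     {basis (xs @ (c *\<^sub>R a) # ys) - c *\<^sub>R basis (xs @ a # ys) | xs c a ys. True} \<union>
     {basis (xs @ a # b # ys) - (-1) powi (m * n) *\<^sub>R basis (xs @ b # a # ys)
       | xs a b ys m n. a \<in> gr m \<and> b \<in> gr n}"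

quotient_type (overloaded) 'a sym =
  "'a::graded_vector list \<Rightarrow>\<^sub>0 real" / "\<lambda>p q. p - q \<in> span sym_relations"
proof (rule equivpI)
  show "reflp (\<lambda>p q. p - q \<in> span sym_relations)"
    by (rule reflpI) (simp add: span_zero)
  show "symp (\<lambda>p q. p - q \<in> span sym_relations)"
  proof (rule sympI)
    fix p q assume "p - q \<in> span sym_relations"
    then have "- (p - q) \<in> span sym_relations" by (rule span_neg)
    then show "q - p \<in> span sym_relations" by simp
  qed
  show "transp (\<lambda>p q. p - q \<in> span sym_relations)"
  proof (rule transpI)
    fix p q r assume "p - q \<in> span sym_relations" "q - r \<in> span sym_relations"
    then have "(p - q) + (q - r) \<in> span sym_relations" by (rule span_add)
    then show "p - r \<in> span sym_relations" by simp
  qed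
qed

instantiation sym :: (graded_vector) real_vector
begin

lift_definition zero_sym :: "'a sym" is 0 .
lift_definition plus_sym :: "'a sym \<Rightarrow> 'a sym \<Rightarrow> 'a sym" is "(+)"
  by (metis add_diff_add span_add)
lift_definition minus_sym :: "'a sym \<Rightarrow> 'a sym \<Rightarrow> 'a sym" is "(-)"
proof -
  fix p q r s :: "'a list \<Rightarrow>\<^sub>0 real"
  have "p - r - (q - s) = (p - q) - (r - s)" by simp
  then show "p - q \<in> span sym_relations \<Longrightarrow> r - s \<in> span sym_relations \<Longrightarrow>
      p - r - (q - s) \<in> span sym_relations"
    by (metis span_diff)
qed
lift_definition uminus_sym :: "'a sym \<Rightarrow> 'a sym" is uminus
  by (metis minus_diff_minus span_neg)
lift_definition scaleR_sym :: "real \<Rightarrow> 'a sym \<Rightarrow> 'a sym" is scaleR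
  by (metis scaleR_diff_right span_scale)

instance
  by standard (transfer; simp add: algebra_simps scaleR_add_left scaleR_add_right span_zero)+

end

text \<open>\<open>word [v\<^sub>1, \<dots>, v\<^sub>n]\<close> is \<open>v\<^sub>1 \<or> \<dots> \<or> v\<^sub>n\<close>.\<close>

lift_definition word :: "'a::graded_vector list \<Rightarrow> 'a sym" is basis .

definition homogeneous :: "int list \<Rightarrow> 'a::graded_vector list \<Rightarrow> bool" where
  "homogeneous ds vs \<longleftrightarrow> list_all2 (\<lambda>d v. v \<in> gr d) ds vs"

definition sym_compatible :: "('a::graded_vector list \<Rightarrow> 'b::real_vector) \<Rightarrow> bool" where
  "sym_compatible \<phi> \<longleftrightarrow>
     (\<forall>xs ys. linear (\<lambda>a. \<phi> (xs @ a # ys))) \<and>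
     (\<forall>xs ys m n a b. a \<in> gr m \<longrightarrow> b \<in> gr n \<longrightarrow>
        \<phi> (xs @ a # b # ys) = (-1) powi (m * n) *\<^sub>R \<phi> (xs @ b # a # ys))"

definition sym_lift :: "('a::graded_vector list \<Rightarrow> 'b::real_vector) \<Rightarrow> 'a sym \<Rightarrow> 'b" where
  "sym_lift \<phi> x = free_lift \<phi> (rep_sym x)"

lemma sym_compatible_word: "sym_compatible word"
proof -
  have add: "word (xs @ (a + b) # ys) = word (xs @ a # ys) + word (xs @ b # ys)" for xs ys and a b :: 'a
    by (transfer, rule span_base, unfold sym_relations_def diff_diff_eq[symmetric]) blast
  have scale: "word (xs @ (c *\<^sub>R a) # ys) = c *\<^sub>R word (xs @ a # ys)" for xs ys c and a :: 'a
    by (transfer, rule span_base, unfold sym_relations_def) blast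
  have swap: "word (xs @ a # b # ys) = (-1) powi (m * n) *\<^sub>R word (xs @ b # a # ys)"
    if "a \<in> gr m" "b \<in> gr n" for xs ys m n and a b :: 'a
  proof -
    have "basis (xs @ a # b # ys) - (-1) powi (m * n) *\<^sub>R basis (xs @ b # a # ys) \<in> sym_relations"
      unfolding sym_relations_def using that
      by (intro UnI2 CollectI exI[of _ xs] exI[of _ a] exI[of _ b] exI[of _ ys] exI[of _ m] exI[of _ n]) simp
    from span_base[OF this] show ?thesis
      by (simp only: word.abs_eq scaleR_sym.abs_eq sym.abs_eq_iff)
  qed
  show ?thesis
    unfolding sym_compatible_def linear_iff by (intro conjI allI impI add scale swap)
qed

lemma sym_lift_abs:
  assumes "sym_compatible \<phi>"
  shows "sym_lift \<phi> (abs_sym p) = free_lift \<phi> p"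
  unfolding sym_lift_def
proof (rule linear_eq_0_on_span_iff[OF linear_free_lift])
  show "rep_sym (abs_sym p) - p \<in> span sym_relations"
    using Quotient3_rep_abs[OF Quotient3_sym, of p] by (simp add: span_zero)
next
  note lin = linear_diff[OF linear_free_lift] linear_scale[OF linear_free_lift]
  fix r :: "'a list \<Rightarrow>\<^sub>0 real" assume "r \<in> sym_relations"
  then show "free_lift \<phi> r = 0"
    unfolding sym_relations_def
  proof (elim UnE CollectE exE conjE)
    fix xs a b ys assume "r = basis (xs @ (a + b) # ys) - basis (xs @ a # ys) - basis (xs @ b # ys)"
    moreover have "linear (\<lambda>a. \<phi> (xs @ a # ys))" using assms by (simp add: sym_compatible_def)
    ultimately show ?thesis by (simp add: lin linear_iff)
  next
    fix xs c a ys assume "r = basis (xs @ (c *\<^sub>R a) # ys) - c *\<^sub>R basis (xs @ a # ys)"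
    moreover have "linear (\<lambda>a. \<phi> (xs @ a # ys))" using assms by (simp add: sym_compatible_def)
    ultimately show ?thesis by (simp add: lin linear_iff)
  next
    fix xs a b ys m n
    assume "r = basis (xs @ a # b # ys) - (-1) powi (m * n) *\<^sub>R basis (xs @ b # a # ys)"
      and ab: "a \<in> gr m" "b \<in> gr n"
    moreover have "\<phi> (xs @ a # b # ys) = (-1) powi (m * n) *\<^sub>R \<phi> (xs @ b # a # ys)"
      using assms ab unfolding sym_compatible_def by blast
    ultimately show ?thesis by (simp only: lin free_lift_basis diff_self)
  qed
qed

lemma sym_lift_word [simp]: "sym_compatible \<phi> \<Longrightarrow> sym_lift \<phi> (word xs) = \<phi> xs"
  by (simp add: word.abs_eq sym_lift_abs)

lemma linear_sym_lift: "sym_compatible \<phi> \<Longrightarrow> linear (sym_lift \<phi>)"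
proof (rule linearI)
  fix s t :: "'a sym" and c :: real
  assume B: "sym_compatible \<phi>"
  obtain p q where "s = abs_sym p" "t = abs_sym q"
    by (metis Quotient3_abs_rep[OF Quotient3_sym])
  with B show "sym_lift \<phi> (s + t) = sym_lift \<phi> s + sym_lift \<phi> t"
    and "sym_lift \<phi> (c *\<^sub>R s) = c *\<^sub>R sym_lift \<phi> s"
    by (simp_all add: plus_sym.abs_eq scaleR_sym.abs_eq sym_lift_abs
        linear_add[OF linear_free_lift] linear_scale[OF linear_free_lift])
qed

lemma linear_abs_sym: "linear abs_sym"
  by (simp add: linear_iff plus_sym.abs_eq scaleR_sym.abs_eq)

lemma surj_abs_sym: "surj abs_sym"
  by (metis Quotient3_abs_rep[OF Quotient3_sym] surj_def)

lemma span_word: "span (range word) = (UNIV :: 'a::graded_vector sym set)"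
proof -
  have "range word = abs_sym ` (range basis :: ('a list \<Rightarrow>\<^sub>0 real) set)"
    by (auto simp: word.abs_eq)
  then show ?thesis
    using linear_span_image[OF linear_abs_sym, of "range basis"] span_basis surj_abs_sym
    by metis
qed

lemma span_homogeneous_word: "span {word vs | vs ds. homogeneous ds vs} = (UNIV :: 'a::graded_vector sym set)"
proof -
  have "word (us @ vs) \<in> span {word vs | vs ds. homogeneous ds vs}" if "homogeneous ds us"
    for us vs :: "'a list" and ds
    using that
  proof (induction vs arbitrary: us ds)
    case Nil
    then show ?case by (auto intro: span_base)
  next
    case (Cons v vs)
    have lin: "linear (\<lambda>v. word (us @ v # vs))"
      using sym_compatible_word by (auto simp: sym_compatible_def)
    have "word (us @ gr_components v n # vs) \<in> span {word vs | vs ds. homogeneous ds vs}" for n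
      using Cons.IH[of "ds @ [n]" "us @ [gr_components v n]"] Cons.prems
      by (simp add: homogeneous_def components_gr list_all2_appendI)
    then have "(\<Sum>n | gr_components v n \<noteq> 0. word (us @ gr_components v n # vs))
        \<in> span {word vs | vs ds. homogeneous ds vs}"
      by (intro span_sum)
    then show ?case
      by (simp add: linear_sum[OF lin, symmetric] sum_components)
  qed
  from this[of "[]" "[]"] have "range word \<subseteq> span {word vs | vs ds. homogeneous (ds :: int list) (vs :: 'a list)}"
    by (auto simp: homogeneous_def)
  then have "span (range word) \<subseteq> span {word vs | vs ds. homogeneous (ds :: int list) (vs :: 'a list)}"
    by (intro span_minimal) auto
  then show ?thesis using span_word by blast
qed

instantiation sym :: (graded_vector) graded_vector
begin

definition "gr n = span {word vs | vs ds. homogeneous ds vs \<and> sum_list ds = n}"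

instance
proof
  fix n :: int and x y v :: "'a sym" and c :: real
  show "0 \<in> (gr n :: 'a sym set)"
    by (simp add: gr_sym_def span_zero)
  show "x + y \<in> gr n" if "x \<in> gr n" "y \<in> gr n"
    using that by (simp add: gr_sym_def span_add)
  show "c *\<^sub>R x \<in> gr n" if "x \<in> gr n"
    using that by (simp add: gr_sym_def span_scale)
  show "\<exists>!c. (\<forall>n. c n \<in> gr n) \<and> finite {n. c n \<noteq> 0} \<and> (\<Sum>n | c n \<noteq> 0. c n) = v"
  proof (rule direct_sum_criterion)
    let ?w = "weighted (\<lambda>n. 2 powi n) :: 'a \<Rightarrow> 'a"
    let ?\<phi> = "sym_lift (\<lambda>vs. word (map ?w vs))"
    have lin: "linear (\<lambda>v. word (xs @ v # ys))" for xs ys :: "'a list"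
      using sym_compatible_word by (auto simp: sym_compatible_def)
    have swap: "word (xs @ a # b # ys) = (-1) powi (m * n) *\<^sub>R word (xs @ b # a # ys)"
      if "a \<in> gr m" "b \<in> gr n" for xs ys m n and a b :: 'a
      using sym_compatible_word that unfolding sym_compatible_def by blast
    have C: "sym_compatible (\<lambda>vs. word (map ?w vs))"
      unfolding sym_compatible_def
    proof (intro conjI allI impI)
      show "linear (\<lambda>a. word (map ?w (xs @ a # ys)))" for xs ys
        using linear_compose[OF linear_weighted lin] by (simp add: o_def)
      show "word (map ?w (xs @ a # b # ys)) = (-1) powi (m * n) *\<^sub>R word (map ?w (xs @ b # a # ys))"
        if "a \<in> gr m" "b \<in> gr n" for xs ys a b m n
        using swap[OF gr_scaleR gr_scaleR, OF that] that by (simp add: weighted_homogeneous)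
    qed
    show "linear ?\<phi>" by (rule linear_sym_lift[OF C])
    show "subspace (gr n :: 'a sym set)" for n
      by (simp add: gr_sym_def)
    have *: "word (us @ map ?w vs) = (2 powi sum_list ds) *\<^sub>R word (us @ vs)"
      if "homogeneous ds vs" for us vs ds
      using that
    proof (induction vs arbitrary: us ds)
      case (Cons v vs)
      then obtain d es where ds: "ds = d # es" "v \<in> gr d" "homogeneous es vs"
        by (auto simp: homogeneous_def list_all2_Cons2)
      have "word (us @ map ?w (v # vs)) = word ((us @ [?w v]) @ map ?w vs)" by simp
      also have "\<dots> = (2 powi sum_list es) *\<^sub>R word (us @ ?w v # vs)"
        by (subst Cons.IH[OF ds(3)]) simp
      finally show ?case
        using ds by (simp add: weighted_homogeneous linear_scale[OF lin] power_int_add)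
    qed (auto simp: homogeneous_def)
    show "?\<phi> x = (2 powi n) *\<^sub>R x" if "x \<in> gr n" for n x
    proof -
      have "linear (\<lambda>x :: 'a sym. (2 powi n) *\<^sub>R x)"
        by (simp add: linear_iff scaleR_add_right)
      then show ?thesis
        by (rule linear_eq_on_span[OF \<open>linear ?\<phi>\<close> _ _ that[unfolded gr_sym_def]])
          (use *[where us = "[]"] C in auto)
    qed
    have "{word vs | vs ds. homogeneous ds vs} \<subseteq> (\<Union>n. gr n :: 'a sym set)"
      unfolding gr_sym_def by (auto intro: span_base)
    then show "span (\<Union>n. gr n) = (UNIV :: 'a sym set)"
      using span_homogeneous_word span_mono by blast
  qed
qed

end

section \<open>Structure maps of the symmetric algebra\<close>

lemma linear_bilin: "bilin B \<Longrightarrow> linear (\<lambda>a. B a b)" "bilin B \<Longrightarrow> linear (B a)"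
  by (simp_all add: bilin_def)

text \<open>\<open>tensor_map q f g\<close> is \<open>f \<otimes> g\<close> for \<open>g\<close> homogeneous of degree \<open>q\<close>; see \<open>tensor_map_pure\<close>.\<close>

definition tensor_map ::
    "int \<Rightarrow> ('a::graded_vector \<Rightarrow> 'c::real_vector) \<Rightarrow> ('b::real_vector \<Rightarrow> 'd::real_vector) \<Rightarrow> 'a \<otimes> 'b \<Rightarrow> 'c \<otimes> 'd" where
  "tensor_map q f g = tensor_lift (\<lambda>v w. f (weighted (\<lambda>n. (-1) powi (q * n)) v) \<otimes> g w)"

lemma bilin_tensor_map:
  assumes "linear f" "linear g"
  shows "bilin (\<lambda>v w. f (weighted s v) \<otimes> g w)"
  using bilin_tensor_pure_compose[OF linear_compose[OF linear_weighted assms(1)] assms(2)]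
  by (simp add: o_def)

lemma tensor_map_pure:
  assumes "linear f" "linear g" "v \<in> gr n"
  shows "tensor_map q f g (v \<otimes> w) = (-1) powi (q * n) *\<^sub>R (f v \<otimes> g w)"
  by (simp add: tensor_map_def bilin_tensor_map[OF assms(1,2)] weighted_homogeneous[OF assms(3)]
      linear_simps[OF assms(1)] tensor_pure_simps)

lemma linear_tensor_map: "linear f \<Longrightarrow> linear g \<Longrightarrow> linear (tensor_map q f g)"
  unfolding tensor_map_def by (intro linear_tensor_lift bilin_tensor_map)

definition assoc :: "('a::real_vector \<otimes> 'b::real_vector) \<otimes> 'c::real_vector \<Rightarrow> 'a \<otimes> 'b \<otimes> 'c" where
  "assoc = tensor_lift (\<lambda>t c. tensor_lift (\<lambda>a b. a \<otimes> b \<otimes> c) t)"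

lemma tensor_eqI:
  assumes "linear f" "linear g" "\<And>n v w. v \<in> gr n \<Longrightarrow> f (v \<otimes> w) = g (v \<otimes> w)"
  shows "f = (g :: 'a::graded_vector \<otimes> 'b::real_vector \<Rightarrow> 'c::real_vector)"
proof
  fix t :: "'a \<otimes> 'b"
  have "f (v \<otimes> w) = g (v \<otimes> w)" for v w
  proof -
    have lin: "linear (\<lambda>v :: 'a. v \<otimes> w)" by (rule linear_bilin[OF tensor_pure_bilin])
    have eq: "v \<otimes> w = (\<Sum>n | gr_components v n \<noteq> 0. gr_components v n \<otimes> w)"
      using linear_sum[OF lin, of "gr_components v" "{n. gr_components v n \<noteq> 0}"]
      by (simp only: sum_components)
    show ?thesis
      unfolding eq linear_sum[OF assms(1)] linear_sum[OF assms(2)]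
      by (intro sum.cong refl assms(3)[OF components_gr])
  qed
  then have "\<And>x. x \<in> {v \<otimes> w | v w. True} \<Longrightarrow> f x = g x" by blast
  moreover have "t \<in> span {v \<otimes> w | v w. True}" by (simp only: span_tensor_pure UNIV_I)
  ultimately show "f t = g t" by (rule linear_eq_on_span[OF assms(1,2)])
qed

lemma bilin_assoc: "bilin (\<lambda>t c. tensor_lift (\<lambda>a b. a \<otimes> b \<otimes> c) t)"
proof -
  have B: "bilin (\<lambda>(a :: 'a) (b :: 'b). a \<otimes> b \<otimes> c)" for c :: 'c
    by (rule bilinI) (simp_all add: tensor_pure_simps)
  have lin: "linear (\<lambda>c :: 'c. tensor_lift (\<lambda>a b. a \<otimes> b \<otimes> c) t)" for t :: "'a \<otimes> 'b"
  proof -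
    have "t \<in> span {a \<otimes> b | a b. True}" by (simp only: span_tensor_pure UNIV_I)
    then show ?thesis
    proof (induction rule: span_induct_alt)
      case base
      then show ?case by (simp add: linear_0[OF linear_tensor_lift[OF B]] linear_iff)
    next
      case (step r x y)
      from step(1) obtain a b where x: "x = a \<otimes> b" by blast
      have "linear (\<lambda>c :: 'c. tensor_lift (\<lambda>a b. a \<otimes> b \<otimes> c) x)"
        unfolding x tensor_lift_pure[OF B] by (simp add: linear_iff tensor_pure_simps)
      with step(2) show ?case
        by (simp add: linear_simps[OF linear_tensor_lift[OF B]] linear_iff scaleR_add_right)
    qed
  qed
  show ?thesis unfolding bilin_def using lin linear_tensor_lift[OF B] by blast
qed

lemma linear_assoc: "linear assoc"
  unfolding assoc_def by (rule linear_tensor_lift[OF bilin_assoc])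

lemma assoc_pure [simp]: "assoc ((a \<otimes> b) \<otimes> c) = a \<otimes> b \<otimes> c"
proof -
  have "bilin (\<lambda>a b. a \<otimes> b \<otimes> c)"
    by (rule bilinI) (simp_all add: tensor_pure_simps)
  from tensor_lift_pure[OF this] show ?thesis
    unfolding assoc_def tensor_lift_pure[OF bilin_assoc] .
qed

definition sym_one :: "'a::graded_vector sym" where
  "sym_one = word []"

definition sym_incl :: "'a::graded_vector \<Rightarrow> 'a sym" where
  "sym_incl v = word [v]"

text \<open>The projection \<open>S(V) \<rightarrow> S\<^sup>1(V) = V\<close>.\<close>

definition sym_proj :: "'a::graded_vector sym \<Rightarrow> 'a" where
  "sym_proj = sym_lift (\<lambda>vs. case vs of [v] \<Rightarrow> v | _ \<Rightarrow> 0)"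

lemma sym_compatible_proj: "sym_compatible (\<lambda>vs. case vs of [v] \<Rightarrow> v | _ \<Rightarrow> 0)"
proof -
  have *: "(case xs @ a # ys of [v] \<Rightarrow> v | _ \<Rightarrow> 0) = (if xs = [] \<and> ys = [] then a else 0)"
    for xs ys and a :: 'a
    by (cases xs; cases ys) (auto split: list.splits)
  have "linear (\<lambda>a. if xs = [] \<and> ys = [] then a else 0)" for xs ys :: "'a list"
    by (auto simp: linear_iff)
  then show ?thesis
    unfolding sym_compatible_def using * by auto
qed

lemma linear_sym_proj: "linear sym_proj"
  unfolding sym_proj_def by (rule linear_sym_lift[OF sym_compatible_proj])

lemma sym_proj_word: "sym_proj (word vs) = (case vs of [v] \<Rightarrow> v | _ \<Rightarrow> 0)"
  by (simp add: sym_proj_def sym_compatible_proj)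

definition vee :: "'a::graded_vector sym \<Rightarrow> 'a sym \<Rightarrow> 'a sym" where
  "vee x y = sym_lift (\<lambda>xs. sym_lift (\<lambda>ys. word (xs @ ys)) y) x"

lemma sym_compatible_append: "sym_compatible (\<lambda>ys. word (xs @ ys))"
  using sym_compatible_word unfolding sym_compatible_def append_assoc[symmetric] by blast

lemma sym_compatible_append': "sym_compatible (\<lambda>xs. word (xs @ ys))"
  using sym_compatible_word unfolding sym_compatible_def append_assoc append_Cons by blast

lemma sym_compatible_lincomb:
  assumes "sym_compatible \<phi>" "sym_compatible \<psi>"
  shows "sym_compatible (\<lambda>xs. c *\<^sub>R \<phi> xs + \<psi> xs)"
  unfolding sym_compatible_def
proof (intro conjI allI impI)
  show "linear (\<lambda>a. c *\<^sub>R \<phi> (xs @ a # ys) + \<psi> (xs @ a # ys))" for xs ys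
    using assms by (simp add: sym_compatible_def linear_iff scaleR_add_right)
  fix xs ys m n and a b :: 'a assume "a \<in> gr m" "b \<in> gr n"
  then have "\<phi> (xs @ a # b # ys) = (-1) powi (m * n) *\<^sub>R \<phi> (xs @ b # a # ys)"
    "\<psi> (xs @ a # b # ys) = (-1) powi (m * n) *\<^sub>R \<psi> (xs @ b # a # ys)"
    using assms unfolding sym_compatible_def by blast+
  then show "c *\<^sub>R \<phi> (xs @ a # b # ys) + \<psi> (xs @ a # b # ys) =
      (-1) powi (m * n) *\<^sub>R (c *\<^sub>R \<phi> (xs @ b # a # ys) + \<psi> (xs @ b # a # ys))"
    by (simp only: scaleR_add_right scaleR_left_commute)
qed

lemma sym_compatible_vee: "sym_compatible (\<lambda>xs. sym_lift (\<lambda>ys. word (xs @ ys)) y)"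
proof -
  have "y \<in> span (range word)" by (simp add: span_word)
  then show ?thesis
  proof (induction rule: span_induct_alt)
    case base
    show ?case
      by (simp add: linear_0[OF linear_sym_lift[OF sym_compatible_append]] sym_compatible_def linear_iff)
  next
    case (step c x y)
    have "sym_compatible (\<lambda>xs. sym_lift (\<lambda>ys. word (xs @ ys)) x)"
      using step(1) by (auto simp: sym_compatible_append sym_compatible_append')
    from sym_compatible_lincomb[OF this step(2)] show ?case
      by (simp add: linear_simps[OF linear_sym_lift[OF sym_compatible_append]])
  qed
qed

lemma vee_word [simp]: "vee (word xs) (word ys) = word (xs @ ys)"
  by (simp add: vee_def sym_compatible_append sym_compatible_append')

lemma bilin_vee: "bilin vee"
proof -
  have L: "linear (\<lambda>x. vee x y)" for y :: "'a sym"
    unfolding vee_def by (rule linear_sym_lift[OF sym_compatible_vee])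
  have "linear (vee x)" for x :: "'a sym"
  proof -
    have "x \<in> span (range word)" by (simp add: span_word)
    then show ?thesis
    proof (induction rule: span_induct_alt)
      case base
      show ?case by (simp add: linear_0[OF L] linear_iff)
    next
      case (step c x x')
      have "linear (vee x)"
        using step(1) linear_sym_lift[OF sym_compatible_append]
        by (auto simp: vee_def[abs_def] sym_compatible_vee)
      with step(2) show ?case
        by (simp add: linear_simps[OF L] linear_iff scaleR_add_right scaleR_left_commute)
    qed
  qed
  with L show ?thesis by (simp add: bilin_def)
qed

definition sym_mult :: "'a::graded_vector sym \<otimes> 'a sym \<Rightarrow> 'a sym" where
  "sym_mult = tensor_lift vee"

lemma linear_sym_mult: "linear sym_mult"
  and sym_mult_pure [simp]: "sym_mult (x \<otimes> y) = vee x y"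
  by (simp_all add: sym_mult_def bilin_vee linear_tensor_lift)

text \<open>Permutations act on the index set \<open>{0, \<dots>, n - 1}\<close>.\<close>

definition Sh :: "nat \<Rightarrow> nat \<Rightarrow> (nat \<Rightarrow> nat) set" where
  "Sh k l = {\<sigma>. \<sigma> permutes {..<k + l} \<and> strict_mono_on {..<k} \<sigma> \<and> strict_mono_on {k..<k + l} \<sigma>}"

definition koszul_sign :: "int list \<Rightarrow> (nat \<Rightarrow> nat) \<Rightarrow> real" where
  "koszul_sign ds \<sigma> =
     (\<Prod>(i, j) \<in> {(i, j). i < j \<and> j < length ds \<and> \<sigma> j < \<sigma> i}. (-1) powi (ds ! \<sigma> i * ds ! \<sigma> j))"

definition shuffle_sum :: "int list \<Rightarrow> 'a::graded_vector list \<Rightarrow> 'a sym \<otimes> 'a sym" where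
  "shuffle_sum ds vs =
     (\<Sum>k\<le>length vs. \<Sum>\<sigma>\<in>Sh k (length vs - k).
        koszul_sign ds \<sigma> *\<^sub>R
          (word (map (\<lambda>i. vs ! \<sigma> i) [0..<k]) \<otimes> word (map (\<lambda>i. vs ! \<sigma> i) [k..<length vs])))"

text \<open>
  The shuffle formula determines the coproduct on products of homogeneous elements. Existence and
  uniqueness of its linear extension are shown in \<open>ex1_coprod\<close>.\<close>

definition coprod :: "'a::graded_vector sym \<Rightarrow> 'a sym \<otimes> 'a sym" where
  "coprod = (THE D. linear D \<and> (\<forall>ds vs. homogeneous ds vs \<longrightarrow> D (word vs) = shuffle_sum ds vs))"

lemma sgn_powi: "(-1::real) powi n = (if even n then 1 else -1)"
  by (simp add: power_int_minus_left)

definition sym_cons :: "'a::graded_vector \<Rightarrow> 'a sym \<Rightarrow> 'a sym" where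
  "sym_cons v = vee (word [v])"

lemma sym_cons_word [simp]: "sym_cons v (word vs) = word (v # vs)"
  by (simp add: sym_cons_def)

lemma linear_word_Cons: "linear (\<lambda>a. word (xs @ a # ys))"
  using sym_compatible_word by (auto simp: sym_compatible_def)

lemma bilin_sym_cons: "bilin sym_cons"
proof -
  have "word [v + w] = word [v] + word [w]" "word [c *\<^sub>R v] = c *\<^sub>R word [v]" for v w :: 'a and c
    using linear_simps[OF linear_word_Cons[of "[]" "[]"]] by simp_all
  then show ?thesis
    by (intro bilinI) (simp_all add: sym_cons_def bilin_simps[OF bilin_vee])
qed

lemma sym_cons_gr: "v \<in> gr m \<Longrightarrow> x \<in> gr n \<Longrightarrow> sym_cons v x \<in> gr (m + n)"
proof -
  assume v: "v \<in> gr m" and "x \<in> gr n"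
  have lin: "linear (sym_cons v)" by (rule linear_bilin[OF bilin_sym_cons])
  have "sym_cons v x \<in> span (sym_cons v ` {word vs | vs ds. homogeneous ds vs \<and> sum_list ds = n})"
    using \<open>x \<in> gr n\<close> linear_span_image[OF lin] unfolding gr_sym_def by blast
  also have "\<dots> \<subseteq> gr (m + n)"
    unfolding gr_sym_def
  proof (rule span_mono, clarsimp)
    fix vs :: "'a list" and ds assume "homogeneous ds vs"
    then show "\<exists>vsa. word (v # vs) = word vsa \<and> (\<exists>dsa. homogeneous dsa vsa \<and> sum_list dsa = m + sum_list ds)"
      using v by (intro exI[of _ "v # vs"] conjI refl exI[of _ "m # ds"]) (auto simp: homogeneous_def)
  qed
  finally show ?thesis .
qed

lemma sym_cons_swap:
  assumes "a \<in> gr m" "b \<in> gr n"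
  shows "sym_cons a (sym_cons b x) = (-1) powi (m * n) *\<^sub>R sym_cons b (sym_cons a x)"
proof -
  have lin: "linear (sym_cons v)" for v :: 'a by (rule linear_bilin[OF bilin_sym_cons])
  have "linear (\<lambda>x. sym_cons a (sym_cons b x))" "linear (\<lambda>x. (-1) powi (m * n) *\<^sub>R sym_cons b (sym_cons a x))"
    by (simp_all add: linear_iff linear_simps[OF lin] scaleR_add_right scaleR_left_commute)
  then show ?thesis
  proof (rule linear_eq_on_span)
    show "x \<in> span (range word)" by (simp add: span_word)
    fix y :: "'a sym" assume "y \<in> range word"
    then obtain vs where y: "y = word vs" by blast
    have "word ([] @ a # b # vs) = (-1) powi (m * n) *\<^sub>R word ([] @ b # a # vs)"
      using sym_compatible_word assms unfolding sym_compatible_def by blast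
    then show "sym_cons a (sym_cons b y) = (-1) powi (m * n) *\<^sub>R sym_cons b (sym_cons a y)"
      by (simp only: y sym_cons_word append_Nil)
  qed
qed

text \<open>Multiplication by \<open>v \<otimes> 1 + 1 \<otimes> v\<close>, used to construct the coproduct.\<close>

definition cop_step :: "'a::graded_vector \<Rightarrow> 'a sym \<otimes> 'a sym \<Rightarrow> 'a sym \<otimes> 'a sym" where
  "cop_step v = tensor_lift (\<lambda>x y. sym_cons v x \<otimes> y +
     (weighted (\<lambda>n. if even n then 1 else 0) x \<otimes> sym_cons v y +
      weighted (\<lambda>n. if even n then 0 else 1) x \<otimes> sym_cons (weighted (\<lambda>n. (-1) powi n) v) y))"

lemma bilin_cop_step_aux: "bilin (\<lambda>x y. sym_cons v x \<otimes> y +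
     (weighted (\<lambda>n. if even n then 1 else 0) x \<otimes> sym_cons v y +
      weighted (\<lambda>n. if even n then 0 else 1) x \<otimes> sym_cons (weighted (\<lambda>n. (-1) powi n) v) y))"
  by (rule bilinI)
    (simp_all add: bilin_simps[OF bilin_sym_cons] linear_simps[OF linear_weighted] tensor_pure_simps
      scaleR_add_right)

lemma cop_step_pure:
  assumes "v \<in> gr m" "x \<in> gr n"
  shows "cop_step v (x \<otimes> y) = sym_cons v x \<otimes> y + (-1) powi (m * n) *\<^sub>R (x \<otimes> sym_cons v y)"
  unfolding cop_step_def tensor_lift_pure[OF bilin_cop_step_aux]
  using assms
  by (auto simp: weighted_homogeneous bilin_simps[OF bilin_sym_cons] bilin_zero[OF bilin_sym_cons]
      tensor_pure_simps sgn_powi)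

lemma linear_cop_step: "linear (cop_step v)"
  unfolding cop_step_def by (rule linear_tensor_lift[OF bilin_cop_step_aux])

lemma linear_cop_step': "linear (\<lambda>v. cop_step v t)"
proof -
  have "t \<in> span {x \<otimes> y | x y. True}" by (simp only: span_tensor_pure UNIV_I)
  then show ?thesis
  proof (induction rule: span_induct_alt)
    case base
    show ?case by (simp add: linear_0[OF linear_cop_step] linear_iff)
  next
    case (step c s t)
    from step(1) obtain x y where s: "s = x \<otimes> y" by blast
    have "linear (\<lambda>v. cop_step v s)"
      unfolding cop_step_def s tensor_lift_pure[OF bilin_cop_step_aux]
      by (simp add: linear_iff bilin_simps[OF bilin_sym_cons]
          linear_simps[OF linear_weighted] tensor_pure_simps scaleR_add_right)
    with step(2) show ?case
      by (simp add: linear_simps[OF linear_cop_step] linear_iff scaleR_add_right scaleR_left_commute)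
  qed
qed

lemma cop_step_swap:
  assumes "a \<in> gr m" "b \<in> gr n"
  shows "cop_step a (cop_step b t) = (-1) powi (m * n) *\<^sub>R cop_step b (cop_step a t)"
proof -
  have "(\<lambda>t. cop_step a (cop_step b t)) = (\<lambda>t. (-1) powi (m * n) *\<^sub>R cop_step b (cop_step a t))"
  proof (rule tensor_eqI)
    show "linear (\<lambda>t. cop_step a (cop_step b t))" "linear (\<lambda>t. (-1) powi (m * n) *\<^sub>R cop_step b (cop_step a t))"
      by (simp_all add: linear_iff linear_simps[OF linear_cop_step] scaleR_add_right scaleR_left_commute)
    fix p and x y :: "'a sym" assume x: "x \<in> gr p"
    note st = cop_step_pure[OF assms(1)] cop_step_pure[OF assms(2)]
    have ax: "sym_cons a x \<in> gr (m + p)" and bx: "sym_cons b x \<in> gr (n + p)"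
      using x assms by (auto intro: sym_cons_gr)
    have sw: "sym_cons a (sym_cons b z) = (-1) powi (m * n) *\<^sub>R sym_cons b (sym_cons a z)" for z
      by (rule sym_cons_swap[OF assms])
    show "cop_step a (cop_step b (x \<otimes> y)) = (-1) powi (m * n) *\<^sub>R cop_step b (cop_step a (x \<otimes> y))"
      by (simp add: st[OF x] st[OF ax] st[OF bx] linear_simps[OF linear_cop_step] sw tensor_pure_simps)
        (auto simp: sgn_powi scaleR_add_right)
  qed
  then show ?thesis by metis
qed

definition cop_word :: "'a::graded_vector list \<Rightarrow> 'a sym \<otimes> 'a sym" where
  "cop_word vs = foldr cop_step vs (word [] \<otimes> word [])"

lemma linear_foldr_cop_step: "linear (foldr cop_step vs)"
proof (induction vs)
  case (Cons v vs)
  then show ?case using linear_compose[OF Cons linear_cop_step] by (simp add: o_def)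
qed (simp add: linear_iff)

lemma sym_compatible_cop_word: "sym_compatible cop_word"
  unfolding sym_compatible_def
proof (intro conjI allI impI)
  show "linear (\<lambda>a. cop_word (xs @ a # ys))" for xs ys :: "'a list"
    using linear_compose[OF linear_cop_step' linear_foldr_cop_step]
    by (simp add: cop_word_def o_def)
  show "cop_word (xs @ a # b # ys) = (-1) powi (m * n) *\<^sub>R cop_word (xs @ b # a # ys)"
    if "a \<in> gr m" "b \<in> gr n" for xs ys m n and a b :: 'a
    unfolding cop_word_def
    by (simp add: cop_step_swap[OF that] linear_simps[OF linear_foldr_cop_step])
qed

lemma permutes_lessThan_iff:
  "\<sigma> permutes {..<n} \<longleftrightarrow> (\<forall>i\<ge>n. \<sigma> i = i) \<and> inj_on \<sigma> {..<n} \<and> (\<forall>i<n. \<sigma> i < n)" for \<sigma> :: "nat \<Rightarrow> nat"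
proof
  assume *: "\<sigma> permutes {..<n}"
  then show "(\<forall>i\<ge>n. \<sigma> i = i) \<and> inj_on \<sigma> {..<n} \<and> (\<forall>i<n. \<sigma> i < n)"
    using permutes_in_image[OF *] permutes_inj_on[OF *] permutes_not_in[OF *] by auto
next
  assume *: "(\<forall>i\<ge>n. \<sigma> i = i) \<and> inj_on \<sigma> {..<n} \<and> (\<forall>i<n. \<sigma> i < n)"
  then have "bij_betw \<sigma> {..<n} {..<n}"
    by (intro bij_betw_imageI endo_inj_surj) auto
  then show "\<sigma> permutes {..<n}"
    by (rule bij_imp_permutes) (use * in auto)
qed

definition perm_up :: "(nat \<Rightarrow> nat) \<Rightarrow> nat \<Rightarrow> nat" where
  "perm_up \<sigma> i = (case i of 0 \<Rightarrow> 0 | Suc j \<Rightarrow> Suc (\<sigma> j))"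

definition perm_down :: "(nat \<Rightarrow> nat) \<Rightarrow> nat \<Rightarrow> nat" where
  "perm_down \<sigma> i = \<sigma> (Suc i) - 1"

definition perm_ins :: "nat \<Rightarrow> (nat \<Rightarrow> nat) \<Rightarrow> nat \<Rightarrow> nat" where
  "perm_ins k \<sigma> i = (if i < k then Suc (\<sigma> i) else if i = k then 0 else Suc (\<sigma> (i - 1)))"

definition perm_del :: "nat \<Rightarrow> (nat \<Rightarrow> nat) \<Rightarrow> nat \<Rightarrow> nat" where
  "perm_del k \<sigma> i = (if i < k then \<sigma> i - 1 else \<sigma> (Suc i) - 1)"

lemma mem_Sh:
  assumes "k \<le> n"
  shows "\<sigma> \<in> Sh k (n - k) \<longleftrightarrow> (\<forall>i\<ge>n. \<sigma> i = i) \<and> inj \<sigma> \<and> (\<forall>i<n. \<sigma> i < n) \<and>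
    (\<forall>i j. i < j \<longrightarrow> j < k \<longrightarrow> \<sigma> i < \<sigma> j) \<and> (\<forall>i j. k \<le> i \<longrightarrow> i < j \<longrightarrow> j < n \<longrightarrow> \<sigma> i < \<sigma> j)"
    (is "_ \<longleftrightarrow> ?R")
proof -
  have k: "k + (n - k) = n" using assms by simp
  show ?thesis
  proof
    assume "\<sigma> \<in> Sh k (n - k)"
    then have \<sigma>: "\<sigma> permutes {..<n}" "strict_mono_on {..<k} \<sigma>" "strict_mono_on {k..<n} \<sigma>"
      by (simp_all add: Sh_def k)
    have "inj \<sigma>" by (rule permutes_inj[OF \<sigma>(1)])
    with \<sigma> show ?R
      by (auto simp: permutes_lessThan_iff strict_mono_on_def)
  next
    assume R: ?R
    then have "inj_on \<sigma> {..<n}" by (auto intro: inj_on_subset)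
    with R show "\<sigma> \<in> Sh k (n - k)"
      by (auto simp: Sh_def k permutes_lessThan_iff strict_mono_on_def)
  qed
qed

lemma perm_up_in_Sh:
  assumes "k \<le> n" "\<sigma> \<in> Sh k (n - k)"
  shows "perm_up \<sigma> \<in> Sh (Suc k) (Suc n - Suc k)"
proof -
  have \<sigma>: "\<forall>i\<ge>n. \<sigma> i = i" "inj \<sigma>" "\<forall>i<n. \<sigma> i < n" "\<forall>i j. i < j \<longrightarrow> j < k \<longrightarrow> \<sigma> i < \<sigma> j"
    "\<forall>i j. k \<le> i \<longrightarrow> i < j \<longrightarrow> j < n \<longrightarrow> \<sigma> i < \<sigma> j"
    using assms(2)[unfolded mem_Sh[OF assms(1)]] by blast+
  have "inj (perm_up \<sigma>)"
    by (rule injI) (auto simp: perm_up_def split: nat.splits dest: injD[OF \<sigma>(2)])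
  moreover have "perm_up \<sigma> i = i" if "Suc n \<le> i" for i
    using that \<sigma>(1) by (cases i) (auto simp: perm_up_def)
  moreover have "perm_up \<sigma> i < Suc n" if "i < Suc n" for i
    using that \<sigma>(3) by (cases i) (auto simp: perm_up_def)
  moreover have "perm_up \<sigma> i < perm_up \<sigma> j" if "i < j" "j < Suc k" for i j
    using that \<sigma>(4) by (cases i; cases j) (auto simp: perm_up_def)
  moreover have "perm_up \<sigma> i < perm_up \<sigma> j" if "Suc k \<le> i" "i < j" "j < Suc n" for i j
    using that \<sigma>(5) by (cases i; cases j) (auto simp: perm_up_def)
  ultimately show ?thesis
    using assms(1) by (subst mem_Sh) auto
qed

lemma perm_down_in_Sh:
  assumes "k \<le> n" "\<sigma> \<in> Sh (Suc k) (Suc n - Suc k)" "\<sigma> 0 = 0"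
  shows "perm_down \<sigma> \<in> Sh k (n - k)" "perm_up (perm_down \<sigma>) = \<sigma>"
proof -
  have k: "Suc k \<le> Suc n" using assms by simp
  have \<sigma>: "\<forall>i\<ge>Suc n. \<sigma> i = i" "inj \<sigma>" "\<forall>i<Suc n. \<sigma> i < Suc n" "\<forall>i j. i < j \<longrightarrow> j < Suc k \<longrightarrow> \<sigma> i < \<sigma> j"
    "\<forall>i j. Suc k \<le> i \<longrightarrow> i < j \<longrightarrow> j < Suc n \<longrightarrow> \<sigma> i < \<sigma> j"
    using assms(2)[unfolded mem_Sh[OF k]] by blast+
  have pos: "\<sigma> (Suc i) = Suc (perm_down \<sigma> i)" for i
  proof -
    have "\<sigma> (Suc i) \<noteq> 0" using \<sigma>(2) assms(3) by (metis injD nat.distinct(1))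
    then show ?thesis by (simp add: perm_down_def)
  qed
  show "perm_up (perm_down \<sigma>) = \<sigma>"
  proof
    show "perm_up (perm_down \<sigma>) i = \<sigma> i" for i
      using assms(3) by (cases i) (simp_all add: perm_up_def pos)
  qed
  have "inj (perm_down \<sigma>)"
    by (rule injI) (metis pos \<sigma>(2) injD nat.inject)
  moreover have "perm_down \<sigma> i = i" if "n \<le> i" for i
    using that \<sigma>(1)[rule_format, of "Suc i"] by (simp add: pos)
  moreover have "perm_down \<sigma> i < n" if "i < n" for i
    using that \<sigma>(3)[rule_format, of "Suc i"] by (simp add: pos)
  moreover have "perm_down \<sigma> i < perm_down \<sigma> j" if "i < j" "j < k" for i j
    using that \<sigma>(4)[rule_format, of "Suc i" "Suc j"] by (simp add: pos)
  moreover have "perm_down \<sigma> i < perm_down \<sigma> j" if "k \<le> i" "i < j" "j < n" for i j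
    using that \<sigma>(5)[rule_format, of "Suc i" "Suc j"] by (simp add: pos)
  ultimately show "perm_down \<sigma> \<in> Sh k (n - k)"
    using assms(1) by (subst mem_Sh) auto
qed

lemma perm_ins_in_Sh:
  assumes "k \<le> n" "\<sigma> \<in> Sh k (n - k)"
  shows "perm_ins k \<sigma> \<in> Sh k (Suc n - k)"
proof -
  have \<sigma>: "\<forall>i\<ge>n. \<sigma> i = i" "inj \<sigma>" "\<forall>i<n. \<sigma> i < n" "\<forall>i j. i < j \<longrightarrow> j < k \<longrightarrow> \<sigma> i < \<sigma> j"
    "\<forall>i j. k \<le> i \<longrightarrow> i < j \<longrightarrow> j < n \<longrightarrow> \<sigma> i < \<sigma> j"
    using assms(2)[unfolded mem_Sh[OF assms(1)]] by blast+
  have "inj (perm_ins k \<sigma>)"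
  proof (rule injI)
    fix i j assume *: "perm_ins k \<sigma> i = perm_ins k \<sigma> j"
    define s where "s i = (if i < k then i else i - 1)" for i :: nat
    have s: "perm_ins k \<sigma> i = (if i = k then 0 else Suc (\<sigma> (s i)))" for i
      by (auto simp: perm_ins_def s_def)
    have "(i = k \<and> j = k) \<or> (i \<noteq> k \<and> j \<noteq> k \<and> s i = s j)"
      using * unfolding s by (auto split: if_splits dest: injD[OF \<sigma>(2)])
    then show "i = j" by (auto simp: s_def split: if_splits)
  qed
  moreover have "perm_ins k \<sigma> i = i" if "Suc n \<le> i" for i
    using that \<sigma>(1)[rule_format, of "i - 1"] assms(1) by (auto simp: perm_ins_def)
  moreover have "perm_ins k \<sigma> i < Suc n" if "i < Suc n" for i
    using that \<sigma>(3)[rule_format, of "i - 1"] \<sigma>(3)[rule_format, of i] assms(1) by (auto simp: perm_ins_def)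
  moreover have "perm_ins k \<sigma> i < perm_ins k \<sigma> j" if "i < j" "j < k" for i j
    using that \<sigma>(4) by (auto simp: perm_ins_def)
  moreover have "perm_ins k \<sigma> i < perm_ins k \<sigma> j" if "k \<le> i" "i < j" "j < Suc n" for i j
    using that \<sigma>(5)[rule_format, of "i - 1" "j - 1"] by (auto simp: perm_ins_def)
  ultimately show ?thesis
    using assms(1) by (subst mem_Sh) auto
qed

lemma perm_del_in_Sh:
  assumes "k \<le> n" "\<sigma> \<in> Sh k (Suc n - k)" "\<sigma> k = 0"
  shows "perm_del k \<sigma> \<in> Sh k (n - k)" "perm_ins k (perm_del k \<sigma>) = \<sigma>"
proof -
  have k: "k \<le> Suc n" using assms by simp
  have \<sigma>: "\<forall>i\<ge>Suc n. \<sigma> i = i" "inj \<sigma>" "\<forall>i<Suc n. \<sigma> i < Suc n" "\<forall>i j. i < j \<longrightarrow> j < k \<longrightarrow> \<sigma> i < \<sigma> j"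
    "\<forall>i j. k \<le> i \<longrightarrow> i < j \<longrightarrow> j < Suc n \<longrightarrow> \<sigma> i < \<sigma> j"
    using assms(2)[unfolded mem_Sh[OF k]] by blast+
  define s where "s i = (if i < k then i else Suc i)" for i :: nat
  have pos: "\<sigma> (s i) = Suc (perm_del k \<sigma> i)" for i
  proof -
    have "s i \<noteq> k" by (simp add: s_def)
    then have "\<sigma> (s i) \<noteq> 0" using \<sigma>(2) assms(3) by (metis injD)
    then show ?thesis by (auto simp: perm_del_def s_def)
  qed
  show "perm_ins k (perm_del k \<sigma>) = \<sigma>"
  proof
    show "perm_ins k (perm_del k \<sigma>) i = \<sigma> i" for i
    proof (cases "k < i")
      case True
      then have "\<not> i - 1 < k" "Suc (i - 1) = i" by linarith+
      with True pos[of "i - 1"] show ?thesis by (simp add: perm_ins_def s_def)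
    next
      case False
      with assms(3) pos[of i] show ?thesis by (auto simp: perm_ins_def s_def)
    qed
  qed
  have "inj (perm_del k \<sigma>)"
  proof (rule injI)
    fix i j assume "perm_del k \<sigma> i = perm_del k \<sigma> j"
    then have "\<sigma> (s i) = \<sigma> (s j)" by (simp add: pos)
    then have "s i = s j" by (rule injD[OF \<sigma>(2)])
    then show "i = j" by (simp add: s_def split: if_splits)
  qed
  moreover have "perm_del k \<sigma> i = i" if "n \<le> i" for i
    using that \<sigma>(1)[rule_format, of "Suc i"] pos[of i] assms(1) by (simp add: s_def)
  moreover have "perm_del k \<sigma> i < n" if "i < n" for i
    using that \<sigma>(3)[rule_format, of "s i"] pos[of i] by (simp add: s_def split: if_splits)
  moreover have "perm_del k \<sigma> i < perm_del k \<sigma> j" if "i < j" "j < k" for i j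
    using that \<sigma>(4)[rule_format, of "i" "j"] pos[of i] pos[of j] by (simp add: s_def)
  moreover have "perm_del k \<sigma> i < perm_del k \<sigma> j" if "k \<le> i" "i < j" "j < n" for i j
    using that \<sigma>(5)[rule_format, of "Suc i" "Suc j"] pos[of i] pos[of j] by (simp add: s_def)
  ultimately show "perm_del k \<sigma> \<in> Sh k (n - k)"
    using assms(1) by (subst mem_Sh) auto
qed

lemma perm_down_up [simp]: "perm_down (perm_up \<sigma>) = \<sigma>"
  by (auto simp: perm_down_def perm_up_def)

lemma perm_del_ins [simp]: "perm_del k (perm_ins k \<sigma>) = \<sigma>"
  by (auto simp: perm_del_def perm_ins_def)

lemma sum_Sh_up:
  assumes "k \<le> n"
  shows "(\<Sum>\<sigma> | \<sigma> \<in> Sh (Suc k) (Suc n - Suc k) \<and> \<sigma> 0 = 0. G \<sigma>) = (\<Sum>\<sigma>\<in>Sh k (n - k). G (perm_up \<sigma>))"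
  by (rule sum.reindex_bij_witness[where i = perm_up and j = perm_down])
    (use assms perm_up_in_Sh[OF assms] perm_down_in_Sh[OF assms] in \<open>auto simp: perm_up_def\<close>)

lemma sum_Sh_ins:
  assumes "k \<le> n"
  shows "(\<Sum>\<sigma> | \<sigma> \<in> Sh k (Suc n - k) \<and> \<sigma> k = 0. G \<sigma>) = (\<Sum>\<sigma>\<in>Sh k (n - k). G (perm_ins k \<sigma>))"
  by (rule sum.reindex_bij_witness[where i = "perm_ins k" and j = "perm_del k"])
    (use assms perm_ins_in_Sh[OF assms] perm_del_in_Sh[OF assms] in \<open>auto simp: perm_ins_def\<close>)

lemma finite_Sh: "finite (Sh k l)"
proof (rule finite_subset)
  show "Sh k l \<subseteq> {\<sigma>. \<sigma> permutes {..<k + l}}" by (auto simp: Sh_def)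
qed (simp add: finite_permutations)

lemma Sh_zero_cases:
  assumes "k \<le> Suc n" "\<sigma> \<in> Sh k (Suc n - k)"
  shows "(0 < k \<and> \<sigma> 0 = 0) \<noteq> (k < Suc n \<and> \<sigma> k = 0)"
proof -
  have \<sigma>: "\<forall>i\<ge>Suc n. \<sigma> i = i" "inj \<sigma>" "\<forall>i<Suc n. \<sigma> i < Suc n" "\<forall>i j. i < j \<longrightarrow> j < k \<longrightarrow> \<sigma> i < \<sigma> j"
    "\<forall>i j. k \<le> i \<longrightarrow> i < j \<longrightarrow> j < Suc n \<longrightarrow> \<sigma> i < \<sigma> j"
    using assms(2)[unfolded mem_Sh[OF assms(1)]] by blast+
  have perm: "\<sigma> permutes {..<Suc n}" using assms by (simp add: Sh_def)
  obtain m where m: "\<sigma> m = 0" by (metis perm permutes_surj surjD)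
  have "m < Suc n" using \<sigma>(1) m by (metis leI old.nat.distinct(1) le_zero_eq)
  have uniq: "\<sigma> i = 0 \<longleftrightarrow> i = m" for i using \<sigma>(2) m by (metis injD)
  have "m = 0 \<or> m = k"
  proof (rule ccontr)
    assume *: "\<not> (m = 0 \<or> m = k)"
    show False
    proof (cases "m < k")
      case True
      then show False using \<sigma>(4)[rule_format, of 0 m] * m by simp
    next
      case False
      then show False using \<sigma>(5)[rule_format, of k m] * m \<open>m < Suc n\<close> by simp
    qed
  qed
  then show ?thesis using \<open>m < Suc n\<close> by (auto simp: uniq)
qed

lemma sum_Sh_Suc:
  fixes G :: "nat \<Rightarrow> (nat \<Rightarrow> nat) \<Rightarrow> 'a::comm_monoid_add"
  shows "(\<Sum>k\<le>Suc n. \<Sum>\<sigma>\<in>Sh k (Suc n - k). G k \<sigma>) =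
    (\<Sum>k\<le>n. \<Sum>\<sigma>\<in>Sh k (n - k). G (Suc k) (perm_up \<sigma>) + G k (perm_ins k \<sigma>))"
proof -
  let ?P = "\<lambda>k. {\<sigma>. \<sigma> \<in> Sh k (Suc n - k) \<and> (0 < k \<and> \<sigma> 0 = 0)}"
  let ?Q = "\<lambda>k. {\<sigma>. \<sigma> \<in> Sh k (Suc n - k) \<and> (k < Suc n \<and> \<sigma> k = 0)}"
  have "(\<Sum>\<sigma>\<in>Sh k (Suc n - k). G k \<sigma>) = (\<Sum>\<sigma>\<in>?P k. G k \<sigma>) + (\<Sum>\<sigma>\<in>?Q k. G k \<sigma>)" if "k \<le> Suc n" for k
  proof -
    have "Sh k (Suc n - k) = ?P k \<union> ?Q k" "?P k \<inter> ?Q k = {}"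
      using Sh_zero_cases[OF that] by blast+
    moreover have "finite (?P k)" "finite (?Q k)"
      using finite_Sh[of k "Suc n - k"] by auto
    ultimately show ?thesis using sum.union_disjoint[of "?P k" "?Q k" "G k"] by simp
  qed
  then have *: "\<And>k. k \<in> {..Suc n} \<Longrightarrow> (\<Sum>\<sigma>\<in>Sh k (Suc n - k). G k \<sigma>) = (\<Sum>\<sigma>\<in>?P k. G k \<sigma>) + (\<Sum>\<sigma>\<in>?Q k. G k \<sigma>)"
    by simp
  have "(\<Sum>k\<le>Suc n. \<Sum>\<sigma>\<in>Sh k (Suc n - k). G k \<sigma>) =
      (\<Sum>k\<le>Suc n. \<Sum>\<sigma>\<in>?P k. G k \<sigma>) + (\<Sum>k\<le>Suc n. \<Sum>\<sigma>\<in>?Q k. G k \<sigma>)"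
    unfolding sum.distrib[symmetric] by (rule sum.cong[OF refl *])
  also have "(\<Sum>k\<le>Suc n. \<Sum>\<sigma>\<in>?P k. G k \<sigma>) = (\<Sum>k\<le>n. \<Sum>\<sigma>\<in>?P (Suc k). G (Suc k) \<sigma>)"
    by (subst sum.atMost_Suc_shift) simp
  also have "\<dots> = (\<Sum>k\<le>n. \<Sum>\<sigma>\<in>Sh k (n - k). G (Suc k) (perm_up \<sigma>))"
  proof (rule sum.cong[OF refl])
    fix k assume "k \<in> {..n}"
    then have k: "k \<le> n" by simp
    then show "(\<Sum>\<sigma>\<in>?P (Suc k). G (Suc k) \<sigma>) = (\<Sum>\<sigma>\<in>Sh k (n - k). G (Suc k) (perm_up \<sigma>))"
      using sum_Sh_up[OF k, of "G (Suc k)"] by simp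
  qed
  also have "(\<Sum>k\<le>Suc n. \<Sum>\<sigma>\<in>?Q k. G k \<sigma>) = (\<Sum>k\<le>n. \<Sum>\<sigma>\<in>?Q k. G k \<sigma>)"
    by simp
  also have "\<dots> = (\<Sum>k\<le>n. \<Sum>\<sigma>\<in>Sh k (n - k). G k (perm_ins k \<sigma>))"
  proof (rule sum.cong[OF refl])
    fix k assume "k \<in> {..n}"
    then have k: "k \<le> n" by simp
    then show "(\<Sum>\<sigma>\<in>?Q k. G k \<sigma>) = (\<Sum>\<sigma>\<in>Sh k (n - k). G k (perm_ins k \<sigma>))"
      using sum_Sh_ins[OF k, of "G k"] by simp
  qed
  finally show ?thesis by (simp add: sum.distrib)
qed

abbreviation inversions :: "nat \<Rightarrow> (nat \<Rightarrow> nat) \<Rightarrow> (nat \<times> nat) set" where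
  "inversions n \<sigma> \<equiv> {(i, j). i < j \<and> j < n \<and> \<sigma> j < \<sigma> i}"

lemma finite_inversions: "finite (inversions n \<sigma>)"
  by (rule finite_subset[of _ "{..<n} \<times> {..<n}"]) auto

lemma koszul_sign_up: "koszul_sign (d # ds) (perm_up \<sigma>) = koszul_sign ds \<sigma>"
proof -
  have "inversions (length (d # ds)) (perm_up \<sigma>) = map_prod Suc Suc ` inversions (length ds) \<sigma>"
  proof (intro subset_antisym subrelI)
    fix i j assume "(i, j) \<in> inversions (length (d # ds)) (perm_up \<sigma>)"
    then show "(i, j) \<in> map_prod Suc Suc ` inversions (length ds) \<sigma>"
      by (cases i; cases j) (auto simp: perm_up_def)
  qed (auto simp: perm_up_def)
  moreover have "inj_on (map_prod Suc Suc) (inversions (length ds) \<sigma>)"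
    by (auto simp: inj_on_def)
  ultimately show ?thesis
    unfolding koszul_sign_def
    by (simp add: prod.reindex o_def case_prod_unfold) (simp add: perm_up_def)
qed

lemma prod_sgn_powi: "(\<Prod>i\<in>A. (-1::real) powi (f i)) = (-1) powi (\<Sum>i\<in>A. f i)"
  by (induction A rule: infinite_finite_induct) (auto simp: power_int_add)

lemma koszul_sign_ins:
  assumes "k \<le> length ds"
  shows "koszul_sign (d # ds) (perm_ins k \<sigma>) = (-1) powi (d * (\<Sum>i<k. ds ! \<sigma> i)) * koszul_sign ds \<sigma>"
proof -
  define s where "s i = (if i < k then i else Suc i)" for i :: nat
  have ps: "perm_ins k \<sigma> (s i) = Suc (\<sigma> i)" for i
    by (simp add: perm_ins_def s_def)
  have inv: "inversions (length (d # ds)) (perm_ins k \<sigma>) =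
      (\<lambda>i. (i, k)) ` {..<k} \<union> map_prod s s ` inversions (length ds) \<sigma>" (is "?I = ?J \<union> ?K")
  proof (intro subset_antisym subrelI)
    fix i j assume ij: "(i, j) \<in> ?I"
    show "(i, j) \<in> ?J \<union> ?K"
    proof (cases "j = k")
      case True
      then show ?thesis using ij by auto
    next
      case False
      define r where "r i = (if i < k then i else i - 1)" for i :: nat
      have "i \<noteq> k" using ij by (auto simp: perm_ins_def)
      then have "(r i, r j) \<in> inversions (length ds) \<sigma>" and s: "i = s (r i)" "j = s (r j)"
        using ij False assms by (auto simp: perm_ins_def r_def s_def split: if_splits)
      from imageI[OF this(1), of "map_prod s s"] show ?thesis
        unfolding map_prod_simp s[symmetric] by (rule UnI2)
    qed
  next
    fix i j assume "(i, j) \<in> ?J \<union> ?K"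
    then show "(i, j) \<in> ?I"
    proof
      assume "(i, j) \<in> ?J"
      then show ?thesis using assms by (auto simp: perm_ins_def)
    next
      assume "(i, j) \<in> ?K"
      then obtain a b where ij: "i = s a" "j = s b" and ab: "a < b" "b < length ds" "\<sigma> b < \<sigma> a"
        by auto
      have "s a < s b" "s b < Suc (length ds)" using ab by (auto simp: s_def)
      with ab show ?thesis by (simp add: ij ps)
    qed
  qed
  have "inj s" by (rule injI) (simp add: s_def split: if_splits)
  then have inj: "inj_on (map_prod s s) A" for A
    using inj_on_subset[OF prod.inj_map] by blast
  let ?g = "\<lambda>(i, j). (-1::real) powi ((d # ds) ! perm_ins k \<sigma> i * (d # ds) ! perm_ins k \<sigma> j)"
  have "koszul_sign (d # ds) (perm_ins k \<sigma>) = prod ?g ?J * prod ?g ?K"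
    unfolding koszul_sign_def inv
  proof (rule prod.union_disjoint)
    show "finite ?J" by simp
    show "finite ?K" by (rule finite_imageI[OF finite_inversions])
    have "s b \<noteq> k" for b by (simp add: s_def)
    then show "?J \<inter> ?K = {}" by auto
  qed
  also have "prod ?g ?J = (\<Prod>i<k. (-1) powi (ds ! \<sigma> i * d))"
    by (subst prod.reindex) (simp_all add: inj_on_def perm_ins_def)
  also have "\<dots> = (-1) powi (d * (\<Sum>i<k. ds ! \<sigma> i))"
    by (simp add: prod_sgn_powi sum_distrib_left mult.commute)
  also have "prod ?g ?K = koszul_sign ds \<sigma>"
    by (subst prod.reindex[OF inj]) (simp add: koszul_sign_def o_def case_prod_unfold ps)
  finally show ?thesis .
qed

lemma shuffle_sum_Cons:
  assumes v: "v \<in> gr d" and vs: "homogeneous ds vs"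
  shows "shuffle_sum (d # ds) (v # vs) = cop_step v (shuffle_sum ds vs)"
proof -
  let ?n = "length vs"
  have len: "length ds = ?n" using vs by (simp add: homogeneous_def list_all2_lengthD)
  let ?A = "\<lambda>k \<sigma>. word (map (\<lambda>i. vs ! \<sigma> i) [0..<k])" and ?B = "\<lambda>k \<sigma>. word (map (\<lambda>i. vs ! \<sigma> i) [k..<?n])"
  let ?G = "\<lambda>k \<sigma>. koszul_sign (d # ds) \<sigma> *\<^sub>R
          (word (map (\<lambda>i. (v # vs) ! \<sigma> i) [0..<k]) \<otimes> word (map (\<lambda>i. (v # vs) ! \<sigma> i) [k..<Suc ?n]))"
  have "shuffle_sum (d # ds) (v # vs) = (\<Sum>k\<le>Suc ?n. \<Sum>\<sigma>\<in>Sh k (Suc ?n - k). ?G k \<sigma>)"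
    by (simp only: shuffle_sum_def list.size add_Suc_right add_0_right)
  also have "\<dots> = (\<Sum>k\<le>?n. \<Sum>\<sigma>\<in>Sh k (?n - k). ?G (Suc k) (perm_up \<sigma>) + ?G k (perm_ins k \<sigma>))"
    by (rule sum_Sh_Suc)
  also have "\<dots> = (\<Sum>k\<le>?n. \<Sum>\<sigma>\<in>Sh k (?n - k). cop_step v (koszul_sign ds \<sigma> *\<^sub>R (?A k \<sigma> \<otimes> ?B k \<sigma>)))"
  proof ((rule sum.cong[OF refl])+)
    fix k \<sigma> assume "k \<in> {..?n}" and \<sigma>: "\<sigma> \<in> Sh k (?n - k)"
    then have k: "k \<le> ?n" by simp
    have lt: "\<sigma> i < ?n" if "i < ?n" for i
      using \<sigma> that unfolding mem_Sh[OF k] by blast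
    have up1: "map (\<lambda>i. (v # vs) ! perm_up \<sigma> i) [0..<Suc k] = v # map (\<lambda>i. vs ! \<sigma> i) [0..<k]"
      by (rule nth_equalityI) (auto simp: perm_up_def nth_Cons' split: nat.splits simp del: upt_Suc)
    have up2: "map (\<lambda>i. (v # vs) ! perm_up \<sigma> i) [Suc k..<Suc ?n] = map (\<lambda>i. vs ! \<sigma> i) [k..<?n]"
      by (rule nth_equalityI) (auto simp: perm_up_def simp del: upt_Suc)
    have ins1: "map (\<lambda>i. (v # vs) ! perm_ins k \<sigma> i) [0..<k] = map (\<lambda>i. vs ! \<sigma> i) [0..<k]"
      by (rule nth_equalityI) (auto simp: perm_ins_def)
    have ins2: "map (\<lambda>i. (v # vs) ! perm_ins k \<sigma> i) [k..<Suc ?n] = v # map (\<lambda>i. vs ! \<sigma> i) [k..<?n]"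
      using k by (intro nth_equalityI)
        (auto simp: perm_ins_def nth_Cons' simp del: upt_Suc)
    have hA: "homogeneous (map (\<lambda>i. ds ! \<sigma> i) [0..<k]) (map (\<lambda>i. vs ! \<sigma> i) [0..<k])"
      unfolding homogeneous_def
      by (rule list_all2_all_nthI) (use vs lt k in \<open>auto simp: homogeneous_def list_all2_conv_all_nth\<close>)
    have "sum_list (map (\<lambda>i. ds ! \<sigma> i) [0..<k]) = (\<Sum>i<k. ds ! \<sigma> i)"
      by (simp add: sum_list_sum_nth lessThan_atLeast0)
    with hA have "?A k \<sigma> \<in> gr (\<Sum>i<k. ds ! \<sigma> i)"
      unfolding gr_sym_def by (intro span_base) blast
    from cop_step_pure[OF v this]
    show "?G (Suc k) (perm_up \<sigma>) + ?G k (perm_ins k \<sigma>) = cop_step v (koszul_sign ds \<sigma> *\<^sub>R (?A k \<sigma> \<otimes> ?B k \<sigma>))"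
      unfolding up1 up2 ins1 ins2 koszul_sign_up
      using k by (simp add: koszul_sign_ins len linear_simps[OF linear_cop_step] scaleR_add_right mult.commute)
  qed
  also have "\<dots> = cop_step v (shuffle_sum ds vs)"
    by (simp only: shuffle_sum_def linear_sum[OF linear_cop_step])
  finally show ?thesis .
qed

lemma cop_word_homogeneous: "homogeneous ds vs \<Longrightarrow> cop_word vs = shuffle_sum ds vs"
proof (induction vs arbitrary: ds)
  case Nil
  have "Sh 0 0 = {id}" by (auto simp: Sh_def strict_mono_on_def)
  then show ?case
    by (simp add: shuffle_sum_def cop_word_def koszul_sign_def Nil[unfolded homogeneous_def, simplified])
next
  case (Cons v vs)
  then obtain d es where "ds = d # es" "v \<in> gr d" "homogeneous es vs"
    by (auto simp: homogeneous_def list_all2_Cons2)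
  then show ?case
    using Cons.IH[of es] shuffle_sum_Cons[of v d es vs] by (simp add: cop_word_def)
qed

lemma ex1_coprod: "\<exists>!D. linear D \<and> (\<forall>ds vs. homogeneous ds vs \<longrightarrow> D (word vs) = shuffle_sum ds vs)"
proof (rule ex1I)
  show "linear (sym_lift cop_word) \<and>
      (\<forall>ds vs. homogeneous ds vs \<longrightarrow> sym_lift cop_word (word vs) = shuffle_sum ds vs)"
    by (simp add: linear_sym_lift sym_compatible_cop_word cop_word_homogeneous)
next
  fix D :: "'a sym \<Rightarrow> 'a sym \<otimes> 'a sym"
  assume D: "linear D \<and> (\<forall>ds vs. homogeneous ds vs \<longrightarrow> D (word vs) = shuffle_sum ds vs)"
  show "D = sym_lift cop_word"
  proof
    fix x :: "'a sym"
    have "linear D" "linear (sym_lift cop_word)"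
      using D by (simp_all add: linear_sym_lift sym_compatible_cop_word)
    moreover have "D y = sym_lift cop_word y" if "y \<in> {word vs | vs ds. homogeneous ds vs}" for y
      using that D by (auto simp: sym_compatible_cop_word cop_word_homogeneous)
    moreover have "x \<in> span {word vs | vs ds. homogeneous ds vs}"
      by (simp only: span_homogeneous_word UNIV_I)
    ultimately show "D x = sym_lift cop_word x"
      by (rule linear_eq_on_span)
  qed
qed

lemma linear_coprod: "linear coprod"
  by (rule conjunct1[OF theI'[OF ex1_coprod, folded coprod_def]])

lemma coprod_word: "homogeneous ds vs \<Longrightarrow> coprod (word vs) = shuffle_sum ds vs"
  using conjunct2[OF theI'[OF ex1_coprod, folded coprod_def]] by blast

section \<open>Cochain complexes\<close>

instantiation "fun" :: (type, real_vector) real_vector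
begin

definition "c *\<^sub>R f = (\<lambda>x. c *\<^sub>R f x)"

instance
  by standard (auto simp: scaleR_fun_def scaleR_add_left scaleR_add_right)

end

text \<open>
  A complex is given by its homogeneous parts \<open>C p\<close> and differentials \<open>d p\<close> on \<open>C p\<close>; the values of
  \<open>d p\<close> outside \<open>C p\<close> are irrelevant.
\<close>

definition linear_map_on :: "'a::real_vector set \<Rightarrow> ('a \<Rightarrow> 'b::real_vector) \<Rightarrow> bool" where
  "linear_map_on U f \<longleftrightarrow>
     (\<forall>x\<in>U. \<forall>y\<in>U. f (x + y) = f x + f y) \<and> (\<forall>c. \<forall>x\<in>U. f (c *\<^sub>R x) = c *\<^sub>R f x)"

definition cochain_complex :: "(int \<Rightarrow> 'a::real_vector set) \<Rightarrow> (int \<Rightarrow> 'a \<Rightarrow> 'a) \<Rightarrow> bool" where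
  "cochain_complex C d \<longleftrightarrow>
     (\<forall>p. subspace (C p) \<and> linear_map_on (C p) (d p) \<and> d p ` C p \<subseteq> C (p + 1) \<and>
          (\<forall>x\<in>C p. d (p + 1) (d p x) = 0))"

definition cochain_map ::
    "(int \<Rightarrow> 'a::real_vector set) \<Rightarrow> (int \<Rightarrow> 'a \<Rightarrow> 'a) \<Rightarrow>
     (int \<Rightarrow> 'b::real_vector set) \<Rightarrow> (int \<Rightarrow> 'b \<Rightarrow> 'b) \<Rightarrow> ('a \<Rightarrow> 'b) \<Rightarrow> bool" where
  "cochain_map C d C' d' \<phi> \<longleftrightarrow>
     (\<forall>p. linear_map_on (C p) \<phi> \<and> \<phi> ` C p \<subseteq> C' p \<and> (\<forall>x\<in>C p. \<phi> (d p x) = d' p (\<phi> x)))"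

definition cocycles :: "(int \<Rightarrow> 'a::real_vector set) \<Rightarrow> (int \<Rightarrow> 'a \<Rightarrow> 'a) \<Rightarrow> int \<Rightarrow> 'a set" where
  "cocycles C d p = {x \<in> C p. d p x = 0}"

definition coboundaries :: "(int \<Rightarrow> 'a::real_vector set) \<Rightarrow> (int \<Rightarrow> 'a \<Rightarrow> 'a) \<Rightarrow> int \<Rightarrow> 'a set" where
  "coboundaries C d p = d (p - 1) ` C (p - 1)"

definition cohomologous :: "(int \<Rightarrow> 'a::real_vector set) \<Rightarrow> (int \<Rightarrow> 'a \<Rightarrow> 'a) \<Rightarrow> int \<Rightarrow> ('a \<times> 'a) set" where
  "cohomologous C d p =
     {(x, y). x \<in> cocycles C d p \<and> y \<in> cocycles C d p \<and> x - y \<in> coboundaries C d p}"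

definition cohomology :: "(int \<Rightarrow> 'a::real_vector set) \<Rightarrow> (int \<Rightarrow> 'a \<Rightarrow> 'a) \<Rightarrow> int \<Rightarrow> 'a set set" where
  "cohomology C d p = cocycles C d p // cohomologous C d p"

definition cohomology_map ::
    "(int \<Rightarrow> 'b::real_vector set) \<Rightarrow> (int \<Rightarrow> 'b \<Rightarrow> 'b) \<Rightarrow> int \<Rightarrow> ('a \<Rightarrow> 'b) \<Rightarrow> 'a set \<Rightarrow> 'b set" where
  "cohomology_map C' d' p \<phi> X = cohomologous C' d' p `` (\<phi> ` X)"

text \<open>
  The vector space \<open>\<Oplus>\<^sub>p C p\<close> is represented by its homogeneous parts, so cohomology is taken degree by
  degree. The map induced on cohomology by a cochain map is automatically linear, hence an isomorphism as
  soon as it is bijective.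
\<close>

definition quasi_isomorphism ::
    "(int \<Rightarrow> 'a::real_vector set) \<Rightarrow> (int \<Rightarrow> 'a \<Rightarrow> 'a) \<Rightarrow>
     (int \<Rightarrow> 'b::real_vector set) \<Rightarrow> (int \<Rightarrow> 'b \<Rightarrow> 'b) \<Rightarrow> ('a \<Rightarrow> 'b) \<Rightarrow> bool" where
  "quasi_isomorphism C d C' d' \<phi> \<longleftrightarrow>
     cochain_complex C d \<and> cochain_complex C' d' \<and> cochain_map C d C' d' \<phi> \<and>
     (\<forall>p. bij_betw (cohomology_map C' d' p \<phi>) (cohomology C d p) (cohomology C' d' p))"

section \<open>\<open>L\<^sub>\<infinity>\<close>-algebras and representations up to homotopy\<close>

text \<open>
  A linear map \<open>\<lambda>\<close> on \<open>S(\<gg>[1])\<close> encodes the family of its restrictions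
  \<open>\<lambda>\<^sub>k\<close> to \<open>S\<^sup>k(\<gg>[1])\<close>, for \<open>k \<ge> 1\<close>, together with \<open>\<lambda>(1)\<close>.
\<close>

definition coderivation :: "('a::graded_vector sym \<Rightarrow> 'a) \<Rightarrow> 'a sym \<Rightarrow> 'a sym" where
  "coderivation lam = sym_mult \<circ> tensor_map 0 (sym_incl \<circ> lam) id \<circ> coprod"

definition L_infinity_algebra :: "('g::graded_vector shift sym \<Rightarrow> 'g shift) \<Rightarrow> bool" where
  "L_infinity_algebra lam \<longleftrightarrow>
     (\<forall>n>0. gr n = ({0} :: 'g set)) \<and>
     lam \<in> Hom 1 \<and> lam sym_one = 0 \<and> (\<forall>x. coderivation lam (coderivation lam x) = 0)"

definition L_infinity_morphism ::
    "('g::graded_vector shift sym \<Rightarrow> 'g shift) \<Rightarrow> ('h::graded_vector shift sym \<Rightarrow> 'h shift) \<Rightarrow>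
     ('g shift sym \<Rightarrow> 'h shift sym) \<Rightarrow> bool" where
  "L_infinity_morphism lam lam' F \<longleftrightarrow>
     F \<in> Hom 0 \<and> coprod \<circ> F = tensor_map 0 F F \<circ> coprod \<and> F sym_one = sym_one \<and>
     F \<circ> coderivation lam = coderivation lam' \<circ> F"

text \<open>
  That the linear part of \<open>F\<close> is a cochain map between complexes, as demanded by
  \<^const>\<open>quasi_isomorphism\<close>, already follows from the equations for \<open>\<lambda>\<close> and \<open>F\<close>; similarly for \<open>f\<close>
  in \<open>ruth_quasi_isomorphism\<close> below.
\<close>

definition L_infinity_quasi_isomorphism ::
    "('g::graded_vector shift sym \<Rightarrow> 'g shift) \<Rightarrow> ('h::graded_vector shift sym \<Rightarrow> 'h shift) \<Rightarrow>
     ('g shift sym \<Rightarrow> 'h shift sym) \<Rightarrow> bool" where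
  "L_infinity_quasi_isomorphism lam lam' F \<longleftrightarrow>
     L_infinity_morphism lam lam' F \<and>
     quasi_isomorphism gr (\<lambda>_. lam \<circ> sym_incl) gr (\<lambda>_. lam' \<circ> sym_incl) (sym_proj \<circ> F \<circ> sym_incl)"

definition ruth ::
    "('g::graded_vector shift sym \<Rightarrow> 'g shift) \<Rightarrow> ('g shift sym \<otimes> 'v::graded_vector \<Rightarrow> 'v) \<Rightarrow> bool" where
  "ruth lam rho \<longleftrightarrow>
     rho \<in> Hom 1 \<and>
     (\<forall>t. (rho \<circ> tensor_map 0 (coderivation lam) id) t
        + (rho \<circ> tensor_map 1 id rho \<circ> assoc \<circ> tensor_map 0 coprod id) t = 0)"

definition ruth_underlying_differential ::
    "('g::graded_vector shift sym \<otimes> 'v::graded_vector \<Rightarrow> 'v) \<Rightarrow> 'v \<Rightarrow> 'v" where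
  "ruth_underlying_differential rho v = rho (sym_one \<otimes> v)"

definition ruth_cochains :: "int \<Rightarrow> ('g::graded_vector shift sym \<Rightarrow> 'v::graded_vector) set" where
  "ruth_cochains p = Hom p"

definition ruth_differential ::
    "('g::graded_vector shift sym \<Rightarrow> 'g shift) \<Rightarrow> ('g shift sym \<otimes> 'v::graded_vector \<Rightarrow> 'v) \<Rightarrow>
     int \<Rightarrow> ('g shift sym \<Rightarrow> 'v) \<Rightarrow> ('g shift sym \<Rightarrow> 'v)" where
  "ruth_differential lam rho p \<alpha> =
     (rho \<circ> tensor_map p id \<alpha> \<circ> coprod) - (-1) powi p *\<^sub>R (\<alpha> \<circ> coderivation lam)"

definition ruth_morphism ::
    "('g::graded_vector shift sym \<Rightarrow> 'g shift) \<Rightarrow> ('g shift sym \<otimes> 'v::graded_vector \<Rightarrow> 'v) \<Rightarrow>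
     ('h::graded_vector shift sym \<Rightarrow> 'h shift) \<Rightarrow> ('h shift sym \<otimes> 'w::graded_vector \<Rightarrow> 'w) \<Rightarrow>
     ('g shift sym \<Rightarrow> 'h shift sym) \<Rightarrow> ('w \<Rightarrow> 'v) \<Rightarrow> bool" where
  "ruth_morphism lam rho lam' rho' F f \<longleftrightarrow>
     L_infinity_morphism lam lam' F \<and> f \<in> Hom 0 \<and>
     f \<circ> rho' \<circ> tensor_map 0 F id = rho \<circ> tensor_map 0 id f"

definition ruth_quasi_isomorphism ::
    "('g::graded_vector shift sym \<Rightarrow> 'g shift) \<Rightarrow> ('g shift sym \<otimes> 'v::graded_vector \<Rightarrow> 'v) \<Rightarrow>
     ('h::graded_vector shift sym \<Rightarrow> 'h shift) \<Rightarrow> ('h shift sym \<otimes> 'w::graded_vector \<Rightarrow> 'w) \<Rightarrow>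
     ('g shift sym \<Rightarrow> 'h shift sym) \<Rightarrow> ('w \<Rightarrow> 'v) \<Rightarrow> bool" where
  "ruth_quasi_isomorphism lam rho lam' rho' F f \<longleftrightarrow>
     ruth_morphism lam rho lam' rho' F f \<and>
     L_infinity_quasi_isomorphism lam lam' F \<and>
     quasi_isomorphism gr (\<lambda>_. ruth_underlying_differential rho')
       gr (\<lambda>_. ruth_underlying_differential rho) f"

definition ruth_pullback ::
    "('g::graded_vector shift sym \<Rightarrow> 'h::graded_vector shift sym) \<Rightarrow> ('w \<Rightarrow> 'v) \<Rightarrow>
     ('h shift sym \<Rightarrow> 'w) \<Rightarrow> ('g shift sym \<Rightarrow> 'v)" where
  "ruth_pullback F f \<alpha> = f \<circ> \<alpha> \<circ> F"

end

theory Submission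
  imports Defs
begin

text \<open>
  Cochains are filtered by the number of arguments: \<open>\<alpha>\<close> lies in the \<open>n\<close>-th step if it vanishes on
  words of length less than \<open>n\<close>. This filtration is complete, so it suffices to compare the associated
  graded complexes. Up to shorter words, \<open>d\<^sub>\<lambda>\<close> is the derivation extending \<open>\<lambda>\<^sub>1\<close> and \<open>F\<close> is the algebra
  map extending \<open>F\<^sup>1\<^sub>1\<close>; hence the graded pullback is \<open>\<alpha> \<mapsto> f \<circ> \<alpha> \<circ> S(F\<^sup>1\<^sub>1)\<close> between complexes of
  homogeneous maps. Over a field \<open>F\<^sup>1\<^sub>1\<close> and \<open>f\<close> are invertible up to homotopy, since every complex
  contracts onto its cohomology, and in characteristic zero a contraction of \<open>V\<close> induces one of \<open>S(V)\<close>.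
\<close>

section \<open>Cohomology and complete filtrations\<close>

text \<open>The L-infinity morphism itself is never inverted. Both \<open>d_\<lambda>\<close>,
  because \<lambda>(1) = 0, and F send a word to combinations of words that are at most as long. A
  cochain vanishing on words of length below n therefore sees, on words of length n, only their
  length-preserving parts. Likewise \<Delta> hands it a word of length n only in the term 1
  \<otimes> x, so \<rho> enters only through \<partial>. The filtration is complete because every
  element of S(g[1]) has bounded length: an infinite series of corrections is a finite sum on each
  argument. This takes the place of a convergence theorem for spectral sequences.

  The contractions retract onto complexes with zero differential. The inverses \<theta> of the
  linear part of F and g of f can then be chosen to be annihilated by the differentials on both
  sides, so S(\<theta>) inverts the linear part of F on the retracts strictly. Characteristic zero
  enters as division by numbers of factors: in the homotopy on S(V), and in recovering F modulo
  shorter words from its linear part.\<close>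

lemma linear_map_on_diff:
  assumes "subspace U" "linear_map_on U f" "x \<in> U" "y \<in> U"
  shows "f (x - y) = f x - f y"
proof -
  have "f (x + (-1) *\<^sub>R y) = f x + f ((-1) *\<^sub>R y)"
    using assms subspace_scale unfolding linear_map_on_def by blast
  also have "f ((-1) *\<^sub>R y) = (-1) *\<^sub>R f y"
    using assms unfolding linear_map_on_def by blast
  finally show ?thesis by simp
qed

lemma linear_map_on_0:
  assumes "subspace U" "linear_map_on U f" shows "f 0 = 0"
  using linear_map_on_diff[OF assms, of 0 0] subspace_0[OF assms(1)] by simp

lemma subspace_cocycles:
  assumes "cochain_complex C d" shows "subspace (cocycles C d p)"
proof -
  have C: "subspace (C p)" "linear_map_on (C p) (d p)"
    using assms by (auto simp: cochain_complex_def)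
  then show ?thesis
    using linear_map_on_0[OF C]
    by (auto simp: subspace_def cocycles_def linear_map_on_def)
qed

lemma linear_map_on_subspace_image:
  assumes "subspace U" "linear_map_on U f" shows "subspace (f ` U)"
proof (rule subspaceI)
  show "0 \<in> f ` U"
    using linear_map_on_0[OF assms] subspace_0[OF assms(1)] by force
  show "x + y \<in> f ` U" if xy: "x \<in> f ` U" "y \<in> f ` U" for x y
  proof -
    obtain u v where uv: "u \<in> U" "v \<in> U" "x = f u" "y = f v" using xy by blast
    then have "x + y = f (u + v)" using assms by (simp add: linear_map_on_def)
    then show ?thesis using uv subspace_add[OF assms(1)] by blast
  qed
  show "c *\<^sub>R x \<in> f ` U" if x: "x \<in> f ` U" for c x
  proof -
    obtain u where u: "u \<in> U" "x = f u" using x by blast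
    then have "c *\<^sub>R x = f (c *\<^sub>R u)" using assms by (simp add: linear_map_on_def)
    then show ?thesis using u subspace_scale[OF assms(1)] by blast
  qed
qed

lemma subspace_coboundaries: "cochain_complex C d \<Longrightarrow> subspace (coboundaries C d p)"
  unfolding coboundaries_def
  by (rule linear_map_on_subspace_image) (auto simp: cochain_complex_def)

lemma equiv_cohomologous:
  assumes "cochain_complex C d" shows "equiv (cocycles C d p) (cohomologous C d p)"
proof (rule equivI)
  note B = subspace_coboundaries[OF assms, of p]
  show "cohomologous C d p \<subseteq> cocycles C d p \<times> cocycles C d p"
    by (auto simp: cohomologous_def)
  show "refl_on (cocycles C d p) (cohomologous C d p)"
    by (auto simp: refl_on_def cohomologous_def subspace_0[OF B])
  show "sym (cohomologous C d p)"
    by (rule symI) (auto simp: cohomologous_def dest: subspace_neg[OF B])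
  show "trans (cohomologous C d p)"
  proof (rule transI)
    fix x y z assume "(x, y) \<in> cohomologous C d p" "(y, z) \<in> cohomologous C d p"
    then have xyz: "x \<in> cocycles C d p" "z \<in> cocycles C d p"
      and "x - y \<in> coboundaries C d p" "y - z \<in> coboundaries C d p"
      by (auto simp: cohomologous_def)
    then have "(x - y) + (y - z) \<in> coboundaries C d p" using subspace_add[OF B] by blast
    with xyz show "(x, z) \<in> cohomologous C d p" by (simp add: cohomologous_def)
  qed
qed

lemma cochain_map_cocycle:
  assumes "cochain_complex C' d'" "cochain_map C d C' d' \<phi>" "z \<in> cocycles C d p"
  shows "\<phi> z \<in> cocycles C' d' p"
proof -
  have z: "z \<in> C p" "d p z = 0" using assms(3) by (auto simp: cocycles_def)
  have "linear_map_on (C q) \<phi>" for q using assms(2) by (simp add: cochain_map_def)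
  then have "\<phi> (0 *\<^sub>R z) = 0 *\<^sub>R \<phi> z" using z(1) unfolding linear_map_on_def by blast
  then have "\<phi> 0 = 0" by simp
  moreover have "\<phi> z \<in> C' p" "\<phi> (d p z) = d' p (\<phi> z)"
    using z(1) assms(2) unfolding cochain_map_def by blast+
  ultimately show ?thesis
    using z(2) by (simp add: cocycles_def)
qed

lemma cochain_map_coboundary:
  assumes "cochain_map C d C' d' \<phi>" "z \<in> coboundaries C d p"
  shows "\<phi> z \<in> coboundaries C' d' p"
proof -
  obtain w where w: "w \<in> C (p - 1)" "z = d (p - 1) w"
    using assms(2) unfolding coboundaries_def by (rule imageE)
  have "\<phi> w \<in> C' (p - 1)" "\<phi> (d (p - 1) w) = d' (p - 1) (\<phi> w)"
    using w(1) assms(1) unfolding cochain_map_def by blast+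
  then show ?thesis unfolding coboundaries_def w(2) by (metis imageI)
qed

text \<open>\<open>cohomology_map\<close> saturates the image of a class under the target relation.
  As \<open>\<phi>\<close> respects coboundaries, that image already lies in a single class, so any
  representative computes the induced map.\<close>

lemma cohomology_map_class:
  assumes "cochain_complex C d" "cochain_complex C' d'" "cochain_map C d C' d' \<phi>" "z \<in> cocycles C d p"
  shows "cohomology_map C' d' p \<phi> (cohomologous C d p `` {z}) = cohomologous C' d' p `` {\<phi> z}"
proof -
  note E = equiv_cohomologous[OF assms(1), of p] and E' = equiv_cohomologous[OF assms(2), of p]
  have *: "(\<phi> x, \<phi> y) \<in> cohomologous C' d' p" if "(x, y) \<in> cohomologous C d p" for x y
  proof -
    have xy: "x \<in> cocycles C d p" "y \<in> cocycles C d p" "x - y \<in> coboundaries C d p"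
      using that by (auto simp: cohomologous_def)
    moreover have "\<phi> (x - y) = \<phi> x - \<phi> y"
      using assms(1,3) xy(1,2)
      by (intro linear_map_on_diff[of "C p"]) (auto simp: cochain_complex_def cochain_map_def cocycles_def)
    ultimately show ?thesis
      using cochain_map_cocycle[OF assms(2,3)] cochain_map_coboundary[OF assms(3) xy(3)]
      by (simp add: cohomologous_def)
  qed
  have "z \<in> cohomologous C d p `` {z}" by (rule equiv_class_self[OF E assms(4)])
  then have "\<phi> z \<in> \<phi> ` (cohomologous C d p `` {z})" by (rule imageI)
  moreover have "trans (cohomologous C' d' p)" using E' by (simp add: equiv_def)
  ultimately show ?thesis
    unfolding cohomology_map_def by (auto intro: transD[OF _ *])
qed

text \<open>Two classes agree exactly when the difference of representatives is a coboundary, so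
  bijectivity becomes a kernel and an image condition on cocycles. Later arguments use this form and
  avoid quotient sets.\<close>

lemma quasi_isomorphism_iff:
  "quasi_isomorphism C d C' d' \<phi> \<longleftrightarrow>
    cochain_complex C d \<and> cochain_complex C' d' \<and> cochain_map C d C' d' \<phi> \<and>
    (\<forall>p. \<forall>z\<in>cocycles C d p. \<phi> z \<in> coboundaries C' d' p \<longrightarrow> z \<in> coboundaries C d p) \<and>
    (\<forall>p. \<forall>y\<in>cocycles C' d' p. \<exists>z\<in>cocycles C d p. y - \<phi> z \<in> coboundaries C' d' p)"
proof -
  have "bij_betw (cohomology_map C' d' p \<phi>) (cohomology C d p) (cohomology C' d' p) \<longleftrightarrow>
      (\<forall>z\<in>cocycles C d p. \<phi> z \<in> coboundaries C' d' p \<longrightarrow> z \<in> coboundaries C d p) \<and>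
      (\<forall>y\<in>cocycles C' d' p. \<exists>z\<in>cocycles C d p. y - \<phi> z \<in> coboundaries C' d' p)" (is "?L \<longleftrightarrow> ?I \<and> ?S")
    if A: "cochain_complex C d" "cochain_complex C' d'" "cochain_map C d C' d' \<phi>" for p
  proof -
    note E = equiv_cohomologous[OF A(1), of p] and E' = equiv_cohomologous[OF A(2), of p]
    let ?Z = "cocycles C d p" and ?Z' = "cocycles C' d' p"
    let ?R = "cohomologous C d p" and ?R' = "cohomologous C' d' p"
    let ?H = "cohomology_map C' d' p \<phi>"
    note Z = subspace_cocycles[OF A(1), of p] and Z' = cochain_map_cocycle[OF A(2,3), of _ p]
    note cls = cohomology_map_class[OF A, of _ p]
    have coh: "cohomology C d p = (\<lambda>z. ?R `` {z}) ` ?Z" "cohomology C' d' p = (\<lambda>z. ?R' `` {z}) ` ?Z'"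
      unfolding cohomology_def quotient_def by blast+
    have diff: "\<phi> (x - y) = \<phi> x - \<phi> y" if "x \<in> ?Z" "y \<in> ?Z" for x y
      using A that
      by (intro linear_map_on_diff[of "C p"]) (auto simp: cochain_complex_def cochain_map_def cocycles_def)
    have eq: "?R `` {x} = ?R `` {y} \<longleftrightarrow> x - y \<in> coboundaries C d p" if "x \<in> ?Z" "y \<in> ?Z" for x y
      using eq_equiv_class_iff[OF E that] that by (simp add: cohomologous_def)
    have eq': "?R' `` {x} = ?R' `` {y} \<longleftrightarrow> x - y \<in> coboundaries C' d' p" if "x \<in> ?Z'" "y \<in> ?Z'" for x y
      using eq_equiv_class_iff[OF E' that] that by (simp add: cohomologous_def)
    have inj: "inj_on ?H (cohomology C d p) \<longleftrightarrow> ?I"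
    proof
      assume inj: "inj_on ?H (cohomology C d p)"
      show ?I
      proof (intro ballI impI)
        fix z assume z: "z \<in> ?Z" "\<phi> z \<in> coboundaries C' d' p"
        have 0: "0 \<in> ?Z" "\<phi> 0 = 0"
          using subspace_0[OF Z] diff[of z z] z(1) by auto
        have "?H (?R `` {z}) = ?H (?R `` {0})"
          using z 0 eq'[OF Z'[OF z(1)] Z'[OF 0(1)]] by (simp add: cls)
        then have "?R `` {z} = ?R `` {0}"
          using inj z(1) 0(1) unfolding coh by (auto dest: inj_onD)
        then show "z \<in> coboundaries C d p" using eq z(1) 0 by simp
      qed
    next
      assume I: ?I
      show "inj_on ?H (cohomology C d p)"
        unfolding coh
      proof (rule inj_onI, elim imageE)
        fix X Y x y assume *: "?H X = ?H Y" "X = ?R `` {x}" "Y = ?R `` {y}" "x \<in> ?Z" "y \<in> ?Z"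
        then have "\<phi> (x - y) \<in> coboundaries C' d' p"
          using cls eq' Z' diff by auto
        then have "x - y \<in> coboundaries C d p" using I * subspace_diff[OF Z] by blast
        then show "X = Y" using * eq by simp
      qed
    qed
    have im: "?H ` cohomology C d p = (\<lambda>z. ?R' `` {\<phi> z}) ` ?Z"
      unfolding coh image_image by (intro image_cong refl cls)
    have "?H ` cohomology C d p = cohomology C' d' p \<longleftrightarrow> ?S"
    proof
      assume *: "?H ` cohomology C d p = cohomology C' d' p"
      show ?S
      proof
        fix y assume y: "y \<in> ?Z'"
        have "?R' `` {y} \<in> cohomology C' d' p"
          unfolding coh(2) using y by (rule imageI)
        then have "?R' `` {y} \<in> (\<lambda>z. ?R' `` {\<phi> z}) ` ?Z"
          by (simp only: *[symmetric] im)
        then obtain z where z: "z \<in> ?Z" "?R' `` {y} = ?R' `` {\<phi> z}" by (rule imageE)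
        then show "\<exists>z\<in>?Z. y - \<phi> z \<in> coboundaries C' d' p"
          using eq'[OF y Z'[OF z(1)]] by blast
      qed
    next
      assume S: ?S
      have "?R' `` {y} \<in> (\<lambda>z. ?R' `` {\<phi> z}) ` ?Z" if y: "y \<in> ?Z'" for y
      proof -
        obtain z where z: "z \<in> ?Z" "y - \<phi> z \<in> coboundaries C' d' p"
          using bspec[OF S y] by (rule bexE)
        then have "?R' `` {y} = ?R' `` {\<phi> z}" using eq'[OF y Z'[OF z(1)]] by simp
        then show ?thesis using z(1) by (rule image_eqI)
      qed
      then have "cohomology C' d' p \<subseteq> (\<lambda>z. ?R' `` {\<phi> z}) ` ?Z"
        unfolding coh(2) by (rule image_subsetI)
      moreover have "(\<lambda>z. ?R' `` {\<phi> z}) ` ?Z \<subseteq> cohomology C' d' p"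
        unfolding coh(2) by (intro image_subsetI imageI Z')
      ultimately show "?H ` cohomology C d p = cohomology C' d' p"
        unfolding im by (rule subset_antisym[rotated])
    qed
    with inj show ?thesis by (simp add: bij_betw_def)
  qed
  then show ?thesis unfolding quasi_isomorphism_def by blast
qed

text \<open>
  The cone of \<open>\<phi>\<close> is acyclic as soon as its associated graded complex is: primitives are corrected
  one filtration step at a time, and the corrections are summed using completeness.
\<close>

lemma quasi_isomorphism_complete_filtration:
  fixes C :: "int \<Rightarrow> 'a::real_vector set" and C' :: "int \<Rightarrow> 'b::real_vector set"
    and FC :: "nat \<Rightarrow> 'a set" and FC' :: "nat \<Rightarrow> 'b set"
  assumes cx: "cochain_complex C d" and cx': "cochain_complex C' d'" and map: "cochain_map C d C' d' \<phi>"
    and sub: "\<And>n. subspace (FC n)" and sub': "\<And>n. subspace (FC' n)"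
    and top: "\<And>p. C p \<subseteq> FC 0" and top': "\<And>p. C' p \<subseteq> FC' 0"
    and sep: "\<And>x. (\<And>n. x \<in> FC n) \<Longrightarrow> x = 0" and sep': "\<And>x. (\<And>n. x \<in> FC' n) \<Longrightarrow> x = 0"
    and d_FC: "\<And>n p x. x \<in> C p \<Longrightarrow> x \<in> FC n \<Longrightarrow> d p x \<in> FC n"
    and d_FC': "\<And>n p x. x \<in> C' p \<Longrightarrow> x \<in> FC' n \<Longrightarrow> d' p x \<in> FC' n"
    and map_FC: "\<And>n p x. x \<in> C p \<Longrightarrow> x \<in> FC n \<Longrightarrow> \<phi> x \<in> FC' n"
    and complete: "\<And>p x. (\<And>n. x n \<in> C p \<inter> FC n) \<Longrightarrow> \<exists>s\<in>C p. \<forall>n. s - (\<Sum>i<n. x i) \<in> FC n"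
    and complete': "\<And>p x. (\<And>n. x n \<in> C' p \<inter> FC' n) \<Longrightarrow> \<exists>s\<in>C' p. \<forall>n. s - (\<Sum>i<n. x i) \<in> FC' n"
    and gr_inj: "\<And>n p a b. a \<in> C p \<Longrightarrow> a \<in> FC n \<Longrightarrow> d p a \<in> FC (Suc n) \<Longrightarrow> b \<in> C' (p - 1) \<Longrightarrow> b \<in> FC' n \<Longrightarrow>
      \<phi> a - d' (p - 1) b \<in> FC' (Suc n) \<Longrightarrow> \<exists>u\<in>C (p - 1) \<inter> FC n. a - d (p - 1) u \<in> FC (Suc n)"
    and gr_surj: "\<And>n p c. c \<in> C' p \<Longrightarrow> c \<in> FC' n \<Longrightarrow> d' p c \<in> FC' (Suc n) \<Longrightarrow>
      \<exists>z\<in>C p \<inter> FC n. \<exists>w\<in>C' (p - 1) \<inter> FC' n. d p z \<in> FC (Suc n) \<and> c - \<phi> z - d' (p - 1) w \<in> FC' (Suc n)"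
  shows "quasi_isomorphism C d C' d' \<phi>"
proof -
  have C: "subspace (C p)" "linear_map_on (C p) (d p)" "x \<in> C p \<Longrightarrow> d p x \<in> C (p + 1)"
    "x \<in> C p \<Longrightarrow> d (p + 1) (d p x) = 0" for p x
    using cx unfolding cochain_complex_def by auto
  have C': "subspace (C' p)" "linear_map_on (C' p) (d' p)" "x \<in> C' p \<Longrightarrow> d' p x \<in> C' (p + 1)"
    "x \<in> C' p \<Longrightarrow> d' (p + 1) (d' p x) = 0" for p x
    using cx' unfolding cochain_complex_def by auto
  have \<phi>: "linear_map_on (C p) \<phi>" "x \<in> C p \<Longrightarrow> \<phi> x \<in> C' p" "x \<in> C p \<Longrightarrow> \<phi> (d p x) = d' p (\<phi> x)" for p x
    using map unfolding cochain_map_def by auto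
  note dd = linear_map_on_diff[OF C(1,2)] and dd' = linear_map_on_diff[OF C'(1,2)]
    and \<phi>d = linear_map_on_diff[OF C(1) \<phi>(1)]
  \<comment> \<open>Up to sign conventions, \<open>(a, b)\<close> is a cocycle of the mapping cone
    and \<open>(u, w)\<close> a primitive. Taking for \<open>b\<close> a primitive of
    \<open>\<phi> a\<close> gives injectivity on cohomology, taking \<open>a = 0\<close> gives
    surjectivity.\<close>
  have cone: "\<exists>u\<in>C p. \<exists>w\<in>C' (p - 1). a = d p u \<and> b = \<phi> u + d' (p - 1) w"
    if a0: "a \<in> C (p + 1)" and b0: "b \<in> C' p" and da0: "d (p + 1) a = 0" and ab0: "\<phi> a = d' p b" for p a b
  proof -
    define P where "P n a b \<longleftrightarrow> a \<in> C (p + 1) \<and> a \<in> FC n \<and> b \<in> C' p \<and> b \<in> FC' n \<and> d (p + 1) a = 0 \<and> \<phi> a = d' p b"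
      for n a b
    define Q where "Q n a b u w \<longleftrightarrow> u \<in> C p \<inter> FC n \<and> w \<in> C' (p - 1) \<inter> FC' n \<and>
        P (Suc n) (a - d p u) (b - \<phi> u - d' (p - 1) w)" for n a b u w
    \<comment> \<open>\<open>gr_inj\<close> moves \<open>a\<close> into the next step by subtracting
      \<open>d p u\<close>. This replaces \<open>b\<close> by \<open>b - \<phi> u\<close>, whose
      differential \<open>\<phi> (a - d p u)\<close> then also lies in the next step, so
      \<open>gr_surj\<close> applies to it. The \<open>z\<close> it supplies can be added to
      \<open>u\<close> without spoiling \<open>a\<close>, because \<open>d p z\<close> lies in the
      next step.\<close>
    have step: "\<exists>u w. Q n a b u w" if "P n a b" for n a b
    proof -
      have a: "a \<in> C (p + 1)" "a \<in> FC n" "b \<in> C' p" "b \<in> FC' n" "d (p + 1) a = 0" "\<phi> a = d' p b"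
        using that by (auto simp: P_def)
      obtain u where u: "u \<in> C p" "u \<in> FC n" "a - d p u \<in> FC (Suc n)"
        using gr_inj[of a "p + 1" n b] a subspace_0[OF sub] subspace_0[OF sub'] by auto
      let ?c = "b - \<phi> u"
      have c: "?c \<in> C' p" "?c \<in> FC' n"
        using subspace_diff[OF C'(1) a(3) \<phi>(2)[OF u(1)]]
          subspace_diff[OF sub' a(4) map_FC[OF u(1,2)]] by auto
      have "d' p ?c = \<phi> (a - d p u)"
        using a u \<phi>(2,3) C(3) by (simp add: dd' \<phi>d[of _ "p + 1"])
      then have "d' p ?c \<in> FC' (Suc n)"
        using map_FC[of "a - d p u" "p + 1"] a u C(3) subspace_diff[OF C(1)] by simp
      from gr_surj[OF c this] obtain z w where zw: "z \<in> C p" "z \<in> FC n" "w \<in> C' (p - 1)" "w \<in> FC' n"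
        "d p z \<in> FC (Suc n)" "?c - \<phi> z - d' (p - 1) w \<in> FC' (Suc n)" by blast
      have dw: "d' (p - 1) w \<in> C' p" "d' p (d' (p - 1) w) = 0"
        using C'(3,4)[OF zw(3)] by simp_all
      have uz: "u + z \<in> C p" "u + z \<in> FC n"
        using u zw subspace_add[OF C(1)] subspace_add[OF sub] by auto
      have duz: "d p (u + z) = d p u + d p z" "\<phi> (u + z) = \<phi> u + \<phi> z"
        using u zw C(2)[of p] \<phi>(1)[of p] unfolding linear_map_on_def by auto
      have 1: "a - d p (u + z) \<in> FC (Suc n)"
        unfolding duz diff_diff_eq[symmetric] by (rule subspace_diff[OF sub u(3) zw(5)])
      have 2: "b - \<phi> (u + z) - d' (p - 1) w \<in> FC' (Suc n)"
        unfolding duz diff_diff_eq[symmetric] by (rule zw(6)[unfolded diff_diff_eq[symmetric]])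
      have bc: "b - \<phi> (u + z) \<in> C' p"
        by (rule subspace_diff[OF C'(1) a(3) \<phi>(2)[OF uz(1)]])
      have 3: "d (p + 1) (a - d p (u + z)) = 0"
        using a(1,5) C(3,4)[OF uz(1)] by (simp add: dd)
      have "d' p (b - \<phi> (u + z) - d' (p - 1) w) = d' p b - d' p (\<phi> (u + z)) - 0"
        using a(3) dw \<phi>(2)[OF uz(1)] bc by (simp add: dd')
      also have "\<dots> = \<phi> (a - d p (u + z))"
        using a C(3)[OF uz(1)] \<phi>(3)[OF uz(1)] by (simp add: \<phi>d[of _ "p + 1"])
      finally have 4: "\<phi> (a - d p (u + z)) = d' p (b - \<phi> (u + z) - d' (p - 1) w)" ..
      have "a - d p (u + z) \<in> C (p + 1)" "b - \<phi> (u + z) - d' (p - 1) w \<in> C' p"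
        using subspace_diff[OF C(1) a(1) C(3)[OF uz(1)]] bc subspace_diff[OF C'(1) _ dw(1)] by auto
      with 1 2 3 4 uz zw(3,4) show ?thesis unfolding Q_def P_def by blast
    qed
    \<comment> \<open>The choices are functions of the step and the current remainder, so that the
      sequence of remainders can be defined by recursion.\<close>
    define cu where "cu n a b = (SOME u. \<exists>w. Q n a b u w)" for n a b
    define cw where "cw n a b = (SOME w. Q n a b (cu n a b) w)" for n a b
    have Q: "Q n a b (cu n a b) (cw n a b)" if "P n a b" for n a b
      unfolding cw_def by (rule someI_ex) (unfold cu_def, rule someI_ex[OF step[OF that]])
    define r where "r = rec_nat (a, b) (\<lambda>n (a, b). (a - d p (cu n a b), b - \<phi> (cu n a b) - d' (p - 1) (cw n a b)))"
    define ra rb where "ra n = fst (r n)" and "rb n = snd (r n)" for n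
    have r0: "ra 0 = a" "rb 0 = b" by (simp_all add: ra_def rb_def r_def)
    define u w where "u n = cu n (ra n) (rb n)" and "w n = cw n (ra n) (rb n)" for n
    have rS: "ra (Suc n) = ra n - d p (u n)" "rb (Suc n) = rb n - \<phi> (u n) - d' (p - 1) (w n)" for n
      by (simp_all add: ra_def rb_def r_def u_def w_def split: prod.splits)
    have P: "P n (ra n) (rb n)" for n
    proof (induct n)
      case 0
      show ?case using a0 b0 da0 ab0 subsetD[OF top a0] subsetD[OF top' b0] by (simp add: P_def r0)
    next
      case (Suc n)
      from Q[OF Suc] show ?case by (simp add: Q_def rS u_def w_def)
    qed
    have uw: "u n \<in> C p \<inter> FC n" "w n \<in> C' (p - 1) \<inter> FC' n" for n
      using Q[OF P[of n]] by (auto simp: Q_def u_def w_def)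
    obtain U where U: "U \<in> C p" "\<And>n. U - (\<Sum>i<n. u i) \<in> FC n"
      using complete[of u p] uw(1) by blast
    obtain W where W: "W \<in> C' (p - 1)" "\<And>n. W - (\<Sum>i<n. w i) \<in> FC' n"
      using complete'[of w "p - 1"] uw(2) by blast
    have us: "(\<Sum>i<n. u i) \<in> C p" and ws: "(\<Sum>i<n. w i) \<in> C' (p - 1)" for n
      using uw by (auto intro: subspace_sum[OF C(1)] subspace_sum[OF C'(1)])
    have sums: "d p (\<Sum>i<n. u i) = a - ra n \<and> \<phi> (\<Sum>i<n. u i) + d' (p - 1) (\<Sum>i<n. w i) = b - rb n" for n
    proof (induction n)
      case 0
      show ?case
        using linear_map_on_0[OF C(1,2)] linear_map_on_0[OF C(1) \<phi>(1)] linear_map_on_0[OF C'(1,2)]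
        by (simp add: r0)
    next
      case (Suc n)
      have "d p ((\<Sum>i<n. u i) + u n) = d p (\<Sum>i<n. u i) + d p (u n)"
        "\<phi> ((\<Sum>i<n. u i) + u n) = \<phi> (\<Sum>i<n. u i) + \<phi> (u n)"
        "d' (p - 1) ((\<Sum>i<n. w i) + w n) = d' (p - 1) (\<Sum>i<n. w i) + d' (p - 1) (w n)"
        using us uw ws C(2)[of p] C'(2)[of "p - 1"] \<phi>(1)[of p] unfolding linear_map_on_def by auto
      with Suc show ?case by (auto simp: rS algebra_simps)
    qed
    \<comment> \<open>The remainder after \<open>n\<close> corrections and the differential of the
      tail of the series both lie in step \<open>n\<close>; as \<open>n\<close> is arbitrary,
      \<open>sep\<close> applies.\<close>
    have "a - d p U \<in> FC n" for n
    proof -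
      have "a - d p U = ra n - d p (U - (\<Sum>i<n. u i))"
        using sums[of n] by (simp add: dd[OF U(1) us])
      also have "\<dots> \<in> FC n"
        using P[of n] d_FC[OF subspace_diff[OF C(1) U(1) us] U(2)]
        unfolding P_def by (intro subspace_diff[OF sub]) auto
      finally show ?thesis .
    qed
    moreover have "b - (\<phi> U + d' (p - 1) W) \<in> FC' n" for n
    proof -
      have "b - (\<phi> U + d' (p - 1) W) = rb n - \<phi> (U - (\<Sum>i<n. u i)) - d' (p - 1) (W - (\<Sum>i<n. w i))"
        using sums[of n] by (simp add: \<phi>d[OF U(1) us] dd'[OF W(1) ws] algebra_simps)
      also have "\<dots> \<in> FC' n"
        using P[of n] map_FC[OF subspace_diff[OF C(1) U(1) us] U(2)]
          d_FC'[OF subspace_diff[OF C'(1) W(1) ws] W(2)]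
        unfolding P_def by (intro subspace_diff[OF sub']) auto
      finally show ?thesis .
    qed
    ultimately have "a - d p U = 0" "b - (\<phi> U + d' (p - 1) W) = 0"
      using sep sep' by blast+
    then show ?thesis using U(1) W(1) by auto
  qed
  have "z \<in> coboundaries C d p" if "z \<in> cocycles C d p" "\<phi> z \<in> coboundaries C' d' p" for p z
    using that cone[of z "p - 1"] by (auto simp: cocycles_def coboundaries_def)
  moreover have "\<exists>z\<in>cocycles C d p. y - \<phi> z \<in> coboundaries C' d' p" if y: "y \<in> cocycles C' d' p" for p y
  proof -
    have "0 \<in> C (p + 1)" "d (p + 1) 0 = 0" "\<phi> 0 = 0"
      using subspace_0[OF C(1)] linear_map_on_0[OF C(1,2)] linear_map_on_0[OF C(1) \<phi>(1)] by auto
    then obtain u w where "u \<in> C p" "w \<in> C' (p - 1)" "0 = d p u" "y = \<phi> u + d' (p - 1) w"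
      using cone[of 0 p y] y by (auto simp: cocycles_def)
    then show ?thesis
      by (intro bexI[of _ u]) (auto simp: cocycles_def coboundaries_def)
  qed
  ultimately show ?thesis
    unfolding quasi_isomorphism_iff using cx cx' map by blast
qed

section \<open>Homogeneous maps and contractions\<close>

lemma HomI: "linear f \<Longrightarrow> (\<And>n x. x \<in> gr n \<Longrightarrow> f x \<in> gr (n + p)) \<Longrightarrow> f \<in> Hom p"
  by (auto simp: Hom_def)

lemma Hom_linear: "f \<in> Hom p \<Longrightarrow> linear f"
  by (simp add: Hom_def)

lemma Hom_gr: "f \<in> Hom p \<Longrightarrow> x \<in> gr n \<Longrightarrow> m = n + p \<Longrightarrow> f x \<in> gr m"
  by (auto simp: Hom_def)

lemma Hom_comp: "f \<in> Hom p \<Longrightarrow> g \<in> Hom q \<Longrightarrow> r = p + q \<Longrightarrow> g \<circ> f \<in> Hom r"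
proof (rule HomI)
  assume *: "f \<in> Hom p" "g \<in> Hom q" "r = p + q"
  then show "linear (g \<circ> f)" by (simp add: linear_compose Hom_linear)
  show "(g \<circ> f) x \<in> gr (n + r)" if "x \<in> gr n" for n x
    using Hom_gr[OF *(2) Hom_gr[OF *(1) that refl] refl] *(3) by (simp add: add.assoc)
qed

lemma id_in_Hom: "id \<in> Hom 0"
  by (intro HomI) (auto simp: linear_iff)

lemmas ident_in_Hom = id_in_Hom[unfolded id_def]

lemma subspace_Hom: "subspace (Hom p)"
proof (rule subspaceI)
  show "0 \<in> (Hom p :: ('a \<Rightarrow> 'b) set)"
    by (intro HomI) (auto simp: linear_iff gr_zero)
  show "f + g \<in> Hom p" if "f \<in> Hom p" "g \<in> Hom p" for f g :: "'a \<Rightarrow> 'b"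
    using that by (intro HomI) (simp_all add: plus_fun_def linear_compose_add Hom_linear gr_add Hom_gr)
  show "c *\<^sub>R f \<in> Hom p" if "f \<in> Hom p" for c and f :: "'a \<Rightarrow> 'b"
    using that by (intro HomI) (simp_all add: scaleR_fun_def linear_compose_scale_right Hom_linear gr_scaleR Hom_gr)
qed

lemma linear_gr_eqI:
  assumes "linear f" "linear g" "\<And>n x. x \<in> gr n \<Longrightarrow> f x = g x"
  shows "f (x :: 'a::graded_vector) = g x"
proof (rule linear_eq_on_span[OF assms(1,2)])
  show "x \<in> span (\<Union>n. gr n)" by (simp add: span_gr)
qed (use assms(3) in blast)

section \<open>Maps glued from their homogeneous parts, and splittings\<close>

definition graded_lift :: "(int \<Rightarrow> 'a::graded_vector \<Rightarrow> 'b::real_vector) \<Rightarrow> 'a \<Rightarrow> 'b" where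
  "graded_lift L v = (\<Sum>n | gr_components v n \<noteq> 0. L n (gr_components v n))"

lemma graded_lift_superset:
  assumes "\<And>n. linear (L n)" "finite A" "{n. gr_components v n \<noteq> 0} \<subseteq> A"
  shows "graded_lift L v = (\<Sum>n\<in>A. L n (gr_components v n))"
  unfolding graded_lift_def
  by (rule sum.mono_neutral_left) (use assms in \<open>auto simp: linear_0\<close>)

lemma linear_graded_lift:
  assumes L: "\<And>n. linear (L n)" shows "linear (graded_lift L)"
proof (rule linearI)
  fix v w :: 'a and c :: real
  let ?A = "{n. gr_components v n \<noteq> 0} \<union> {n. gr_components w n \<noteq> 0}"
  have "finite ?A" by (simp add: finite_components)
  moreover have "{n. gr_components (v + w) n \<noteq> 0} \<subseteq> ?A" by (auto simp: components_add)
  ultimately show "graded_lift L (v + w) = graded_lift L v + graded_lift L w"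
    by (simp add: graded_lift_superset[OF L, where A = ?A] components_add linear_add[OF L] sum.distrib)
  have "graded_lift L (c *\<^sub>R v) = (\<Sum>n | gr_components v n \<noteq> 0. L n (gr_components (c *\<^sub>R v) n))"
    by (rule graded_lift_superset[OF L]) (auto simp: finite_components components_scaleR)
  then show "graded_lift L (c *\<^sub>R v) = c *\<^sub>R graded_lift L v"
    by (simp add: graded_lift_def components_scaleR linear_scale[OF L] scaleR_sum_right)
qed

lemma graded_lift_homogeneous: "(\<And>n. linear (L n)) \<Longrightarrow> v \<in> gr n \<Longrightarrow> graded_lift L v = L n v"
  by (subst graded_lift_superset[where A = "{n}"]) (auto simp: components_homogeneous split: if_splits)

text \<open>Over a field a linear map has a right inverse on its image. Choosing one with values in
  \<open>gr n\<close> separately for each \<open>n\<close>, and gluing, makes the result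
  homogeneous.\<close>

lemma Hom_generalized_inverse:
  assumes T: "T \<in> Hom d" shows "\<exists>s\<in>Hom (-d). \<forall>x. T (s (T x)) = T x"
proof -
  have "\<exists>g. g ` UNIV \<subseteq> gr n \<and> linear g \<and> (\<forall>v\<in>T ` gr n. T (g v) = v)" for n
    by (rule linear_exists_right_inverse_on[OF Hom_linear[OF T] subspace_gr])
  then obtain G where "\<And>n. G n ` UNIV \<subseteq> gr n \<and> linear (G n) \<and> (\<forall>v\<in>T ` gr n. T (G n v) = v)"
    by metis
  then have G: "\<And>n v. G n v \<in> gr n" "\<And>n. linear (G n)" "\<And>n x. x \<in> gr n \<Longrightarrow> T (G n (T x)) = T x"
    by blast+
  \<comment> \<open>\<open>T\<close> reaches degree \<open>n\<close> from degree
    \<open>n - d\<close>, so the right inverse used in degree \<open>n\<close> is the one chosen for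
    \<open>n - d\<close>.\<close>
  define s where "s = graded_lift (\<lambda>n. G (n - d))"
  have s: "s v = G (n - d) v" if "v \<in> gr n" for n v
    unfolding s_def by (rule graded_lift_homogeneous[OF G(2) that])
  have "linear s" unfolding s_def by (rule linear_graded_lift[OF G(2)])
  then have sH: "s \<in> Hom (-d)"
    by (rule HomI) (use G(1) s in auto)
  have "T (s (T x)) = T x" for x
  proof (rule linear_gr_eqI[of "\<lambda>x. T (s (T x))" T])
    show "linear (\<lambda>x. T (s (T x)))"
      using linear_compose[OF linear_compose[OF Hom_linear[OF T] \<open>linear s\<close>] Hom_linear[OF T]]
      by (simp add: o_def)
    show "T (s (T x)) = T x" if "x \<in> gr n" for n x
      using s[OF Hom_gr[OF T that refl]] G(3)[OF that] by simp
  qed (rule Hom_linear[OF T])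
  with sH show ?thesis by blast
qed

text \<open>Deformation retraction of \<open>(V, l)\<close> onto a complex with zero differential.\<close>

definition contraction ::
    "('a::graded_vector \<Rightarrow> 'a) \<Rightarrow> ('a \<Rightarrow> 'a) \<Rightarrow> ('a \<Rightarrow> 'a) \<Rightarrow> bool" where
  "contraction l p h \<longleftrightarrow> l \<in> Hom 1 \<and> p \<in> Hom 0 \<and> h \<in> Hom (-1) \<and> (\<forall>x. l (l x) = 0) \<and>
     (\<forall>x. l (p x) = 0) \<and> (\<forall>x. p (l x) = 0) \<and> (\<forall>x. p (p x) = p x) \<and>
     (\<forall>x. p x = x - l (h x) - h (l x))"

lemma ex_contraction:
  assumes l: "l \<in> Hom 1" and ll: "\<And>x. l (l x) = 0"
  shows "\<exists>p h. contraction l p h"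
proof -
  obtain s where s: "s \<in> Hom (-1)" and lsl: "\<And>x. l (s (l x)) = l x"
    using Hom_generalized_inverse[OF l] by auto
  note lin = linear_diff[OF Hom_linear[OF l]] linear_diff[OF Hom_linear[OF s]]
    linear_0[OF Hom_linear[OF l]] linear_0[OF Hom_linear[OF s]]
  \<comment> \<open>Put \<open>h1 = s l s\<close>; then \<open>l h1 l = l\<close> and
    \<open>h1 l h1 = h1\<close>. The formula is \<open>h1 - l h1 h1\<close>. The correction yields
    \<open>h h = 0\<close> and hence \<open>l h h l = 0\<close>, which is what idempotence of
    \<open>p = id - l h - h l\<close> requires beyond \<open>l h l = l\<close> and
    \<open>h l h = h\<close>.\<close>
  define h where "h = (s \<circ> l \<circ> s) - (l \<circ> s \<circ> s \<circ> l \<circ> s)"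
  define p where "p = id - (l \<circ> h) - (h \<circ> l)"
  have h: "h \<in> Hom (-1)"
    unfolding h_def
    by (rule subspace_diff[OF subspace_Hom Hom_comp[OF s Hom_comp[OF l s refl]]
          Hom_comp[OF s Hom_comp[OF l Hom_comp[OF s Hom_comp[OF s l refl] refl] refl]]]) auto
  have p: "p \<in> Hom 0"
    unfolding p_def by (intro subspace_diff[OF subspace_Hom] Hom_comp[OF h l] Hom_comp[OF l h] id_in_Hom) auto
  have h_ap: "h x = s (l (s x)) - l (s (s (l (s x))))" for x by (simp add: h_def)
  have p_ap: "p x = x - l (s x) - (s (l x) - l (s (s (l x))))" for x
    by (simp add: p_def h_ap lin ll lsl)
  have "contraction l p h"
    unfolding contraction_def
    using l p h by (auto simp: p_ap h_ap lin ll lsl)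
  then show ?thesis by blast
qed

text \<open>The images of \<open>p\<close> and \<open>p'\<close> are copies of the cohomologies, and
  \<open>T = p' \<phi> p\<close> is the map that \<open>\<phi>\<close> induces between them. A
  generalised inverse of \<open>T\<close> is therefore a true inverse there. Sandwiching it between
  \<open>p\<close> and \<open>p'\<close> makes the differentials vanish against
  \<open>\<theta>\<close> on both sides.\<close>

lemma contraction_inverse:
  fixes l :: "'a::graded_vector \<Rightarrow> 'a" and l' :: "'b::graded_vector \<Rightarrow> 'b"
  assumes c: "contraction l p h" and c': "contraction l' p' h'" and \<phi>: "\<phi> \<in> Hom 0"
    and qi: "quasi_isomorphism gr (\<lambda>_. l) gr (\<lambda>_. l') \<phi>"
  shows "\<exists>\<theta>\<in>Hom 0. (\<forall>x. \<theta> (\<phi> (p x)) = p x) \<and> (\<forall>y. p' (\<phi> (\<theta> y)) = p' y) \<and>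
    (\<forall>y. l (\<theta> y) = 0) \<and> (\<forall>y. \<theta> (l' y) = 0)"
proof -
  have inj: "z \<in> l ` gr (n - 1)" if "z \<in> gr n" "l z = 0" "\<phi> z \<in> l' ` gr (n - 1)" for n z
    using qi that unfolding quasi_isomorphism_iff cocycles_def coboundaries_def by blast
  have surj: "\<exists>z\<in>gr n. l z = 0 \<and> y - \<phi> z \<in> l' ` gr (n - 1)" if "y \<in> gr n" "l' y = 0" for n y
    using qi that unfolding quasi_isomorphism_iff cocycles_def coboundaries_def by blast
  have l: "l \<in> Hom 1" "p \<in> Hom 0" "h \<in> Hom (-1)"
    and lp: "\<And>x. l (p x) = 0" "\<And>x. p (l x) = 0" "\<And>x. p (p x) = p x" "\<And>x. p x = x - l (h x) - h (l x)"
    using c unfolding contraction_def by blast+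
  have l': "l' \<in> Hom 1" "p' \<in> Hom 0" "h' \<in> Hom (-1)"
    and lp': "\<And>x. l' (p' x) = 0" "\<And>x. p' (l' x) = 0" "\<And>x. p' (p' x) = p' x"
      "\<And>x. p' x = x - l' (h' x) - h' (l' x)"
    using c' unfolding contraction_def by blast+
  note lin = l[THEN Hom_linear] l'[THEN Hom_linear] Hom_linear[OF \<phi>]
  note diff = lin[THEN linear_diff] and zero = lin[THEN linear_0]
  have chain: "\<phi> (l x) = l' (\<phi> x)" for x
  proof (rule linear_gr_eqI[of "\<lambda>x. \<phi> (l x)" "\<lambda>x. l' (\<phi> x)"])
    show "linear (\<lambda>x. \<phi> (l x))" "linear (\<lambda>x. l' (\<phi> x))"
      using linear_compose[OF lin(1) lin(7)] linear_compose[OF lin(7) lin(4)] by (simp_all add: o_def)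
    show "\<phi> (l x) = l' (\<phi> x)" if "x \<in> gr n" for n x
      using qi that unfolding quasi_isomorphism_def cochain_map_def by blast
  qed
  define T where "T = p' \<circ> \<phi> \<circ> p"
  have T: "T \<in> Hom 0"
    unfolding T_def by (intro Hom_comp[OF l(2) Hom_comp[OF \<phi> l'(2)]]) auto
  obtain s where s: "s \<in> Hom 0" and TsT: "\<And>x. T (s (T x)) = T x"
    using Hom_generalized_inverse[OF T] by auto
  note slin = Hom_linear[OF s] and Tlin = Hom_linear[OF T]
  define \<theta> where "\<theta> = p \<circ> s \<circ> p'"
  have \<theta>: "\<theta> \<in> Hom 0"
    unfolding \<theta>_def by (intro Hom_comp[OF l'(2) Hom_comp[OF s l(2)]]) auto
  have psT: "p (s (T x)) = p x" for x
  proof (rule linear_gr_eqI[of "\<lambda>x. p (s (T x))" p])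
    show "linear (\<lambda>x. p (s (T x)))"
      using linear_compose[OF linear_compose[OF Tlin slin] lin(2)] by (simp add: o_def)
    show "p (s (T x)) = p x" if x: "x \<in> gr n" for n x
    proof -
      \<comment> \<open>\<open>u\<close> is the failure of \<open>s\<close> to be a left inverse of
        \<open>T\<close>, so \<open>T u = 0\<close>. Then the cocycle \<open>\<phi> (p u)\<close>
        has no component in the image of \<open>p'\<close> and is a boundary; by injectivity
        \<open>p u\<close> is a boundary, and \<open>p\<close> kills boundaries while fixing
        \<open>p u\<close>.\<close>
      define u where "u = s (T x) - x"
      have u: "u \<in> gr n"
        unfolding u_def using x Hom_gr[OF s Hom_gr[OF T x refl] refl]
        by (intro subspace_diff[OF subspace_gr]) simp_all
      have "T u = 0" by (simp add: u_def TsT linear_diff[OF Tlin])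
      then have "\<phi> (p u) = l' (h' (\<phi> (p u)))"
        using lp'(4)[of "\<phi> (p u)"] by (simp add: T_def chain[symmetric] lp(1) zero)
      moreover have "h' (\<phi> (p u)) \<in> gr (n - 1)"
        using Hom_gr[OF l'(3) Hom_gr[OF \<phi> Hom_gr[OF l(2) u refl] refl] refl] by simp
      ultimately have "\<phi> (p u) \<in> l' ` gr (n - 1)" by (rule image_eqI)
      then obtain w where "p u = l w"
        using inj[of "p u" n] Hom_gr[OF l(2) u] lp(1) by auto
      then have "p u = 0" using lp(2,3) by metis
      then show ?thesis by (simp add: u_def diff)
    qed
  qed (rule lin(2))
  have "p' (\<phi> (\<theta> y)) = p' y" for y
  proof (rule linear_gr_eqI[of "\<lambda>y. p' (\<phi> (\<theta> y))" p'])
    show "linear (\<lambda>y. p' (\<phi> (\<theta> y)))"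
      using linear_compose[OF linear_compose[OF Hom_linear[OF \<theta>] lin(7)] lin(5)] by (simp add: o_def)
    show "p' (\<phi> (\<theta> y)) = p' y" if y: "y \<in> gr n" for n y
    proof -
      \<comment> \<open>Surjectivity represents \<open>p' y\<close> by a cocycle \<open>z\<close>.
        As \<open>z\<close> and \<open>p z\<close> differ by \<open>l (h z)\<close>, it may be
        replaced by \<open>p z\<close>, which exhibits \<open>p' y\<close> as a value of
        \<open>T\<close>.\<close>
      obtain z w where z: "l z = 0" "p' y - \<phi> z = l' w"
        using surj[OF Hom_gr[OF l'(2) y refl]] lp'(1) by auto
      have "p' y = p' (\<phi> z + l' w)"
        using z(2) lp'(3) by (metis diff_add_cancel add.commute)
      also have "\<phi> z = \<phi> (p z + l (h z))"
        using lp(4)[of z] z(1) by (simp add: zero)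
      also have "p' (\<phi> (p z + l (h z)) + l' w) = T z"
        using lin[THEN linear_add] by (simp add: chain lp'(1-3) T_def)
      finally have "p' y = T z" .
      then show ?thesis using TsT[of z] by (simp add: \<theta>_def T_def)
    qed
  qed (rule lin(5))
  moreover have "\<theta> (\<phi> (p x)) = p x" for x using psT[of x] by (simp add: \<theta>_def T_def)
  moreover have "l (\<theta> y) = 0" "\<theta> (l' y) = 0" for y
    by (simp_all add: \<theta>_def lp(1-3) lp'(1-3) zero linear_0[OF slin])
  ultimately show ?thesis using \<theta> by blast
qed

section \<open>Recursion on the symmetric algebra\<close>

lemma subspace_equalizer: "linear f \<Longrightarrow> linear g \<Longrightarrow> subspace {x. f x = g x}"
  by (auto simp: subspace_def linear_simps linear_0)

lemma homogeneous_Cons_iff: "homogeneous ds (v # vs) \<longleftrightarrow> (\<exists>d es. ds = d # es \<and> v \<in> gr d \<and> homogeneous es vs)"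
  by (auto simp: homogeneous_def list_all2_Cons2)

lemma homogeneous_Nil_iff: "homogeneous ds [] \<longleftrightarrow> ds = []"
  by (simp add: homogeneous_def)

lemma word_gr: "homogeneous ds vs \<Longrightarrow> word vs \<in> gr (sum_list ds)"
  unfolding gr_sym_def by (rule span_base) blast

lemma word_homogeneous_induct [consumes 1, case_names Nil Cons]:
  assumes "homogeneous ds vs" and "P [] sym_one"
    and "\<And>m v es vs. v \<in> gr m \<Longrightarrow> homogeneous es vs \<Longrightarrow> P vs (word vs) \<Longrightarrow> P (v # vs) (sym_cons v (word vs))"
  shows "P vs (word vs)"
  using assms(1)
proof (induction vs arbitrary: ds)
  case Nil
  then show ?case using assms(2) by (simp add: sym_one_def)
next
  case (Cons v vs)
  then obtain d es where "ds = d # es" "v \<in> gr d" "homogeneous es vs"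
    by (auto simp: homogeneous_Cons_iff)
  then show ?case using Cons.IH assms(3) by (metis sym_cons_word)
qed

lemma sym_induct [case_names lin one cons]:
  assumes "subspace {y. P y}" and "P sym_one"
    and "\<And>m v n y. v \<in> gr m \<Longrightarrow> y \<in> gr n \<Longrightarrow> P y \<Longrightarrow> P (sym_cons v y)"
  shows "P y"
proof -
  have "P (word vs)" if "homogeneous ds vs" for ds and vs :: "'a list"
    using that by (rule word_homogeneous_induct) (rule assms(2), rule assms(3)[OF _ word_gr])
  then have "span {word vs | vs ds. homogeneous ds vs} \<subseteq> {y. P y}"
    by (intro span_minimal assms(1)) auto
  then show ?thesis unfolding span_homogeneous_word by blast
qed

text \<open>A whole family is proved at once because recursions below change the index: adding a
  factor turns a weight \<open>w\<close> into \<open>w \<circ> Suc\<close>, and a map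
  \<open>a\<close> into \<open>a \<circ> sym_cons v\<close>.\<close>

lemma sym_eqI_family:
  assumes "\<And>i. i \<in> I \<Longrightarrow> linear (f i)" "\<And>i. i \<in> I \<Longrightarrow> linear (g i)"
    and "\<And>i. i \<in> I \<Longrightarrow> f i sym_one = g i sym_one"
    and step: "\<And>i m v n y. i \<in> I \<Longrightarrow> v \<in> gr m \<Longrightarrow> y \<in> gr n \<Longrightarrow> (\<And>j. j \<in> I \<Longrightarrow> f j y = g j y) \<Longrightarrow>
      f i (sym_cons v y) = g i (sym_cons v y)"
    and "i \<in> I"
  shows "f i y = g i y"
proof -
  have "\<forall>i\<in>I. f i y = g i y"
  proof (induction y rule: sym_induct)
    case lin
    have "{y. \<forall>i\<in>I. f i y = g i y} = (\<Inter>i\<in>I. {y. f i y = g i y})" by auto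
    then show ?case
      using assms(1,2) by (simp only:) (intro subspace_Int subspace_equalizer)
  qed (use assms(3) step in auto)
  with assms(5) show ?thesis by blast
qed

lemma sym_eqI:
  assumes "linear f" "linear g" "f sym_one = g sym_one"
    and "\<And>m v n y. v \<in> gr m \<Longrightarrow> y \<in> gr n \<Longrightarrow> f y = g y \<Longrightarrow> f (sym_cons v y) = g (sym_cons v y)"
  shows "f y = g y"
  using sym_eqI_family[of "{()}" "\<lambda>_. f" "\<lambda>_. g" "()" y] assms by auto

lemma sym_HomI:
  assumes "linear f" and "f sym_one \<in> gr d"
    and "\<And>m v n y. v \<in> gr m \<Longrightarrow> y \<in> gr n \<Longrightarrow> f y \<in> gr (n + d) \<Longrightarrow> f (sym_cons v y) \<in> gr (m + n + d)"
  shows "f \<in> Hom d"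
proof (rule HomI[OF assms(1)])
  have word: "f (word vs) \<in> gr (sum_list ds + d)" if "homogeneous ds vs" for ds and vs :: "'a list"
    using that
  proof (induction vs arbitrary: ds)
    case Nil
    then show ?case using assms(2) by (simp add: sym_one_def homogeneous_Nil_iff)
  next
    case (Cons v vs)
    then obtain m es where ds: "ds = m # es" "v \<in> gr m" "homogeneous es vs"
      by (auto simp: homogeneous_Cons_iff)
    then show ?case using assms(3)[OF ds(2) word_gr[OF ds(3)] Cons.IH[OF ds(3)]] by simp
  qed
  fix n and x :: "'a sym" assume "x \<in> gr n"
  then have "f x \<in> span (f ` {word vs | vs ds. homogeneous ds vs \<and> sum_list ds = n})"
    unfolding gr_sym_def linear_span_image[OF assms(1)] by blast
  also have "\<dots> \<subseteq> gr (n + d)"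
    by (rule span_minimal[OF _ subspace_gr]) (use word in auto)
  finally show "f x \<in> gr (n + d)" .
qed

text \<open>Operators indexed by V that commute up to the Koszul sign make the target a module over
  S(V). This is the universal property of S(V), and \<open>sym_rec s e\<close> is the action on the
  element \<open>e\<close>. The sign depends only on the degrees in V, so the target carries no
  grading.\<close>

definition sym_step :: "('a::graded_vector \<Rightarrow> 'b::real_vector \<Rightarrow> 'b) \<Rightarrow> bool" where
  "sym_step s \<longleftrightarrow> bilin s \<and>
     (\<forall>m n a b t. a \<in> gr m \<longrightarrow> b \<in> gr n \<longrightarrow> s a (s b t) = (-1) powi (m * n) *\<^sub>R s b (s a t))"

definition sym_rec :: "('a::graded_vector \<Rightarrow> 'b::real_vector \<Rightarrow> 'b) \<Rightarrow> 'b \<Rightarrow> 'a sym \<Rightarrow> 'b" where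
  "sym_rec s e = sym_lift (\<lambda>vs. foldr s vs e)"

lemma sym_compatible_foldr:
  assumes "sym_step s" shows "sym_compatible (\<lambda>vs. foldr s vs e)"
proof -
  have s: "bilin s" using assms by (simp add: sym_step_def)
  have lin: "linear (foldr s vs)" for vs
  proof (induction vs)
    case (Cons v vs)
    then show ?case using linear_compose[OF Cons linear_bilin(2)[OF s]] by (simp add: o_def)
  qed (simp add: linear_iff)
  show ?thesis
    unfolding sym_compatible_def
  proof (intro conjI allI impI)
    show "linear (\<lambda>a. foldr s (xs @ a # ys) e)" for xs ys
      using linear_compose[OF linear_bilin(1)[OF s] lin] by (simp add: o_def)
    fix xs ys m n and a b :: 'a assume "a \<in> gr m" "b \<in> gr n"
    then have "s a (s b (foldr s ys e)) = (-1) powi (m * n) *\<^sub>R s b (s a (foldr s ys e))"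
      using assms unfolding sym_step_def by blast
    then show "foldr s (xs @ a # b # ys) e = (-1) powi (m * n) *\<^sub>R foldr s (xs @ b # a # ys) e"
      by (simp add: linear_simps[OF lin])
  qed
qed

lemma
  assumes "sym_step s"
  shows linear_sym_rec: "linear (sym_rec s e)"
    and sym_rec_one: "sym_rec s e sym_one = e"
    and sym_rec_cons: "sym_rec s e (sym_cons v y) = s v (sym_rec s e y)"
proof -
  note C = sym_compatible_foldr[OF assms]
  show lin: "linear (sym_rec s e)" unfolding sym_rec_def by (rule linear_sym_lift[OF C])
  show "sym_rec s e sym_one = e" by (simp add: sym_rec_def sym_one_def C)
  have "linear (\<lambda>y. sym_rec s e (sym_cons v y))" "linear (\<lambda>y. s v (sym_rec s e y))"
    using linear_compose[OF linear_bilin(2)[OF bilin_sym_cons] lin] linear_compose[OF lin linear_bilin(2)]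
      assms by (auto simp: o_def sym_step_def)
  then show "sym_rec s e (sym_cons v y) = s v (sym_rec s e y)"
  proof (rule linear_eq_on_span)
    show "y \<in> span (range word)" by (simp add: span_word)
  qed (auto simp: sym_rec_def C)
qed

lemmas sym_cons_simps = bilin_simps[OF bilin_sym_cons] bilin_zero[OF bilin_sym_cons]

lemma sym_one_gr: "sym_one \<in> gr 0"
  using word_gr[of "[]" "[]"] by (simp add: sym_one_def homogeneous_Nil_iff)

subsection \<open>Functoriality\<close>

definition sym_map :: "('a::graded_vector \<Rightarrow> 'b::graded_vector) \<Rightarrow> 'a sym \<Rightarrow> 'b sym" where
  "sym_map \<phi> = sym_rec (\<lambda>v. sym_cons (\<phi> v)) sym_one"

context
  fixes \<phi> :: "'a::graded_vector \<Rightarrow> 'b::graded_vector"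
  assumes \<phi>: "\<phi> \<in> Hom 0"
begin

lemma sym_step_map: "sym_step (\<lambda>v. sym_cons (\<phi> v))"
  unfolding sym_step_def
proof (intro conjI allI impI)
  show "bilin (\<lambda>v. sym_cons (\<phi> v))"
    by (rule bilinI) (simp_all add: sym_cons_simps linear_simps[OF Hom_linear[OF \<phi>]])
  show "sym_cons (\<phi> a) (sym_cons (\<phi> b) t) = (-1) powi (m * n) *\<^sub>R sym_cons (\<phi> b) (sym_cons (\<phi> a) t)"
    if "a \<in> gr m" "b \<in> gr n" for m n a b t
    by (rule sym_cons_swap) (use Hom_gr[OF \<phi>] that in auto)
qed

lemma linear_sym_map: "linear (sym_map \<phi>)"
  and sym_map_one: "sym_map \<phi> sym_one = sym_one"
  and sym_map_cons: "sym_map \<phi> (sym_cons v y) = sym_cons (\<phi> v) (sym_map \<phi> y)"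
  unfolding sym_map_def
  by (rule linear_sym_rec[OF sym_step_map] sym_rec_one[OF sym_step_map] sym_rec_cons[OF sym_step_map])+

lemma sym_map_Hom: "sym_map \<phi> \<in> Hom 0"
proof (rule sym_HomI[OF linear_sym_map])
  fix m n and v :: 'a and y :: "'a sym" assume "v \<in> gr m" "sym_map \<phi> y \<in> gr (n + 0)"
  then show "sym_map \<phi> (sym_cons v y) \<in> gr (m + n + 0)"
    using sym_cons_gr[OF Hom_gr[OF \<phi>]] by (simp add: sym_map_cons)
qed (simp add: sym_map_one sym_one_gr)

end

lemma sym_map_compose:
  assumes "\<phi> \<in> Hom 0" "\<psi> \<in> Hom 0"
  shows "sym_map \<psi> (sym_map \<phi> y) = sym_map (\<psi> \<circ> \<phi>) y"
proof (rule sym_eqI[where f = "\<lambda>y. sym_map \<psi> (sym_map \<phi> y)" and y = y])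
  have c: "\<psi> \<circ> \<phi> \<in> Hom 0" using Hom_comp[OF assms] by simp
  show "linear (\<lambda>y. sym_map \<psi> (sym_map \<phi> y))" "linear (sym_map (\<psi> \<circ> \<phi>))"
    using linear_compose[OF linear_sym_map[OF assms(1)] linear_sym_map[OF assms(2)]] linear_sym_map[OF c]
    by (simp_all add: o_def)
qed (use assms Hom_comp[OF assms, of 0] in \<open>simp_all add: sym_map_one sym_map_cons o_def\<close>)

subsection \<open>Derivations\<close>

text \<open>The Leibniz rule for \<open>v \<or> y\<close> involves both \<open>y\<close> and its
  derivative, so the recursion carries the pair of them. \<open>weighted\<close> supplies the sign
  of moving a map of degree \<open>d\<close> past a \<open>v\<close> that need not be
  homogeneous.\<close>

definition der_step ::
    "int \<Rightarrow> ('a::graded_vector \<Rightarrow> 'a) \<Rightarrow> 'a \<Rightarrow> 'a sym \<times> 'a sym \<Rightarrow> 'a sym \<times> 'a sym" where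
  "der_step d \<theta> v = (\<lambda>(y, z).
     (sym_cons v y, sym_cons (\<theta> v) y + sym_cons (weighted (\<lambda>n. (-1) powi (d * n)) v) z))"

definition sym_der :: "int \<Rightarrow> ('a::graded_vector \<Rightarrow> 'a) \<Rightarrow> 'a sym \<Rightarrow> 'a sym" where
  "sym_der d \<theta> y = snd (sym_rec (der_step d \<theta>) (sym_one, 0) y)"

context
  fixes \<theta> :: "'a::graded_vector \<Rightarrow> 'a" and d :: int
  assumes \<theta>: "\<theta> \<in> Hom d"
begin

lemma sym_step_der: "sym_step (der_step d \<theta>)"
  unfolding sym_step_def
proof (intro conjI allI impI)
  show "bilin (der_step d \<theta>)"
    by (rule bilinI)
      (simp_all add: der_step_def sym_cons_simps linear_simps[OF Hom_linear[OF \<theta>]] linear_simps[OF linear_weighted]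
        scaleR_add_right split: prod.splits)
  fix m n and a b :: 'a and t
  assume a: "a \<in> gr m" and b: "b \<in> gr n"
  have swap: "sym_cons a (sym_cons b y) = (-1) powi (m * n) *\<^sub>R sym_cons b (sym_cons a y)"
    "sym_cons (\<theta> a) (sym_cons b y) = (-1) powi ((m + d) * n) *\<^sub>R sym_cons b (sym_cons (\<theta> a) y)"
    "sym_cons a (sym_cons (\<theta> b) y) = (-1) powi (m * (n + d)) *\<^sub>R sym_cons (\<theta> b) (sym_cons a y)" for y
    using a b Hom_gr[OF \<theta>] by (auto intro!: sym_cons_swap)
  show "der_step d \<theta> a (der_step d \<theta> b t) = (-1) powi (m * n) *\<^sub>R der_step d \<theta> b (der_step d \<theta> a t)"
    by (cases t) (auto simp: der_step_def weighted_homogeneous[OF a] weighted_homogeneous[OF b]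
        sym_cons_simps swap sgn_powi scaleR_add_right)
qed

lemma fst_der_step: "fst (der_step d \<theta> v Y) = sym_cons v (fst Y)"
  by (simp add: der_step_def split: prod.splits)

lemma sym_der_fst: "fst (sym_rec (der_step d \<theta>) (sym_one, 0) y) = y"
proof (rule sym_eqI[of _ "\<lambda>y. y"])
  note lin = linear_sym_rec[OF sym_step_der]
  show "linear (\<lambda>y. fst (sym_rec (der_step d \<theta>) (sym_one, 0) y))" "linear (\<lambda>y :: 'a sym. y)"
    using linear_simps[OF lin] by (auto simp: linear_iff)
qed (simp_all add: sym_rec_one[OF sym_step_der] sym_rec_cons[OF sym_step_der] fst_der_step)

lemma linear_sym_der: "linear (sym_der d \<theta>)"
  using linear_simps[OF linear_sym_rec[OF sym_step_der]] by (auto simp: linear_iff sym_der_def)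

lemma sym_der_one: "sym_der d \<theta> sym_one = 0"
  by (simp add: sym_der_def sym_rec_one[OF sym_step_der])

lemma sym_der_cons: "v \<in> gr m \<Longrightarrow>
    sym_der d \<theta> (sym_cons v y) = sym_cons (\<theta> v) y + (-1) powi (d * m) *\<^sub>R sym_cons v (sym_der d \<theta> y)"
  using sym_der_fst[of y]
  by (auto simp: sym_der_def sym_rec_cons[OF sym_step_der] der_step_def weighted_homogeneous sym_cons_simps
      split: prod.splits)

lemma sym_der_Hom: "sym_der d \<theta> \<in> Hom d"
proof (rule sym_HomI[OF linear_sym_der])
  show "sym_der d \<theta> sym_one \<in> gr d" by (simp add: sym_der_one gr_zero)
  fix m n and v :: 'a and y :: "'a sym"
  assume v: "v \<in> gr m" and y: "y \<in> gr n" "sym_der d \<theta> y \<in> gr (n + d)"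
  have "sym_cons (\<theta> v) y \<in> gr (m + n + d)" "sym_cons v (sym_der d \<theta> y) \<in> gr (m + n + d)"
    using sym_cons_gr[OF Hom_gr[OF \<theta> v refl] y(1)] sym_cons_gr[OF v y(2)] by (simp_all add: ac_simps)
  then show "sym_der d \<theta> (sym_cons v y) \<in> gr (m + n + d)"
    by (simp add: sym_der_cons[OF v] gr_add gr_scaleR)
qed

end

lemma sym_map_der:
  fixes l :: "'a::graded_vector \<Rightarrow> 'a"
  assumes \<phi>: "\<phi> \<in> Hom 0" and l: "l \<in> Hom d" and l': "l' \<in> Hom d" and chain: "\<And>v. \<phi> (l v) = l' (\<phi> v)"
  shows "sym_map \<phi> (sym_der d l y) = sym_der d l' (sym_map \<phi> y)"
proof (rule sym_eqI[where y = y and f = "\<lambda>y. sym_map \<phi> (sym_der d l y)"])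
  note lin = linear_sym_map[OF \<phi>] linear_sym_der[OF l] linear_sym_der[OF l']
  show "linear (\<lambda>y. sym_map \<phi> (sym_der d l y))" "linear (\<lambda>y. sym_der d l' (sym_map \<phi> y))"
    using linear_compose[OF lin(2,1)] linear_compose[OF lin(1,3)] by (simp_all add: o_def)
  show "sym_map \<phi> (sym_der d l sym_one) = sym_der d l' (sym_map \<phi> sym_one)"
    by (simp add: sym_map_one[OF \<phi>] sym_der_one[OF l] sym_der_one[OF l'] linear_0[OF lin(1)])
  fix m n and v :: 'a and y :: "'a sym"
  assume v: "v \<in> gr m" and IH: "sym_map \<phi> (sym_der d l y) = sym_der d l' (sym_map \<phi> y)"
  have "\<phi> v \<in> gr m" using Hom_gr[OF \<phi> v] by simp
  from sym_der_cons[OF l' this]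
  show "sym_map \<phi> (sym_der d l (sym_cons v y)) = sym_der d l' (sym_map \<phi> (sym_cons v y))"
    by (simp add: sym_map_cons[OF \<phi>] sym_der_cons[OF l v] linear_simps[OF lin(1)] IH chain)
qed

text \<open>
  \<open>sym_split p q w\<close> maps \<open>v\<^sub>1 \<or> \<dots> \<or> v\<^sub>n\<close> to the sum over all sets \<open>I\<close> of indices of \<open>w (card I)\<close> times
  the product in which \<open>q\<close> is applied to the factors with index in \<open>I\<close> and \<open>p\<close> to the others.
\<close>

definition split_step ::
    "('a::graded_vector \<Rightarrow> 'a) \<Rightarrow> ('a \<Rightarrow> 'a) \<Rightarrow> 'a \<Rightarrow> ((nat \<Rightarrow> real) \<Rightarrow> 'a sym) \<Rightarrow> (nat \<Rightarrow> real) \<Rightarrow> 'a sym" where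
  "split_step p q v Y = (\<lambda>w. sym_cons (p v) (Y w) + sym_cons (q v) (Y (w \<circ> Suc)))"

definition sym_split ::
    "('a::graded_vector \<Rightarrow> 'a) \<Rightarrow> ('a \<Rightarrow> 'a) \<Rightarrow> (nat \<Rightarrow> real) \<Rightarrow> 'a sym \<Rightarrow> 'a sym" where
  "sym_split p q w y = sym_rec (split_step p q) (\<lambda>w. w 0 *\<^sub>R sym_one) y w"

context
  fixes p q :: "'a::graded_vector \<Rightarrow> 'a"
  assumes p: "p \<in> Hom 0" and q: "q \<in> Hom 0"
begin

lemma sym_step_split: "sym_step (split_step p q)"
  unfolding sym_step_def
proof (intro conjI allI impI)
  note lin = linear_simps[OF Hom_linear[OF p]] linear_simps[OF Hom_linear[OF q]]
  show "bilin (split_step p q)"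
    by (rule bilinI) (auto simp: split_step_def sym_cons_simps lin scaleR_add_right scaleR_fun_def)
  fix m n and a b :: 'a and Y
  assume a: "a \<in> gr m" and b: "b \<in> gr n"
  have "p a \<in> gr m" "q a \<in> gr m" "p b \<in> gr n" "q b \<in> gr n"
    using a b Hom_gr[OF p] Hom_gr[OF q] by auto
  note swap = sym_cons_swap[OF this(1,3)] sym_cons_swap[OF this(1,4)]
    sym_cons_swap[OF this(2,3)] sym_cons_swap[OF this(2,4)]
  show "split_step p q a (split_step p q b Y) = (-1) powi (m * n) *\<^sub>R split_step p q b (split_step p q a Y)"
    by (auto simp: split_step_def scaleR_fun_def sym_cons_simps swap scaleR_add_right)
qed

lemma linear_sym_split: "linear (sym_split p q w)"
  using linear_simps[OF linear_sym_rec[OF sym_step_split]]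
  by (auto simp: linear_iff sym_split_def scaleR_fun_def)

lemma sym_split_one: "sym_split p q w sym_one = w 0 *\<^sub>R sym_one"
  by (simp add: sym_split_def sym_rec_one[OF sym_step_split])

text \<open>If the new factor receives \<open>q\<close>, every index set chosen among the remaining
  factors counts one element more; this is the shift \<open>w \<circ> Suc\<close>.\<close>

lemma sym_split_cons:
  "sym_split p q w (sym_cons v y) = sym_cons (p v) (sym_split p q w y) + sym_cons (q v) (sym_split p q (w \<circ> Suc) y)"
  by (simp add: sym_split_def sym_rec_cons[OF sym_step_split] split_step_def)

text \<open>The recursion passes from \<open>w\<close> to \<open>w \<circ> Suc\<close>, so the
  induction on words has to keep the weight arbitrary, which \<open>sym_HomI\<close> with its single
  map does not.\<close>

lemma sym_split_Hom: "sym_split p q w \<in> Hom 0"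
proof (rule HomI[OF linear_sym_split])
  have word: "sym_split p q w (word vs) \<in> gr (sum_list ds)" if "homogeneous ds vs" for w ds and vs :: "'a list"
    using that
  proof (induction vs arbitrary: ds w)
    case Nil
    then show ?case
      using sym_split_one gr_scaleR[OF sym_one_gr] by (simp add: sym_one_def homogeneous_Nil_iff)
  next
    case (Cons v vs)
    then obtain m es where ds: "ds = m # es" "v \<in> gr m" "homogeneous es vs"
      by (auto simp: homogeneous_Cons_iff)
    have "p v \<in> gr m" "q v \<in> gr m" using Hom_gr[OF p ds(2)] Hom_gr[OF q ds(2)] by simp_all
    then show ?case
      using Cons.IH[OF ds(3)] sym_split_cons[of w v "word vs"] by (simp add: ds(1) gr_add sym_cons_gr)
  qed
  fix n and x :: "'a sym" assume "x \<in> gr n"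
  then have "sym_split p q w x \<in> span (sym_split p q w ` {word vs | vs ds. homogeneous ds vs \<and> sum_list ds = n})"
    unfolding gr_sym_def linear_span_image[OF linear_sym_split] by blast
  also have "\<dots> \<subseteq> gr n"
    by (rule span_minimal[OF _ subspace_gr]) (use word in auto)
  finally show "sym_split p q w x \<in> gr (n + 0)" by simp
qed

lemma sym_split_lincomb:
  "sym_split p q (\<lambda>k. c * w k + c' * w' k) y = c *\<^sub>R sym_split p q w y + c' *\<^sub>R sym_split p q w' y"
proof -
  note lin = linear_simps[OF linear_sym_split]
  show ?thesis
  proof (rule sym_eqI_family[where I = UNIV and i = "(w, w')" and y = y
        and f = "\<lambda>(w, w'). sym_split p q (\<lambda>k. c * w k + c' * w' k)"
        and g = "\<lambda>(w, w') y. c *\<^sub>R sym_split p q w y + c' *\<^sub>R sym_split p q w' y", simplified, unfolded split_paired_all, simplified])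
    show "linear (sym_split p q (\<lambda>k. c * w k + c' * w' k))" for w w' by (rule linear_sym_split)
    show "linear (\<lambda>y. c *\<^sub>R sym_split p q w y + c' *\<^sub>R sym_split p q w' y)" for w w'
      by (simp add: linear_iff lin scaleR_add_right mult.commute)
  qed (auto simp: sym_split_one sym_split_cons sym_cons_simps scaleR_add_left scaleR_add_right o_def)
qed

lemma sym_split_der:
  assumes l: "l \<in> Hom d" and pl: "\<And>v. p (l v) = l (p v)" and ql: "\<And>v. q (l v) = l (q v)"
  shows "sym_split p q w (sym_der d l y) = sym_der d l (sym_split p q w y)"
proof (rule sym_eqI_family[where I = UNIV and i = w and y = y])
  note lin = linear_sym_split linear_sym_der[OF l]
  show "linear (\<lambda>y. sym_split p q w (sym_der d l y))" "linear (\<lambda>y. sym_der d l (sym_split p q w y))" for w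
    using linear_compose[OF lin(2,1)] linear_compose[OF lin(1,2)] by (simp_all add: o_def)
  show "sym_split p q w (sym_der d l sym_one) = sym_der d l (sym_split p q w sym_one)" for w
    by (simp add: sym_split_one sym_der_one[OF l] linear_0[OF linear_sym_split] linear_simps[OF lin(2)])
  fix w m n and v :: 'a and y :: "'a sym"
  assume v: "v \<in> gr m"
    and IH: "\<And>w. w \<in> UNIV \<Longrightarrow> sym_split p q w (sym_der d l y) = sym_der d l (sym_split p q w y)"
  have "p v \<in> gr m" "q v \<in> gr m" using Hom_gr[OF p v] Hom_gr[OF q v] by simp_all
  note cons = this[THEN sym_der_cons[OF l]]
  show "sym_split p q w (sym_der d l (sym_cons v y)) = sym_der d l (sym_split p q w (sym_cons v y))"
    by (simp add: sym_split_cons sym_der_cons[OF l v] cons linear_simps[OF lin(1)] linear_simps[OF lin(2)]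
        IH pl ql sym_cons_simps scaleR_add_right)
qed simp

end

lemma sym_der_map_eq_0:
  fixes \<phi> :: "'a::graded_vector \<Rightarrow> 'b::graded_vector"
  assumes \<phi>: "\<phi> \<in> Hom 0" and l: "l \<in> Hom d" and l\<phi>: "\<And>v. l (\<phi> v) = 0"
  shows "sym_der d l (sym_map \<phi> y) = 0"
proof (rule sym_eqI[where f = "\<lambda>y. sym_der d l (sym_map \<phi> y)" and g = "\<lambda>_. 0" and y = y])
  show "linear (\<lambda>y. sym_der d l (sym_map \<phi> y))"
    using linear_compose[OF linear_sym_map[OF \<phi>] linear_sym_der[OF l]] by (simp add: o_def)
  fix m n and v :: 'a and y :: "'a sym" assume v: "v \<in> gr m" and IH: "sym_der d l (sym_map \<phi> y) = 0"
  have "\<phi> v \<in> gr m" using Hom_gr[OF \<phi> v] by simp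
  from sym_der_cons[OF l this] show "sym_der d l (sym_map \<phi> (sym_cons v y)) = 0"
    by (simp add: sym_map_cons[OF \<phi>] IH l\<phi> sym_cons_simps)
qed (simp_all add: sym_map_one[OF \<phi>] sym_der_one[OF l] linear_iff)

subsection \<open>Contraction of the symmetric algebra\<close>

text \<open>Both derivations are odd, so the mixed terms containing \<open>h v\<close> and
  \<open>l v\<close> appear twice with opposite signs. What remains is the Leibniz rule of a
  derivation of degree 0.\<close>

lemma sym_der_commutator_cons:
  assumes l: "l \<in> Hom 1" and h: "h \<in> Hom (-1)" and v: "v \<in> gr m"
  shows "sym_der 1 l (sym_der (-1) h (sym_cons v y)) + sym_der (-1) h (sym_der 1 l (sym_cons v y)) =
    sym_cons (l (h v) + h (l v)) y +
    sym_cons v (sym_der 1 l (sym_der (-1) h y) + sym_der (-1) h (sym_der 1 l y))"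
proof -
  note L = linear_simps[OF linear_sym_der[OF l]] linear_simps[OF linear_sym_der[OF h]]
  note hv = Hom_gr[OF h v refl] and lv = Hom_gr[OF l v refl]
  show ?thesis
    by (simp add: sym_der_cons[OF l v] sym_der_cons[OF h v] sym_der_cons[OF l hv] sym_der_cons[OF h lv]
        L sym_cons_simps)
      (auto simp: sgn_powi scaleR_add_right)
qed

text \<open>
  The graded commutator of the derivations extending \<open>l\<close> and \<open>h\<close> is the derivation extending \<open>id - p\<close>.
  It multiplies a product by the number of factors in the image of \<open>id - p\<close>, so dividing by this number
  turns the derivation extending \<open>h\<close> into a homotopy.
\<close>

lemma contraction_sym:
  fixes l :: "'a::graded_vector \<Rightarrow> 'a"
  assumes c: "contraction l p h"
  shows "contraction (sym_der 1 l) (sym_map p)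
    (sym_der (-1) h \<circ> sym_split p (\<lambda>v. v - p v) (\<lambda>k. 1 / real k))"
proof -
  have l: "l \<in> Hom 1" and p: "p \<in> Hom 0" and h: "h \<in> Hom (-1)"
    and ll: "\<And>x. l (l x) = 0" and lp: "\<And>x. l (p x) = 0" and pl: "\<And>x. p (l x) = 0" and pp: "\<And>x. p (p x) = p x"
    and hom: "\<And>x. p x = x - l (h x) - h (l x)"
    using c unfolding contraction_def by blast+
  define q where "q v = v - p v" for v
  have q: "q \<in> Hom 0"
    using subspace_diff[OF subspace_Hom id_in_Hom p] unfolding q_def[abs_def] by (simp add: fun_diff_def)
  note plin = Hom_linear[OF p] and llin = Hom_linear[OF l]
  have lh: "l (h x) + h (l x) = q x" for x by (simp add: q_def hom)
  have qp: "q (p x) = 0" "q (q x) = q x" for x by (simp_all add: q_def pp linear_diff[OF plin])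
  let ?M = "sym_split p q"
  let ?l = "sym_der 1 l" and ?h = "sym_der (-1) h"
  note Mlin = linear_sym_split[OF p q] and dl = linear_sym_der[OF l] and dh = linear_sym_der[OF h]
  note Mcons = sym_split_cons[OF p q] and Mone = sym_split_one[OF p q]
  have comm: "?M w (?l y) = ?l (?M w y)" for w y
    by (rule sym_split_der[OF p q l]) (simp_all add: q_def pl lp linear_diff[OF llin])
  have euler: "?l (?h (?M w y)) + ?h (?l (?M w y)) = ?M (\<lambda>k. real k * w k) y" for w y
  proof (rule sym_eqI_family[where I = UNIV and i = w and y = y
        and f = "\<lambda>w y. ?l (?h (?M w y)) + ?h (?l (?M w y))"
        and g = "\<lambda>w. ?M (\<lambda>k. real k * w k)"])
    note L = linear_simps[OF Mlin] linear_simps[OF dl] linear_simps[OF dh]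
    show "linear (\<lambda>y. ?l (?h (?M w y)) + ?h (?l (?M w y)))" for w
      by (simp add: linear_iff L scaleR_add_right)
    show "?l (?h (?M w sym_one)) + ?h (?l (?M w sym_one)) = ?M (\<lambda>k. real k * w k) sym_one" for w
      by (simp add: Mone L sym_der_one[OF l] sym_der_one[OF h] linear_0[OF dl] linear_0[OF dh])
    fix w m n and v :: 'a and y :: "'a sym"
    assume v: "v \<in> gr m"
      and IH: "\<And>w. w \<in> UNIV \<Longrightarrow> ?l (?h (?M w y)) + ?h (?l (?M w y)) = ?M (\<lambda>k. real k * w k) y"
    have pv: "p v \<in> gr m" and qv: "q v \<in> gr m" using Hom_gr[OF p v] Hom_gr[OF q v] by simp_all
    have "?l (?h (?M w (sym_cons v y))) + ?h (?l (?M w (sym_cons v y))) =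
        (?l (?h (sym_cons (p v) (?M w y))) + ?h (?l (sym_cons (p v) (?M w y)))) +
        (?l (?h (sym_cons (q v) (?M (w \<circ> Suc) y))) + ?h (?l (sym_cons (q v) (?M (w \<circ> Suc) y))))"
      by (simp add: Mcons L)
    \<comment> \<open>On a single factor \<open>l h + h l\<close> acts as \<open>q\<close>, which
      kills \<open>p v\<close> and fixes \<open>q v\<close>. The extra copy of the
      \<open>q v\<close> term is the increment that turns \<open>k\<close> into \<open>Suc k\<close>
      in the next equation.\<close>
    also have "\<dots> = sym_cons (p v) (?M (\<lambda>k. real k * w k) y) +
        (sym_cons (q v) (?M (w \<circ> Suc) y) + sym_cons (q v) (?M (\<lambda>k. real k * (w \<circ> Suc) k) y))"
      unfolding sym_der_commutator_cons[OF l h pv] sym_der_commutator_cons[OF l h qv]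
      by (simp only: IH[OF UNIV_I] lh qp sym_cons_simps add_0_left)
    also have "sym_cons (q v) (?M (w \<circ> Suc) y) + sym_cons (q v) (?M (\<lambda>k. real k * (w \<circ> Suc) k) y) =
        sym_cons (q v) (?M ((\<lambda>k. real k * w k) \<circ> Suc) y)"
    proof -
      have "(\<lambda>k. real k * w k) \<circ> Suc = (\<lambda>k. 1 * (w \<circ> Suc) k + 1 * (real k * (w \<circ> Suc) k))"
        by (auto simp: algebra_simps)
      then have "?M ((\<lambda>k. real k * w k) \<circ> Suc) y = ?M (w \<circ> Suc) y + ?M (\<lambda>k. real k * (w \<circ> Suc) k) y"
        by (simp only: sym_split_lincomb[OF p q] scaleR_one)
      then show ?thesis by (simp only: sym_cons_simps)
    qed
    finally show "?l (?h (?M w (sym_cons v y))) + ?h (?l (?M w (sym_cons v y))) =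
        ?M (\<lambda>k. real k * w k) (sym_cons v y)"
      by (simp only: Mcons)
  qed (simp_all add: Mlin)
  \<comment> \<open>With constant weight the sum over index sets multiplies out the factors
    \<open>p v + q v = v\<close>. The weight concentrated at 0, in \<open>Mp\<close>, keeps only the
    empty index set.\<close>
  have M1: "?M (\<lambda>_. 1) y = y" for y
  proof (rule sym_eqI[of _ id y, unfolded id_apply[of y]])
    show "linear (?M (\<lambda>_. 1))" "linear (id :: 'a sym \<Rightarrow> _)" by (rule Mlin, simp add: linear_iff)
    have pq: "sym_cons (p v) y + sym_cons (q v) y = sym_cons v y" for v y
      by (simp add: sym_cons_simps(1)[symmetric] q_def)
    show "?M (\<lambda>_. 1) (sym_cons v y) = id (sym_cons v y)" if "?M (\<lambda>_. 1) y = id y" for v y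
      using that by (simp add: Mcons o_def pq)
  qed (simp add: Mone)
  have M0: "?M (\<lambda>_. 0) y = 0" for y
    using sym_split_lincomb[OF p q, of 0 _ 0 _ y] by simp
  have Mp: "?M (\<lambda>k. if k = 0 then 1 else 0) y = sym_map p y" for y
  proof (rule sym_eqI[OF Mlin linear_sym_map[OF p]])
  qed (simp_all add: Mone Mcons sym_map_one[OF p] sym_map_cons[OF p] o_def M0 sym_cons_simps)
  let ?k = "?h \<circ> ?M (\<lambda>k. 1 / real k)"
  have "sym_map p y = y - ?l (?k y) - ?k (?l y)" for y
  proof -
    have "?l (?k y) + ?k (?l y) = ?M (\<lambda>k. real k * (1 / real k)) y"
      using euler[of "\<lambda>k. 1 / real k" y] by (simp add: comm)
    \<comment> \<open>Division by zero gives 0, so the product of weights is 1 for positive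
      \<open>k\<close> and 0 for \<open>k = 0\<close>. The exceptional value accounts for the
      retraction \<open>sym_map p\<close>.\<close>
    also have "(\<lambda>k. real k * (1 / real k)) = (\<lambda>k. 1 * 1 + (-1) * (if k = 0 then 1 else 0))"
      by auto
    also have "?M \<dots> y = y - sym_map p y"
      by (subst sym_split_lincomb[OF p q]) (simp add: M1 Mp)
    finally show ?thesis by (simp add: algebra_simps)
  qed
  moreover have "?l (sym_map p y) = 0" for y
    by (rule sym_der_map_eq_0[OF p l lp])
  moreover have "sym_map p (?l y) = ?l (sym_map p y)" for y
    by (rule sym_map_der[OF p l l]) (simp add: pl lp)
  moreover have "sym_map p (sym_map p y) = sym_map p y" for y
    using sym_map_compose[OF p p] by (simp add: o_def pp)
  moreover have "?l (?l y) = 0" for y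
  proof (rule sym_eqI[where f = "\<lambda>y. ?l (?l y)" and g = "\<lambda>_. 0" and y = y])
    show "linear (\<lambda>y. ?l (?l y))" using linear_compose[OF dl dl] by (simp add: o_def)
    fix m n and v :: 'a and y :: "'a sym" assume v: "v \<in> gr m" and IH: "?l (?l y) = 0"
    show "?l (?l (sym_cons v y)) = 0"
      by (simp add: sym_der_cons[OF l v] linear_simps[OF dl] sym_der_cons[OF l Hom_gr[OF l v refl]] IH ll
          sym_cons_simps sgn_powi)
  qed (simp_all add: sym_der_one[OF l] linear_0[OF dl] linear_iff)
  moreover have "?k \<in> Hom (-1)"
    by (rule Hom_comp[OF sym_split_Hom[OF p q] sym_der_Hom[OF h]]) simp
  ultimately have "contraction ?l (sym_map p) ?k"
    unfolding contraction_def using sym_der_Hom[OF l] sym_map_Hom[OF p] by simp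
  then show ?thesis by (simp add: q_def[abs_def])
qed

section \<open>The coproduct\<close>

lemma linear_span_subset:
  assumes "linear f" "\<And>x. x \<in> B \<Longrightarrow> f x \<in> S" "subspace S" "x \<in> span B" shows "f x \<in> S"
proof -
  have "f x \<in> span (f ` B)" using assms(4) linear_span_image[OF assms(1)] by blast
  moreover have "span (f ` B) \<subseteq> S" by (rule span_minimal) (use assms in auto)
  ultimately show ?thesis by blast
qed

lemma tensor_gr: "x \<in> gr i \<Longrightarrow> y \<in> gr j \<Longrightarrow> n = i + j \<Longrightarrow> x \<otimes> y \<in> gr n"
  unfolding gr_tensor_def by (rule span_base) force

lemma tensor_HomI:
  assumes "linear f" "\<And>i j x y. x \<in> gr i \<Longrightarrow> y \<in> gr j \<Longrightarrow> f (x \<otimes> y) \<in> gr (i + j + d)"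
  shows "f \<in> Hom d"
proof (rule HomI[OF assms(1)])
  fix n and t :: "'a \<otimes> 'b" assume "t \<in> gr n"
  then show "f t \<in> gr (n + d)"
    unfolding gr_tensor_def[of n]
    by (rule linear_span_subset[OF assms(1) _ subspace_gr, rotated]) (use assms(2) in force)
qed

lemma tensor_map_Hom:
  assumes "f \<in> Hom p" "g \<in> Hom r" "d = p + r" shows "tensor_map q f g \<in> Hom d"
proof (rule tensor_HomI)
  note lin = Hom_linear[OF assms(1)] Hom_linear[OF assms(2)]
  show "linear (tensor_map q f g)" by (rule linear_tensor_map[OF lin])
  show "tensor_map q f g (x \<otimes> y) \<in> gr (i + j + d)" if "x \<in> gr i" "y \<in> gr j" for i j x y
    using tensor_gr[OF Hom_gr[OF assms(1) that(1) refl] Hom_gr[OF assms(2) that(2) refl], of "i + j + d"] assms(3)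
    by (simp add: tensor_map_pure[OF lin that(1)] gr_scaleR)
qed

text \<open>From here on shuffles disappear: the coproduct is the S(V)-action on 1 \<otimes> 1 in
  which \<open>v\<close> acts as multiplication by v \<otimes> 1 + 1 \<otimes> v.\<close>

lemma coprod_rec: "coprod = sym_rec cop_step (sym_one \<otimes> sym_one)"
proof
  have step: "sym_step cop_step"
    using linear_cop_step linear_cop_step' cop_step_swap unfolding sym_step_def bilin_def by blast
  fix y :: "'a sym"
  show "coprod y = sym_rec cop_step (sym_one \<otimes> sym_one) y"
  proof (rule linear_eq_on_span[OF linear_coprod linear_sym_rec[OF step]])
    show "y \<in> span {word vs | vs ds. homogeneous ds vs}" by (simp only: span_homogeneous_word UNIV_I)
    show "coprod x = sym_rec cop_step (sym_one \<otimes> sym_one) x" if "x \<in> {word vs | vs ds. homogeneous ds vs}"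
      for x :: "'a sym"
      using that
      by (auto simp: coprod_word cop_word_homogeneous[symmetric] cop_word_def sym_rec_def
          sym_compatible_foldr[OF step] sym_one_def)
  qed
qed

lemma
  fixes v :: "'a::graded_vector"
  shows coprod_one: "coprod (sym_one :: 'a sym) = sym_one \<otimes> sym_one"
    and coprod_cons: "coprod (sym_cons v y) = cop_step v (coprod y)"
proof -
  have step: "sym_step (cop_step :: 'a \<Rightarrow> _)"
    using linear_cop_step linear_cop_step' cop_step_swap unfolding sym_step_def bilin_def by blast
  show "coprod sym_one = sym_one \<otimes> (sym_one :: 'a sym)" "coprod (sym_cons v y) = cop_step v (coprod y)"
    by (simp_all add: coprod_rec sym_rec_one[OF step] sym_rec_cons[OF step])
qed

lemma cop_step_Hom:
  assumes v: "v \<in> gr m" shows "cop_step v \<in> Hom m"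
proof (rule tensor_HomI[OF linear_cop_step])
  fix i j and x y :: "'a sym" assume x: "x \<in> gr i" and y: "y \<in> gr j"
  have "sym_cons v x \<otimes> y \<in> gr (i + j + m)" "x \<otimes> sym_cons v y \<in> gr (i + j + m)"
    using tensor_gr[OF sym_cons_gr[OF v x] y] tensor_gr[OF x sym_cons_gr[OF v y]] by (simp_all add: ac_simps)
  then show "cop_step v (x \<otimes> y) \<in> gr (i + j + m)"
    by (simp add: cop_step_pure[OF v x] gr_add gr_scaleR)
qed

lemma coprod_Hom: "coprod \<in> Hom 0"
proof (rule sym_HomI[OF linear_coprod])
  show "coprod sym_one \<in> gr 0"
    unfolding coprod_one by (rule tensor_gr[OF sym_one_gr sym_one_gr]) simp
  fix m n and v :: 'a and y :: "'a sym" assume v: "v \<in> gr m" and y: "coprod y \<in> gr (n + 0)"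
  show "coprod (sym_cons v y) \<in> gr (m + n + 0)"
    unfolding coprod_cons by (rule Hom_gr[OF cop_step_Hom[OF v] y]) simp
qed

text \<open>Both iterated coproducts obey one recursion: prefixing \<open>v\<close> becomes
  \<open>cop3\<close>, multiplication by v \<otimes> 1 \<otimes> 1 + 1 \<otimes> v \<otimes> 1 + 1
  \<otimes> 1 \<otimes> v.\<close>

lemma coprod_coassoc: "assoc (tensor_map 0 coprod id (coprod y)) = tensor_map 0 id coprod (coprod y)"
proof (rule sym_eqI[where f = "\<lambda>y. assoc (tensor_map 0 coprod id (coprod y))"
      and g = "\<lambda>y. tensor_map 0 id coprod (coprod y)" and y = y])
  have id: "linear (id :: 'a sym \<Rightarrow> 'a sym)" by (simp add: linear_iff)
  note lin = linear_tensor_map[OF linear_coprod id, of 0] linear_tensor_map[OF id linear_coprod, of 0]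
  show "linear (\<lambda>y :: 'a sym. assoc (tensor_map 0 coprod id (coprod y)))"
    "linear (\<lambda>y :: 'a sym. tensor_map 0 id coprod (coprod y))"
    using linear_compose[OF linear_compose[OF linear_coprod lin(1)] linear_assoc]
      linear_compose[OF linear_coprod lin(2)] by (simp_all add: o_def)
  show "assoc (tensor_map 0 coprod id (coprod (sym_one :: 'a sym))) = tensor_map 0 id coprod (coprod sym_one)"
    by (simp add: coprod_one tensor_map_pure[OF linear_coprod id sym_one_gr]
        tensor_map_pure[OF id linear_coprod sym_one_gr])
  fix m n and v :: 'a and y :: "'a sym"
  assume v: "v \<in> gr m" and IH: "assoc (tensor_map 0 coprod id (coprod y)) = tensor_map 0 id coprod (coprod y)"
  have cons: "linear (sym_cons v)" by (rule linear_bilin[OF bilin_sym_cons])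
  have idt: "linear (id :: 'a sym \<otimes> 'a sym \<Rightarrow> _)" by (simp add: linear_iff)
  define cop3 where "cop3 t = tensor_map 0 (sym_cons v) id t + tensor_map m id (cop_step v) t"
    for t :: "'a sym \<otimes> 'a sym \<otimes> 'a sym"
  have cop3_pure: "cop3 (x \<otimes> t) = sym_cons v x \<otimes> t + (-1) powi (m * k) *\<^sub>R (x \<otimes> cop_step v t)"
    if "x \<in> gr k" for x t k
    by (simp add: cop3_def tensor_map_pure[OF cons idt that] tensor_map_pure[OF id linear_cop_step that])
  have lin3: "linear cop3"
    using linear_compose_add[OF linear_tensor_map[OF cons idt, of 0] linear_tensor_map[OF id linear_cop_step, of m v]]
    by (simp add: cop3_def[abs_def])
  have cop3_assoc: "assoc (cop_step v s \<otimes> y) + (-1) powi (m * k) *\<^sub>R assoc (s \<otimes> sym_cons v y) = cop3 (assoc (s \<otimes> y))"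
    if s: "s \<in> gr k" for s k and y :: "'a sym"
  proof (rule linear_eq_on_span[OF _ _ _ s[unfolded gr_tensor_def]])
    note L = linear_simps[OF linear_assoc] linear_simps[OF lin3] linear_simps[OF linear_cop_step]
    show "linear (\<lambda>s. assoc (cop_step v s \<otimes> y) + (-1) powi (m * k) *\<^sub>R assoc (s \<otimes> sym_cons v y))"
      "linear (\<lambda>s. cop3 (assoc (s \<otimes> y)))"
      by (simp_all add: linear_iff L tensor_pure_simps scaleR_add_right scaleR_left_commute)
    fix x :: "'a sym \<otimes> 'a sym" assume "x \<in> {a \<otimes> b | a b i. a \<in> gr i \<and> b \<in> gr (k - i)}"
    then obtain a b i where x: "x = a \<otimes> b" and a: "a \<in> gr i" and b: "b \<in> gr (k - i)" by blast
    show "assoc (cop_step v x \<otimes> y) + (-1) powi (m * k) *\<^sub>R assoc (x \<otimes> sym_cons v y) = cop3 (assoc (x \<otimes> y))"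
      by (simp add: x cop_step_pure[OF v a] cop_step_pure[OF v b] cop3_pure[OF a] L tensor_pure_simps)
        (auto simp: sgn_powi scaleR_add_right)
  qed
  have eq1: "(\<lambda>t. assoc (tensor_map 0 coprod id (cop_step v t))) = (\<lambda>t. cop3 (assoc (tensor_map 0 coprod id t)))"
  proof (rule tensor_eqI)
    note L = linear_simps[OF linear_assoc] linear_simps[OF lin3] linear_simps[OF linear_cop_step] linear_simps[OF lin(1)]
    show "linear (\<lambda>t. assoc (tensor_map 0 coprod id (cop_step v t)))"
      "linear (\<lambda>t. cop3 (assoc (tensor_map 0 coprod id t)))"
      by (simp_all add: linear_iff L)
    fix k and x z :: "'a sym" assume x: "x \<in> gr k"
    note pure = tensor_map_pure[OF linear_coprod id x] tensor_map_pure[OF linear_coprod id sym_cons_gr[OF v x]]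
    have "coprod x \<in> gr k" using Hom_gr[OF coprod_Hom x] by simp
    from cop3_assoc[OF this]
    show "assoc (tensor_map 0 coprod id (cop_step v (x \<otimes> z))) = cop3 (assoc (tensor_map 0 coprod id (x \<otimes> z)))"
      by (simp add: cop_step_pure[OF v x] L pure coprod_cons)
  qed
  have eq2: "(\<lambda>t. tensor_map 0 id coprod (cop_step v t)) = (\<lambda>t. cop3 (tensor_map 0 id coprod t))"
  proof (rule tensor_eqI)
    note L = linear_simps[OF lin3] linear_simps[OF linear_cop_step] linear_simps[OF lin(2)]
    show "linear (\<lambda>t. tensor_map 0 id coprod (cop_step v t))" "linear (\<lambda>t. cop3 (tensor_map 0 id coprod t))"
      by (simp_all add: linear_iff L)
    fix k and x z :: "'a sym" assume x: "x \<in> gr k"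
    note pure = tensor_map_pure[OF id linear_coprod x] tensor_map_pure[OF id linear_coprod sym_cons_gr[OF v x]]
    show "tensor_map 0 id coprod (cop_step v (x \<otimes> z)) = cop3 (tensor_map 0 id coprod (x \<otimes> z))"
      by (simp add: cop_step_pure[OF v x] L pure coprod_cons cop3_pure[OF x])
  qed
  show "assoc (tensor_map 0 coprod id (coprod (sym_cons v y))) = tensor_map 0 id coprod (coprod (sym_cons v y))"
    using fun_cong[OF eq1, of "coprod y"] fun_cong[OF eq2, of "coprod y"] by (simp add: coprod_cons IH)
qed

subsection \<open>Counit\<close>

definition counit :: "'a::graded_vector sym \<Rightarrow> real" where
  "counit = sym_rec (\<lambda>_ _. 0) 1"

lemma sym_step_counit: "sym_step (\<lambda>_ _. 0 :: real)"
  by (simp add: sym_step_def bilin_def linear_iff)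

lemma linear_counit: "linear counit"
  and counit_one: "counit sym_one = 1"
  and counit_cons: "counit (sym_cons v y) = 0"
  unfolding counit_def
  by (rule linear_sym_rec[OF sym_step_counit] sym_rec_one[OF sym_step_counit] sym_rec_cons[OF sym_step_counit])+

text \<open>Only degree 0 survives the counit, and there the Koszul sign in
  \<open>cop_step_pure\<close> is 1; this is how the sign drops out of the counit law.\<close>

lemma counit_gr:
  assumes "y \<in> gr n" "n \<noteq> 0" shows "counit y = 0"
proof (rule linear_eq_on_span[OF linear_counit _ _ assms(1)[unfolded gr_sym_def]])
  show "linear (\<lambda>_. 0 :: real)" by (simp add: linear_iff)
  fix x :: "'a sym" assume "x \<in> {word vs | vs ds. homogeneous ds vs \<and> sum_list ds = n}"
  then obtain vs ds where x: "x = word vs" "homogeneous ds vs" "sum_list ds = n" by blast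
  then obtain v us where "vs = v # us"
    using assms(2) by (cases vs) (auto simp: homogeneous_Nil_iff)
  then show "counit x = 0" using counit_cons[of v "word us"] x by simp
qed

definition counit_left :: "'a::graded_vector sym \<otimes> 'b::real_vector \<Rightarrow> 'b" where
  "counit_left = tensor_lift (\<lambda>x y. counit x *\<^sub>R y)"

lemma bilin_counit: "bilin (\<lambda>x y. counit x *\<^sub>R y)"
  by (rule bilinI) (simp_all add: linear_simps[OF linear_counit] scaleR_add_left scaleR_add_right)

lemma linear_counit_left: "linear counit_left"
  and counit_left_pure [simp]: "counit_left (x \<otimes> y) = counit x *\<^sub>R y"
  by (simp_all add: counit_left_def bilin_counit linear_tensor_lift)

lemma counit_left_coprod: "counit_left (coprod y) = y"
proof (rule sym_eqI[where f = "\<lambda>y. counit_left (coprod y)" and g = "\<lambda>y. y"])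
  show "linear (\<lambda>y :: 'a sym. counit_left (coprod y))" "linear (\<lambda>y :: 'a sym. y)"
    using linear_compose[OF linear_coprod linear_counit_left] by (simp_all add: o_def linear_iff)
  show "counit_left (coprod (sym_one :: 'a sym)) = sym_one"
    by (simp add: coprod_one counit_one)
  fix m n and v :: 'a and y :: "'a sym" assume v: "v \<in> gr m" and IH: "counit_left (coprod y) = y"
  have eq: "(\<lambda>t. counit_left (cop_step v t)) = (\<lambda>t. sym_cons v (counit_left t))"
  proof (rule tensor_eqI)
    note L = linear_simps[OF linear_counit_left] linear_simps[OF linear_cop_step]
    show "linear (\<lambda>t. counit_left (cop_step v t))" "linear (\<lambda>t :: _ \<otimes> 'a sym. sym_cons v (counit_left t))"
      by (simp_all add: linear_iff L sym_cons_simps)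
    show "counit_left (cop_step v (x \<otimes> z)) = sym_cons v (counit_left (x \<otimes> z))" if x: "x \<in> gr k" for k x z
      using counit_gr[OF x] by (cases "k = 0") (simp_all add: cop_step_pure[OF v x] L counit_cons sym_cons_simps)
  qed
  show "counit_left (coprod (sym_cons v y)) = sym_cons v y"
    using fun_cong[OF eq, of "coprod y"] by (simp add: coprod_cons IH)
qed

section \<open>Coderivations\<close>

lemma vee_sym_incl: "vee (sym_incl v) y = sym_cons v y"
  by (simp add: sym_incl_def sym_cons_def)

lemma sym_incl_Hom: "sym_incl \<in> Hom 0"
proof (rule HomI)
  show "linear (sym_incl :: 'a \<Rightarrow> _)"
    using linear_word_Cons[of "[]" "[]"] by (simp add: sym_incl_def[abs_def])
  show "sym_incl v \<in> gr (n + 0)" if "v \<in> gr n" for n and v :: 'a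
    using word_gr[of "[n]" "[v]"] that by (simp add: sym_incl_def homogeneous_def)
qed

lemma sym_mult_Hom: "sym_mult \<in> Hom 0"
proof (rule tensor_HomI[OF linear_sym_mult])
  fix i j and x y :: "'a sym" assume x: "x \<in> gr i" and y: "y \<in> gr j"
  have word: "vee (word us) y \<in> gr (sum_list ds + j)" if "homogeneous ds us" for us :: "'a list" and ds
    using that
  proof (induction us arbitrary: ds)
    case Nil
    have "vee (word []) y = y"
      by (rule linear_eq_on_span[of "vee (word [])" "\<lambda>y. y" "range word"])
        (auto simp: linear_bilin[OF bilin_vee] linear_iff bilin_simps[OF bilin_vee] span_word)
    then show ?case using Nil y by (simp add: homogeneous_Nil_iff)
  next
    case (Cons u us)
    then obtain m es where ds: "ds = m # es" "u \<in> gr m" "homogeneous es us"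
      by (auto simp: homogeneous_Cons_iff)
    have "vee (word (u # us)) y = sym_cons u (vee (word us) y)"
      by (rule linear_eq_on_span[of "vee (word (u # us))" "\<lambda>y. sym_cons u (vee (word us) y)" "range word"])
        (auto simp: linear_iff bilin_simps[OF bilin_vee] sym_cons_simps span_word)
    then show ?case
      using sym_cons_gr[OF ds(2) Cons.IH[OF ds(3)]] by (simp add: ds(1) add.assoc)
  qed
  have "vee x y \<in> gr (i + j)"
    using x unfolding gr_sym_def[of i]
    by (rule linear_span_subset[OF linear_bilin(1)[OF bilin_vee] _ subspace_gr, rotated]) (use word in auto)
  then show "sym_mult (x \<otimes> y) \<in> gr (i + j + 0)" by simp
qed

lemma coderivation_Hom: "a \<in> Hom q \<Longrightarrow> coderivation a \<in> Hom q"
  unfolding coderivation_def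
  by (intro Hom_comp[OF coprod_Hom Hom_comp[OF tensor_map_Hom[OF Hom_comp[OF _ sym_incl_Hom] id_in_Hom] sym_mult_Hom]])
    auto

lemma linear_tensor_map_id:
  "linear a \<Longrightarrow> linear (tensor_map q a (id :: 'b::real_vector \<Rightarrow> 'b))"
  by (rule linear_tensor_map) (auto simp: linear_iff)

lemma tensor_map_id_pure:
  "linear a \<Longrightarrow> x \<in> gr n \<Longrightarrow> tensor_map 0 a id (x \<otimes> y) = a x \<otimes> (y :: 'b::real_vector)"
  by (subst tensor_map_pure) (auto simp: linear_iff)

lemma tensor_map_pure_id:
  "linear a \<Longrightarrow> x \<in> gr n \<Longrightarrow> tensor_map q id a (x \<otimes> y) = (-1) powi (q * n) *\<^sub>R (x \<otimes> a y)"
  by (subst tensor_map_pure) (auto simp: linear_iff)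

lemma linear_tensor_map_id':
  "linear a \<Longrightarrow> linear (tensor_map q (id :: 'b::graded_vector \<Rightarrow> 'b) a)"
  by (rule linear_tensor_map) (auto simp: linear_iff)

lemma sym_cons_Hom: "v \<in> gr m \<Longrightarrow> sym_cons v \<in> Hom m"
  by (rule HomI) (auto simp: linear_bilin[OF bilin_sym_cons] add.commute dest: sym_cons_gr)

lemma linear_incl_comp: "linear a \<Longrightarrow> linear (sym_incl \<circ> a)"
  by (rule linear_compose[OF _ Hom_linear[OF sym_incl_Hom]])

lemma coderivation_one: "linear a \<Longrightarrow> coderivation a sym_one = sym_cons (a sym_one) sym_one"
  by (simp add: coderivation_def coprod_one tensor_map_id_pure[OF linear_incl_comp sym_one_gr] vee_sym_incl)

text \<open>In the coproduct of \<open>v \<or> y\<close> the factor \<open>v\<close> goes either to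
  the left, where \<open>a\<close> consumes it, or to the right, from where it is moved out past
  \<open>a\<close>. The price of this recursion is the new map \<open>a \<circ> sym_cons v\<close>,
  of different degree and in general nonzero at 1, so inductions with it range over all homogeneous
  \<open>a\<close>.\<close>

lemma coderivation_cons:
  assumes a: "a \<in> Hom q" and v: "v \<in> gr m"
  shows "coderivation a (sym_cons v y) =
    coderivation (a \<circ> sym_cons v) y + (-1) powi (q * m) *\<^sub>R sym_cons v (coderivation a y)"
proof -
  define G where "G b t = sym_mult (tensor_map 0 (sym_incl \<circ> b) id t)" for b :: "'a sym \<Rightarrow> 'a" and t
  have G: "coderivation b y = G b (coprod y)" for b y
    by (simp add: coderivation_def G_def)
  have lin_a: "linear a" and lin_av: "linear (a \<circ> sym_cons v)"
    using Hom_linear[OF a] linear_compose[OF linear_bilin(2)[OF bilin_sym_cons]] by auto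
  have lin: "linear (G b)" if "linear b" for b
    using linear_compose[OF linear_tensor_map_id[OF linear_incl_comp[OF that]] linear_sym_mult]
    by (simp add: G_def[abs_def] o_def)
  have pure: "G b (x \<otimes> z) = sym_cons (b x) z" if "linear b" "x \<in> gr k" for b x k z
    by (simp add: G_def tensor_map_id_pure[OF linear_incl_comp[OF that(1)] that(2)] vee_sym_incl)
  have eq: "(\<lambda>t. G a (cop_step v t)) = (\<lambda>t. G (a \<circ> sym_cons v) t + (-1) powi (q * m) *\<^sub>R sym_cons v (G a t))"
  proof (rule tensor_eqI)
    note L = linear_simps[OF lin[OF lin_a]] linear_simps[OF lin[OF lin_av]] linear_simps[OF linear_cop_step]
    show "linear (\<lambda>t. G a (cop_step v t))"
      "linear (\<lambda>t. G (a \<circ> sym_cons v) t + (-1) powi (q * m) *\<^sub>R sym_cons v (G a t))"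
      by (simp_all add: linear_iff L sym_cons_simps scaleR_add_right scaleR_left_commute)
    fix k and x z :: "'a sym" assume x: "x \<in> gr k"
    have "sym_cons (a x) (sym_cons v z) = (-1) powi ((k + q) * m) *\<^sub>R sym_cons v (sym_cons (a x) z)"
      by (rule sym_cons_swap[OF Hom_gr[OF a x refl] v])
    then show "G a (cop_step v (x \<otimes> z)) =
        G (a \<circ> sym_cons v) (x \<otimes> z) + (-1) powi (q * m) *\<^sub>R sym_cons v (G a (x \<otimes> z))"
      by (simp add: cop_step_pure[OF v x] L pure[OF lin_a x] pure[OF lin_av x] pure[OF lin_a sym_cons_gr[OF v x]])
        (auto simp: sgn_powi)
  qed
  show ?thesis using fun_cong[OF eq, of "coprod y"] by (simp add: G coprod_cons)
qed

text \<open>The co-Leibniz rule. The operator \<open>T\<close> satisfies, under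
  \<open>cop_step v\<close>, the same recursion as \<open>coderivation_cons\<close>; the induction
  treats all pairs of a degree and a map simultaneously, since both change in the step.\<close>

lemma coprod_coderivation:
  assumes "a \<in> Hom q"
  shows "coprod (coderivation a y) =
    tensor_map 0 (coderivation a) id (coprod y) + tensor_map q id (coderivation a) (coprod y)"
proof -
  define T where "T q a t = tensor_map 0 (coderivation a) id t + tensor_map q id (coderivation a) t"
    for q and a :: "'a sym \<Rightarrow> 'a" and t :: "'a sym \<otimes> 'a sym"
  have lin: "linear (T q a)" if "a \<in> Hom q" for q a
    using linear_compose_add[OF linear_tensor_map_id[of _ 0] linear_tensor_map_id'[of _ q],
        OF Hom_linear[OF coderivation_Hom[OF that]] Hom_linear[OF coderivation_Hom[OF that]]]
    by (simp add: T_def[abs_def])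
  have pure: "T q a (x \<otimes> z) = coderivation a x \<otimes> z + (-1) powi (q * k) *\<^sub>R (x \<otimes> coderivation a z)"
    if "a \<in> Hom q" "x \<in> gr k" for q a x z k
    using Hom_linear[OF coderivation_Hom[OF that(1)]] that(2)
    by (simp add: T_def tensor_map_id_pure tensor_map_pure_id)
  have "coprod (coderivation (snd i) y) = T (fst i) (snd i) (coprod y)" if "i \<in> {(q, a). a \<in> Hom q}" for i
  proof (rule sym_eqI_family[where I = "{(q, a). a \<in> Hom q}" and i = i and y = y
        and f = "\<lambda>i y. coprod (coderivation (snd i) y)" and g = "\<lambda>i y. T (fst i) (snd i) (coprod y)"])
    show "i \<in> {(q, a). a \<in> Hom q}" by (rule that)
  next
    fix i :: "int \<times> ('a sym \<Rightarrow> 'a)" assume "i \<in> {(q, a). a \<in> Hom q}"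
    then obtain q a where i: "i = (q, a)" and a: "a \<in> Hom q" by blast
    note Ha = coderivation_Hom[OF a]
    show "linear (\<lambda>y. coprod (coderivation (snd i) y))" "linear (\<lambda>y. T (fst i) (snd i) (coprod y))"
      using linear_compose[OF Hom_linear[OF Ha] linear_coprod] linear_compose[OF linear_coprod lin[OF a]]
      by (simp_all add: i o_def)
    show "coprod (coderivation (snd i) sym_one) = T (fst i) (snd i) (coprod sym_one)"
    proof -
      have "a sym_one \<in> gr q" using Hom_gr[OF a sym_one_gr] by simp
      from cop_step_pure[OF this sym_one_gr]
      show ?thesis
        by (simp add: i coprod_one pure[OF a sym_one_gr] coderivation_one[OF Hom_linear[OF a]] coprod_cons)
    qed
    fix m n :: int and v :: 'a and y :: "'a sym"
    assume v: "v \<in> gr m"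
      and IH: "\<And>j. j \<in> {(q, a). a \<in> Hom q} \<Longrightarrow> coprod (coderivation (snd j) y) = T (fst j) (snd j) (coprod y)"
    have av: "a \<circ> sym_cons v \<in> Hom (m + q)" by (rule Hom_comp[OF sym_cons_Hom[OF v] a refl])
    have eq: "(\<lambda>t. T q a (cop_step v t)) = (\<lambda>t. T (m + q) (a \<circ> sym_cons v) t + (-1) powi (q * m) *\<^sub>R cop_step v (T q a t))"
    proof (rule tensor_eqI)
      note L = linear_simps[OF lin[OF a]] linear_simps[OF lin[OF av]] linear_simps[OF linear_cop_step]
      show "linear (\<lambda>t. T q a (cop_step v t))"
        "linear (\<lambda>t. T (m + q) (a \<circ> sym_cons v) t + (-1) powi (q * m) *\<^sub>R cop_step v (T q a t))"
        by (simp_all add: linear_iff L scaleR_add_right scaleR_left_commute)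
      fix k and x z :: "'a sym" assume x: "x \<in> gr k"
      show "T q a (cop_step v (x \<otimes> z)) =
          T (m + q) (a \<circ> sym_cons v) (x \<otimes> z) + (-1) powi (q * m) *\<^sub>R cop_step v (T q a (x \<otimes> z))"
        by (simp add: cop_step_pure[OF v x] cop_step_pure[OF v Hom_gr[OF Ha x refl]] L
            pure[OF a x] pure[OF av x] pure[OF a sym_cons_gr[OF v x]] coderivation_cons[OF a v] tensor_pure_simps)
          (auto simp: sgn_powi scaleR_add_right)
    qed
    have "coprod (coderivation a y) = T q a (coprod y)"
      "coprod (coderivation (a \<circ> sym_cons v) y) = T (m + q) (a \<circ> sym_cons v) (coprod y)"
      using IH[of "(q, a)"] IH[of "(m + q, a \<circ> sym_cons v)"] a av by auto
    with fun_cong[OF eq, of "coprod y"] show "coprod (coderivation (snd i) (sym_cons v y)) = T (fst i) (snd i) (coprod (sym_cons v y))"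
      by (simp add: i coprod_cons coderivation_cons[OF a v] linear_simps[OF linear_coprod])
  qed
  from this[of "(q, a)"] assms show ?thesis by (simp add: T_def)
qed

section \<open>The length filtration\<close>

text \<open>The strict bound makes \<open>sym_len 0\<close> zero, so that the cochains vanishing on
  it are all cochains; words of length at most n span \<open>sym_len (Suc n)\<close>.\<close>

definition sym_len :: "nat \<Rightarrow> 'a::graded_vector sym set" where
  "sym_len n = span {word vs | vs ds. homogeneous ds vs \<and> length vs < n}"

lemma subspace_sym_len: "subspace (sym_len n)"
  by (simp add: sym_len_def)

lemma sym_len_mono: "m \<le> n \<Longrightarrow> x \<in> sym_len m \<Longrightarrow> x \<in> sym_len n"
  unfolding sym_len_def by (rule subsetD[OF span_mono]) auto

lemma word_sym_len: "homogeneous ds vs \<Longrightarrow> length vs < n \<Longrightarrow> word vs \<in> sym_len n"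
  unfolding sym_len_def by (rule span_base) blast

lemma sym_one_len: "0 < n \<Longrightarrow> sym_one \<in> sym_len n"
  unfolding sym_one_def by (rule word_sym_len[of "[]"]) (simp_all add: homogeneous_Nil_iff)

lemma sym_len_0: "sym_len 0 = {0}"
  by (simp add: sym_len_def)

lemma sym_len_induct:
  assumes "linear f" "subspace S" "\<And>ds vs. homogeneous ds vs \<Longrightarrow> length vs < n \<Longrightarrow> f (word vs) \<in> S" "x \<in> sym_len n"
  shows "f x \<in> S"
  using assms(4) unfolding sym_len_def
  by (rule linear_span_subset[OF assms(1) _ assms(2), rotated]) (use assms(3) in auto)

lemma sym_len_preserve:
  assumes "linear f" "\<And>ds vs. homogeneous ds vs \<Longrightarrow> f (word vs) \<in> sym_len (Suc (length vs))" "x \<in> sym_len n"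
  shows "f x \<in> sym_len n"
  by (rule sym_len_induct[OF assms(1) subspace_sym_len _ assms(3)])
    (use assms(2) sym_len_mono[of "Suc _" n] in \<open>auto simp: Suc_le_eq\<close>)

text \<open>Exhaustion of S(V) by bounded length is what makes the dual filtration of cochains
  separated and complete.\<close>

lemma ex_sym_len: "\<exists>n. x \<in> sym_len n"
proof -
  have "x \<in> span {word vs | vs ds. homogeneous ds vs}" by (simp only: span_homogeneous_word UNIV_I)
  then show ?thesis
  proof (induction rule: span_induct_alt)
    case base
    show ?case using subspace_0[OF subspace_sym_len] by blast
  next
    case (step c y x)
    then obtain n vs ds where *: "x \<in> sym_len n" "y = word vs" "homogeneous ds vs" by blast
    let ?k = "max n (Suc (length vs))"
    have "y \<in> sym_len ?k" "x \<in> sym_len ?k"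
      using * sym_len_mono[of n ?k] word_sym_len[of ds vs ?k] by auto
    then show ?case using subspace_add[OF subspace_sym_len] subspace_scale[OF subspace_sym_len] by blast
  qed
qed

lemma sym_cons_len:
  assumes y: "y \<in> sym_len n" shows "sym_cons v y \<in> sym_len (Suc n)"
proof -
  have hom: "sym_cons (gr_components v m) y \<in> sym_len (Suc n)" for m
  proof (rule sym_len_induct[OF linear_bilin(2)[OF bilin_sym_cons] subspace_sym_len _ y])
    fix ds and vs :: "'a list" assume *: "homogeneous ds vs" "length vs < n"
    then have "homogeneous (m # ds) (gr_components v m # vs)"
      by (simp add: homogeneous_def components_gr)
    from word_sym_len[OF this, of "Suc n"] * show "sym_cons (gr_components v m) (word vs) \<in> sym_len (Suc n)"
      by simp
  qed
  have "sym_cons (\<Sum>m | gr_components v m \<noteq> 0. gr_components v m) y \<in> sym_len (Suc n)"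
    unfolding linear_sum[OF linear_bilin(1)[OF bilin_sym_cons]]
    by (rule subspace_sum[OF subspace_sym_len hom])
  then show ?thesis by (simp add: sum_components)
qed

lemma sym_map_len:
  assumes \<phi>: "\<phi> \<in> Hom 0" and x: "x \<in> sym_len n" shows "sym_map \<phi> x \<in> sym_len n"
proof (rule sym_len_preserve[OF linear_sym_map[OF \<phi>] _ x])
  show "sym_map \<phi> (word vs) \<in> sym_len (Suc (length vs))" if "homogeneous ds vs" for ds vs
    using that
  proof (rule word_homogeneous_induct)
    show "sym_map \<phi> sym_one \<in> sym_len (Suc (length []))"
      by (simp add: sym_map_one[OF \<phi>] sym_one_len)
  qed (auto simp: sym_map_cons[OF \<phi>] sym_cons_len simp del: sym_cons_word)
qed

lemma sym_der_len:
  fixes x :: "'a::graded_vector sym"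
  assumes \<theta>: "\<theta> \<in> Hom d" and x: "x \<in> sym_len n" shows "sym_der d \<theta> x \<in> sym_len n"
proof (rule sym_len_preserve[OF linear_sym_der[OF \<theta>] _ x])
  have "sym_der d \<theta> (word vs) \<in> sym_len (Suc (length vs)) \<and> word vs \<in> sym_len (Suc (length vs))"
    if "homogeneous ds vs" for ds vs
    using that
  proof (rule word_homogeneous_induct)
    fix m es and v :: 'a and vs :: "'a list" assume "v \<in> gr m"
      and IH: "sym_der d \<theta> (word vs) \<in> sym_len (Suc (length vs)) \<and> word vs \<in> sym_len (Suc (length vs))"
    then show "sym_der d \<theta> (sym_cons v (word vs)) \<in> sym_len (Suc (length (v # vs))) \<and>
        sym_cons v (word vs) \<in> sym_len (Suc (length (v # vs)))"
      using IH[THEN conjunct1, THEN sym_cons_len] IH[THEN conjunct2, THEN sym_cons_len]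
      by (simp del: sym_cons_word
          add: sym_der_cons[OF \<theta>] subspace_add[OF subspace_sym_len] subspace_scale[OF subspace_sym_len])
  qed (simp add: sym_der_one[OF \<theta>] subspace_0[OF subspace_sym_len] sym_one_len)
  then show "sym_der d \<theta> (word vs) \<in> sym_len (Suc (length vs))" if "homogeneous ds vs" for ds vs
    using that by blast
qed

lemma sym_split_len:
  assumes p: "p \<in> Hom 0" and q: "q \<in> Hom 0" and x: "x \<in> sym_len n" shows "sym_split p q w x \<in> sym_len n"
proof (rule sym_len_preserve[OF linear_sym_split[OF p q] _ x])
  have "\<forall>w. sym_split p q w (word vs) \<in> sym_len (Suc (length vs))" if "homogeneous ds vs" for ds vs
    using that
  proof (rule word_homogeneous_induct)
    show "\<forall>w. sym_split p q w sym_one \<in> sym_len (Suc (length []))"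
      by (simp add: sym_split_one[OF p q] subspace_scale[OF subspace_sym_len] sym_one_len)
  qed (auto simp: sym_split_cons[OF p q] sym_cons_len subspace_add[OF subspace_sym_len] simp del: sym_cons_word)
  then show "sym_split p q w (word vs) \<in> sym_len (Suc (length vs))" if "homogeneous ds vs" for ds vs
    using that by blast
qed

subsection \<open>Leading terms of coderivations\<close>

text \<open>Only the term 1 \<otimes> vs of the coproduct lets \<open>a\<close> consume nothing, and
  it lengthens the word by the factor \<open>a sym_one\<close>; in all other terms a factor is
  consumed and the length does not grow. Maps with \<open>a sym_one \<noteq> 0\<close> must be
  covered because the next lemma needs \<open>a \<circ> sym_cons v\<close>.\<close>

lemma coderivation_word:
  fixes vs :: "'a::graded_vector list"
  assumes "homogeneous ds vs" "a \<in> Hom q"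
  shows "coderivation a (word vs) - sym_cons (a sym_one) (word vs) \<in> sym_len (Suc (length vs))"
proof -
  have "\<forall>q a. a \<in> Hom q \<longrightarrow>
      coderivation a (word vs) - sym_cons (a sym_one) (word vs) \<in> sym_len (Suc (length vs))"
    using assms(1)
  proof (rule word_homogeneous_induct)
    show "\<forall>q a. a \<in> Hom q \<longrightarrow>
        coderivation a sym_one - sym_cons (a sym_one) (sym_one :: 'a sym) \<in> sym_len (Suc (length ([] :: 'a list)))"
      by (auto simp: coderivation_one[OF Hom_linear] subspace_0[OF subspace_sym_len])
    fix m es and v :: 'a and vs :: "'a list"
    assume v: "v \<in> gr m" and vs: "homogeneous es vs"
      and IH: "\<forall>q a. a \<in> Hom q \<longrightarrow>
        coderivation a (word vs) - sym_cons (a sym_one) (word vs) \<in> sym_len (Suc (length vs))"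
    define y where "y = word vs"
    define n where "n = length vs"
    have y: "y \<in> sym_len (Suc n)" unfolding y_def n_def by (rule word_sym_len[OF vs]) simp
    have "coderivation a (sym_cons v y) - sym_cons (a sym_one) (sym_cons v y) \<in> sym_len (Suc (Suc n))"
      if a: "a \<in> Hom q" for q a
    proof -
      have av: "a \<circ> sym_cons v \<in> Hom (m + q)" by (rule Hom_comp[OF sym_cons_Hom[OF v] a refl])
      have "a sym_one \<in> gr q" using Hom_gr[OF a sym_one_gr] by simp
      note swap = sym_cons_swap[OF v this, of y]
      let ?s = "(-1) powi (q * m) :: real"
      let ?A = "coderivation (a \<circ> sym_cons v) y - sym_cons ((a \<circ> sym_cons v) sym_one) y"
      let ?B = "sym_cons ((a \<circ> sym_cons v) sym_one) y"
      let ?C = "sym_cons v (coderivation a y - sym_cons (a sym_one) y)"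
      have "coderivation a (sym_cons v y) - sym_cons (a sym_one) (sym_cons v y) = ?A + ?B + ?s *\<^sub>R ?C"
        by (auto simp: coderivation_cons[OF a v] linear_diff[OF linear_bilin(2)[OF bilin_sym_cons]] swap
            scaleR_diff_right sgn_powi)
      moreover have "?A \<in> sym_len (Suc (Suc n))"
        by (rule sym_len_mono[OF _ IH[rule_format, OF av, folded y_def n_def]]) simp
      moreover have "?B \<in> sym_len (Suc (Suc n))" by (rule sym_cons_len[OF y])
      moreover have "?C \<in> sym_len (Suc (Suc n))"
        by (rule sym_cons_len) (use IH a in \<open>simp add: y_def n_def\<close>)
      ultimately show ?thesis
        by (simp only: subspace_add[OF subspace_sym_len] subspace_scale[OF subspace_sym_len])
    qed
    then show "\<forall>q a. a \<in> Hom q \<longrightarrow>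
        coderivation a (sym_cons v (word vs)) - sym_cons (a sym_one) (sym_cons v (word vs))
          \<in> sym_len (Suc (length (v # vs)))"
      by (simp add: y_def n_def)
  qed
  with assms(2) show ?thesis by blast
qed

text \<open>The terms in which \<open>a\<close> consumes exactly one factor form the derivation;
  consuming more shortens the word. In the step, \<open>a \<circ> sym_cons v\<close> takes the value
  \<open>a (sym_incl v)\<close> at 1, and its longest term is the first summand of the Leibniz
  rule.\<close>

lemma coderivation_leading_term:
  fixes vs :: "'a::graded_vector list"
  assumes "homogeneous ds vs" and a: "a \<in> Hom q" and a1: "a sym_one = 0"
  shows "coderivation a (word vs) - sym_der q (a \<circ> sym_incl) (word vs) \<in> sym_len (length vs)"
  using assms(1)
proof (rule word_homogeneous_induct)
  have ai: "a \<circ> sym_incl \<in> Hom q" using Hom_comp[OF sym_incl_Hom a] by simp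
  show "coderivation a sym_one - sym_der q (a \<circ> sym_incl) sym_one \<in> sym_len (length ([] :: 'a list))"
    by (simp add: coderivation_one[OF Hom_linear[OF a]] sym_der_one[OF ai] a1 sym_cons_simps
        subspace_0[OF subspace_sym_len])
  fix m es and v :: 'a and vs :: "'a list"
  assume v: "v \<in> gr m" and vs: "homogeneous es vs"
    and IH: "coderivation a (word vs) - sym_der q (a \<circ> sym_incl) (word vs) \<in> sym_len (length vs)"
  have av: "a \<circ> sym_cons v \<in> Hom (m + q)" by (rule Hom_comp[OF sym_cons_Hom[OF v] a refl])
  let ?s = "(-1) powi (q * m) :: real"
  let ?A = "coderivation (a \<circ> sym_cons v) (word vs) - sym_cons ((a \<circ> sym_cons v) sym_one) (word vs)"
  let ?C = "sym_cons v (coderivation a (word vs) - sym_der q (a \<circ> sym_incl) (word vs))"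
  have "(a \<circ> sym_cons v) sym_one = (a \<circ> sym_incl) v" by (simp add: sym_one_def sym_incl_def)
  then have "coderivation a (sym_cons v (word vs)) - sym_der q (a \<circ> sym_incl) (sym_cons v (word vs)) = ?A + ?s *\<^sub>R ?C"
    by (simp del: sym_cons_word add: coderivation_cons[OF a v] sym_der_cons[OF ai v]
        linear_diff[OF linear_bilin(2)[OF bilin_sym_cons]] scaleR_diff_right)
  moreover have "?A \<in> sym_len (Suc (length vs))" by (rule coderivation_word[OF vs av])
  moreover have "?C \<in> sym_len (Suc (length vs))" by (rule sym_cons_len[OF IH])
  ultimately show "coderivation a (sym_cons v (word vs)) - sym_der q (a \<circ> sym_incl) (sym_cons v (word vs))
      \<in> sym_len (length (v # vs))"
    by (simp add: subspace_add[OF subspace_sym_len] subspace_scale[OF subspace_sym_len] del: sym_cons_word)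
qed

subsection \<open>Leading terms of coalgebra morphisms\<close>

definition tensor_len :: "nat \<Rightarrow> ('a::graded_vector sym \<otimes> 'a sym) set" where
  "tensor_len n = span {word xs \<otimes> word ys | xs ys ds es.
     homogeneous ds xs \<and> homogeneous es ys \<and> length xs + length ys = n}"

lemma coprod_tensor_len:
  fixes vs :: "'a::graded_vector list"
  assumes "homogeneous ds vs" shows "coprod (word vs) \<in> tensor_len (length vs)"
  using assms
proof (rule word_homogeneous_induct)
  show "coprod sym_one \<in> tensor_len (length ([] :: 'a list))"
    unfolding coprod_one unfolding tensor_len_def sym_one_def
    by (intro span_base CollectI exI[of _ "[]"] exI[of _ "[] :: int list"] conjI refl)
      (simp_all add: homogeneous_Nil_iff)
  fix m es and v :: 'a and vs :: "'a list"
  assume v: "v \<in> gr m" and IH: "coprod (word vs) \<in> tensor_len (length vs)"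
  have "cop_step v (coprod (word vs)) \<in> tensor_len (Suc (length vs))"
  proof (rule linear_span_subset[OF linear_cop_step _ _ IH[unfolded tensor_len_def]])
    show S: "subspace (tensor_len (Suc (length vs)))" by (simp add: tensor_len_def)
    fix t :: "'a sym \<otimes> 'a sym"
    assume "t \<in> {word xs \<otimes> word ys | xs ys ds es.
      homogeneous ds xs \<and> homogeneous es ys \<and> length xs + length ys = length vs}"
    then obtain xs ys ds es where t: "t = word xs \<otimes> word ys" "homogeneous ds xs" "homogeneous es ys"
      "length xs + length ys = length vs" by blast
    have hx: "homogeneous (m # ds) (v # xs)" and hy: "homogeneous (m # es) (v # ys)"
      using v t by (simp_all add: homogeneous_def)
    have "word (v # xs) \<otimes> word ys \<in> tensor_len (Suc (length vs))"
      unfolding tensor_len_def by (rule span_base) (use hx t in force)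
    moreover have "word xs \<otimes> word (v # ys) \<in> tensor_len (Suc (length vs))"
      unfolding tensor_len_def by (rule span_base) (use hy t in force)
    ultimately show "cop_step v t \<in> tensor_len (Suc (length vs))"
      by (simp add: t(1) cop_step_pure[OF v word_gr[OF t(2)]] subspace_add[OF S] subspace_scale[OF S])
  qed
  then show "coprod (sym_cons v (word vs)) \<in> tensor_len (length (v # vs))"
    by (simp add: coprod_cons del: sym_cons_word)
qed

section \<open>The Euler operator and its inverse on words of positive length\<close>

lemma sym_proj_Hom: "sym_proj \<in> Hom 0"
proof (rule HomI[OF linear_sym_proj])
  fix n and x :: "'a sym" assume "x \<in> gr n"
  then show "sym_proj x \<in> gr (n + 0)"
    unfolding gr_sym_def[of n]
    by (rule linear_span_subset[OF linear_sym_proj _ subspace_gr, rotated])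
      (auto simp: sym_proj_word homogeneous_def list_all2_Cons2 gr_zero split: list.splits)
qed

lemma sym_proj_cons: "sym_proj (sym_cons v x) = counit x *\<^sub>R v"
proof (rule linear_eq_on_span[where f = "\<lambda>x. sym_proj (sym_cons v x)" and g = "\<lambda>x. counit x *\<^sub>R v"])
  show "x \<in> span (range word)" by (simp add: span_word)
  show "linear (\<lambda>x. sym_proj (sym_cons v x))" "linear (\<lambda>x. counit x *\<^sub>R v)"
    by (simp_all add: linear_iff linear_simps[OF linear_sym_proj] linear_simps[OF linear_counit] sym_cons_simps
        scaleR_add_left)
  fix y :: "'a sym" assume "y \<in> range word"
  then obtain vs where y: "y = word vs" by blast
  show "sym_proj (sym_cons v y) = counit y *\<^sub>R v"
    unfolding y using counit_cons[of _ "word _"]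
    by (cases vs) (auto simp: sym_proj_word counit_one[unfolded sym_one_def])
qed

lemma sym_der_id_word: "homogeneous ds vs \<Longrightarrow> sym_der 0 (\<lambda>v. v) (word vs) = real (length vs) *\<^sub>R word vs"
  by (induction rule: word_homogeneous_induct)
    (auto simp: sym_der_one[OF ident_in_Hom] sym_der_cons[OF ident_in_Hom] sym_cons_simps scaleR_add_left
      simp del: sym_cons_word)

text \<open>\<open>sym_proj\<close> selects the terms of the coproduct with a single factor on the
  left, and multiplying back returns the word once for each factor. Formally
  \<open>sym_proj \<circ> sym_cons v\<close> is the counit times \<open>v\<close>, so the counit law
  gives the step.\<close>

lemma coderivation_sym_proj: "coderivation sym_proj y = sym_der 0 (\<lambda>v. v) y"
proof (rule sym_eqI[OF Hom_linear[OF coderivation_Hom[OF sym_proj_Hom]] linear_sym_der[OF ident_in_Hom]])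
  show "coderivation sym_proj sym_one = sym_der 0 (\<lambda>v. v) (sym_one :: 'a sym)"
    using sym_proj_word[of "[] :: 'a list"]
    by (simp add: coderivation_one[OF linear_sym_proj] sym_der_one[OF ident_in_Hom] sym_one_def[symmetric]
        bilin_zero[OF bilin_sym_cons] del: sym_cons_word)
  fix m n and v :: 'a and y :: "'a sym"
  assume v: "v \<in> gr m" and IH: "coderivation sym_proj y = sym_der 0 (\<lambda>v. v) y"
  have lin: "linear (sym_proj \<circ> sym_cons v)"
    by (rule linear_compose[OF linear_bilin(2)[OF bilin_sym_cons] linear_sym_proj])
  have eq: "(\<lambda>t. sym_mult (tensor_map 0 (sym_incl \<circ> (sym_proj \<circ> sym_cons v)) id t)) =
      (\<lambda>t. sym_cons v (counit_left t))"
  proof (rule tensor_eqI)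
    show "linear (\<lambda>t. sym_mult (tensor_map 0 (sym_incl \<circ> (sym_proj \<circ> sym_cons v)) id t))"
      using linear_compose[OF linear_tensor_map_id[OF linear_incl_comp[OF lin]] linear_sym_mult] by (simp add: o_def)
    show "linear (\<lambda>t :: _ \<otimes> 'a sym. sym_cons v (counit_left t))"
      by (simp add: linear_iff linear_simps[OF linear_counit_left] sym_cons_simps)
    show "sym_mult (tensor_map 0 (sym_incl \<circ> (sym_proj \<circ> sym_cons v)) id (x \<otimes> z)) = sym_cons v (counit_left (x \<otimes> z))"
      if "x \<in> gr k" for k x z
      by (simp add: tensor_map_id_pure[OF linear_incl_comp[OF lin] that] vee_sym_incl sym_proj_cons sym_cons_simps)
  qed
  have "coderivation (sym_proj \<circ> sym_cons v) y = sym_cons v y"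
    using fun_cong[OF eq, of "coprod y"] by (simp add: coderivation_def counit_left_coprod)
  then show "coderivation sym_proj (sym_cons v y) = sym_der 0 (\<lambda>v. v) (sym_cons v y)"
    by (simp add: coderivation_cons[OF sym_proj_Hom v] sym_der_cons[OF ident_in_Hom v] IH)
qed

text \<open>With \<open>p = 0\<close> and \<open>q = id\<close> only the full index set survives in
  \<open>sym_split\<close>, so the weight \<open>1 / k\<close> divides a word by its length. The
  constant term, lost under the Euler operator, is added back through the counit and lies in
  \<open>sym_len n\<close> since \<open>0 < n\<close>.\<close>

lemma sym_der_id_len_cancel:
  assumes "sym_der 0 (\<lambda>v. v) x \<in> sym_len n" "0 < n" shows "x \<in> sym_len n"
proof -
  have z: "(\<lambda>_. 0) \<in> Hom 0" using subspace_0[OF subspace_Hom] by (simp add: zero_fun_def)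
  let ?R = "sym_split (\<lambda>_. 0) (\<lambda>v. v) (\<lambda>k. 1 / real k)"
  note R = linear_sym_split[OF z ident_in_Hom] and D = linear_sym_der[OF ident_in_Hom]
  have word: "sym_split (\<lambda>_. 0) (\<lambda>v. v) w (word vs) = w (length vs) *\<^sub>R word vs" if "homogeneous ds vs" for w ds and vs :: "'a list"
  proof -
    have "\<forall>w. sym_split (\<lambda>_. 0) (\<lambda>v. v) w (word vs) = w (length vs) *\<^sub>R word vs"
      using that
      by (induction rule: word_homogeneous_induct)
        (auto simp: sym_split_one[OF z ident_in_Hom] sym_split_cons[OF z ident_in_Hom] sym_cons_simps simp del: sym_cons_word)
    then show ?thesis by blast
  qed
  have "?R (sym_der 0 (\<lambda>v. v) x) = x - counit x *\<^sub>R sym_one"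
  proof (rule linear_eq_on_span[where f = "\<lambda>x. ?R (sym_der 0 (\<lambda>v. v) x)" and g = "\<lambda>x. x - counit x *\<^sub>R sym_one"])
    show "linear (\<lambda>x. ?R (sym_der 0 (\<lambda>v. v) x))" using linear_compose[OF D R] by (simp add: o_def)
    show "linear (\<lambda>x :: 'a sym. x - counit x *\<^sub>R sym_one)"
      by (auto simp: linear_iff linear_simps[OF linear_counit] scaleR_add_left algebra_simps)
    show "x \<in> span {word vs | vs ds. homogeneous ds vs}" by (simp only: span_homogeneous_word UNIV_I)
    fix y :: "'a sym" assume "y \<in> {word vs | vs ds. homogeneous ds vs}"
    then obtain vs ds where y: "y = word vs" "homogeneous ds vs" by blast
    show "?R (sym_der 0 (\<lambda>v. v) y) = y - counit y *\<^sub>R sym_one"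
    proof (cases vs)
      case Nil
      then show ?thesis
        unfolding y sym_der_id_word[OF y(2)]
        by (simp add: linear_0[OF R] sym_one_def counit_one[unfolded sym_one_def])
    next
      case (Cons v us)
      then show ?thesis
        using counit_cons[of v "word us"]
        unfolding y sym_der_id_word[OF y(2)] linear_simps(2)[OF R] word[OF y(2)] by simp
    qed
  qed
  then have "x = ?R (sym_der 0 (\<lambda>v. v) x) + counit x *\<^sub>R sym_one" by simp
  also have "\<dots> \<in> sym_len n"
    by (intro subspace_add[OF subspace_sym_len] subspace_scale[OF subspace_sym_len] sym_one_len assms
        sym_split_len[OF z ident_in_Hom])
  finally show ?thesis .
qed

text \<open>
  Composing the comultiplicativity of \<open>F\<close> with \<open>\<mu> \<circ> (pr \<otimes> id)\<close> turns \<open>\<Delta>\<close> into the Euler operator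
  \<open>word vs \<mapsto> length vs *\<^sub>R word vs\<close>, which can be inverted on words of positive length.
\<close>

lemma coalgebra_morphism_leading_term:
  fixes F :: "'a::graded_vector sym \<Rightarrow> 'b::graded_vector sym"
  assumes F: "F \<in> Hom 0" and comult: "\<And>x. coprod (F x) = tensor_map 0 F F (coprod x)"
    and F1: "F sym_one = sym_one" and vs: "homogeneous ds vs"
  shows "F (word vs) - sym_map (sym_proj \<circ> F \<circ> sym_incl) (word vs) \<in> sym_len (length vs)"
  using vs
proof (induction "length vs" arbitrary: vs ds rule: less_induct)
  case less
  define \<phi> where "\<phi> = sym_proj \<circ> F \<circ> sym_incl"
  have \<phi>: "\<phi> \<in> Hom 0"
    unfolding \<phi>_def by (rule Hom_comp[OF sym_incl_Hom Hom_comp[OF F sym_proj_Hom]]) simp_all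
  note Flin = Hom_linear[OF F] and Slin = linear_sym_map[OF \<phi>]
  let ?n = "length vs"
  show ?case
  proof (cases "?n = 0")
    case True
    then show ?thesis
      using F1 sym_map_one[OF \<phi>] by (simp add: sym_one_def \<phi>_def subspace_0[OF subspace_sym_len])
  next
    case False
    \<comment> \<open>On the coproduct of the word, \<open>G1\<close> and \<open>G2\<close> give the
      Euler operator applied to \<open>F (word vs)\<close> and to
      \<open>sym_map \<phi> (word vs)\<close>. They can thus be compared on pure tensors of
      words.\<close>
    define G1 where "G1 t = sym_mult (tensor_map 0 (sym_incl \<circ> sym_proj) id (tensor_map 0 F F t))" for t
    define G2 where "G2 t = sym_map \<phi> (sym_mult (tensor_map 0 (sym_incl \<circ> sym_proj) id t))" for t
    have pr1: "sym_proj (sym_one :: 'c::graded_vector sym) = 0" by (simp add: sym_one_def sym_proj_word)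
    have G1: "G1 (x \<otimes> z) = sym_cons (sym_proj (F x)) (F z)" if "x \<in> gr k" for k x z
    proof -
      have "F x \<in> gr k" using Hom_gr[OF F that] by simp
      then show ?thesis
        by (simp add: G1_def tensor_map_pure[OF Flin Flin that]
            tensor_map_id_pure[OF linear_incl_comp[OF linear_sym_proj]] vee_sym_incl)
    qed
    have G2: "G2 (x \<otimes> z) = sym_cons (\<phi> (sym_proj x)) (sym_map \<phi> z)" if "x \<in> gr k" for k x z
      by (simp add: G2_def tensor_map_id_pure[OF linear_incl_comp[OF linear_sym_proj] that] vee_sym_incl
          sym_map_cons[OF \<phi>])
    have linM: "linear (\<lambda>t. sym_mult (tensor_map 0 (sym_incl \<circ> sym_proj) id t))"
      using linear_compose[OF linear_tensor_map_id[OF linear_incl_comp[OF linear_sym_proj]] linear_sym_mult]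
      by (simp add: o_def)
    have lin: "linear (\<lambda>t. G1 t - G2 t)"
      using linear_compose_sub[OF linear_compose[OF linear_tensor_map[OF Flin Flin, of 0] linM] linear_compose[OF linM Slin]]
      by (simp add: G1_def G2_def o_def)
    have "G1 (coprod (word vs)) - G2 (coprod (word vs)) \<in> sym_len ?n"
    proof (rule linear_span_subset[OF lin _ subspace_sym_len coprod_tensor_len[OF less.prems, unfolded tensor_len_def]])
      fix t :: "'a sym \<otimes> 'a sym"
      assume "t \<in> {word xs \<otimes> word ys | xs ys ds es.
        homogeneous ds xs \<and> homogeneous es ys \<and> length xs + length ys = ?n}"
      then obtain xs ys ds es where t: "t = word xs \<otimes> word ys" and xs: "homogeneous ds xs"
        and ys: "homogeneous es ys" and len: "length xs + length ys = ?n" by blast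
      note G = G1[OF word_gr[OF xs], of "word ys"] G2[OF word_gr[OF xs], of "word ys"]
      \<comment> \<open>By the length of the left word: for length 0 both terms vanish; for length 1
        the induction hypothesis for \<open>ys\<close> applies behind the common factor
        \<open>\<phi> v\<close>; for greater length \<open>G2\<close> vanishes and \<open>G1\<close>
        has replaced at least two factors by one.\<close>
      show "G1 t - G2 t \<in> sym_len ?n"
      proof (cases xs)
        case Nil
        then have "word xs = sym_one" by (simp add: sym_one_def)
        then show ?thesis
          unfolding t G by (simp add: F1 pr1 linear_0[OF Hom_linear[OF \<phi>]] bilin_zero[OF bilin_sym_cons]
              subspace_0[OF subspace_sym_len])
      next
        case (Cons v us)
        then have "length ys < ?n" using len by simp
        then have IH: "F (word ys) - sym_map \<phi> (word ys) \<in> sym_len (length ys)"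
          unfolding \<phi>_def by (rule less.hyps) (rule ys)
        show ?thesis
        proof (cases us)
          case Nil
          have "word xs = sym_incl v" by (simp add: Cons Nil sym_incl_def)
          then have "G1 t - G2 t = sym_cons (\<phi> v) (F (word ys) - sym_map \<phi> (word ys))"
            unfolding t G
            by (simp add: linear_diff[OF linear_bilin(2)[OF bilin_sym_cons]] \<phi>_def sym_incl_def sym_proj_word)
          moreover have "?n = Suc (length ys)" using len Cons Nil by simp
          ultimately show ?thesis using sym_cons_len[OF IH] by simp
        next
          case (Cons w ws)
          have "sym_map \<phi> (word ys) \<in> sym_len (Suc (length ys))"
            by (rule sym_map_len[OF \<phi> word_sym_len[OF ys]]) simp
          moreover have "F (word ys) - sym_map \<phi> (word ys) \<in> sym_len (Suc (length ys))"
            by (rule sym_len_mono[OF _ IH]) simp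
          ultimately have "F (word ys) \<in> sym_len (Suc (length ys))"
            using subspace_add[OF subspace_sym_len] by fastforce
          then have "sym_cons (sym_proj (F (word xs))) (F (word ys)) \<in> sym_len (Suc (Suc (length ys)))"
            by (rule sym_cons_len)
          moreover have "Suc (Suc (length ys)) \<le> ?n" using len \<open>xs = v # us\<close> Cons by simp
          moreover have "sym_proj (word xs) = 0" using \<open>xs = v # us\<close> Cons by (simp add: sym_proj_word)
          ultimately show ?thesis
            by (auto simp: t G linear_0[OF Hom_linear[OF \<phi>]] bilin_zero[OF bilin_sym_cons] intro: sym_len_mono)
        qed
      qed
    qed
    also have "G1 (coprod (word vs)) = sym_der 0 (\<lambda>v. v) (F (word vs))"
      by (simp add: G1_def comult[symmetric] coderivation_sym_proj[symmetric] coderivation_def)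
    also have "G2 (coprod (word vs)) = sym_der 0 (\<lambda>v. v) (sym_map \<phi> (word vs))"
      using sym_map_der[OF \<phi> ident_in_Hom ident_in_Hom, of "word vs"]
      by (simp add: G2_def coderivation_sym_proj[symmetric] coderivation_def)
    finally have "sym_der 0 (\<lambda>v. v) (F (word vs) - sym_map \<phi> (word vs)) \<in> sym_len ?n"
      by (simp add: linear_diff[OF linear_sym_der[OF ident_in_Hom]])
    then show ?thesis
      unfolding \<phi>_def by (rule sym_der_id_len_cancel) (use False in simp)
  qed
qed

section \<open>Cochains with values in a representation up to homotopy\<close>

lemma scaleR_fun_apply: "(c *\<^sub>R f) x = c *\<^sub>R f x"
  by (simp add: scaleR_fun_def)

lemma ruth_differential_apply:
  "ruth_differential lam rho p \<alpha> x =
    rho (tensor_map p id \<alpha> (coprod x)) - (-1) powi p *\<^sub>R \<alpha> (coderivation lam x)"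
  by (simp add: ruth_differential_def scaleR_fun_def)

lemma ruth_differential_Hom:
  assumes lam: "lam \<in> Hom 1" and rho: "rho \<in> Hom 1" and \<alpha>: "\<alpha> \<in> Hom p"
  shows "ruth_differential lam rho p \<alpha> \<in> Hom (p + 1)"
proof -
  have "rho \<circ> tensor_map p id \<alpha> \<circ> coprod \<in> Hom (p + 1)"
    by (rule Hom_comp[OF coprod_Hom Hom_comp[OF tensor_map_Hom[OF id_in_Hom \<alpha> refl] rho refl]]) simp
  moreover have "\<alpha> \<circ> coderivation lam \<in> Hom (p + 1)"
    by (rule Hom_comp[OF coderivation_Hom[OF lam] \<alpha>]) simp
  ultimately show ?thesis
    unfolding ruth_differential_def by (intro subspace_diff[OF subspace_Hom] subspace_scale[OF subspace_Hom])
qed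

text \<open>The nested map on the left is id \<otimes> id \<otimes> \<alpha>, whose sign over the
  two tensor factors of \<open>coprod x\<close> adds up to the sign over \<open>x\<close>. This lets
  \<alpha> be pulled out of the equation satisfied by \<open>rho\<close>.\<close>

lemma tensor_map_coassoc:
  fixes t :: "'a::graded_vector sym \<otimes> 'b::real_vector"
  assumes \<alpha>: "linear \<alpha>"
  shows "tensor_map p id (tensor_map p id \<alpha>) (assoc (tensor_map 0 coprod id t)) =
    assoc (tensor_map 0 coprod id (tensor_map p id \<alpha> t))"
proof -
  note P = linear_tensor_map_id'[OF \<alpha>, of p] linear_tensor_map_id'[OF linear_tensor_map_id'[OF \<alpha>, of p], of p]
  note C = linear_tensor_map_id[OF linear_coprod, of 0]
  have "(\<lambda>t :: 'a sym \<otimes> 'b. tensor_map p id (tensor_map p id \<alpha>) (assoc (tensor_map 0 coprod id t))) =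
      (\<lambda>t. assoc (tensor_map 0 coprod id (tensor_map p id \<alpha> t)))"
  proof (rule tensor_eqI)
    show "linear (\<lambda>t. tensor_map p id (tensor_map p id \<alpha>) (assoc (tensor_map 0 coprod id t)))"
      using linear_compose[OF linear_compose[OF C linear_assoc] P(2)] by (simp add: o_def)
    show "linear (\<lambda>t. assoc (tensor_map 0 coprod id (tensor_map p id \<alpha> t)))"
      using linear_compose[OF linear_compose[OF P(1) C] linear_assoc] by (simp add: o_def)
    fix k and x :: "'a sym" and z assume x: "x \<in> gr k"
    have s: "coprod x \<in> gr k" using Hom_gr[OF coprod_Hom x] by simp
    have "tensor_map p id (tensor_map p id \<alpha>) (assoc (coprod x \<otimes> z)) = (-1) powi (p * k) *\<^sub>R assoc (coprod x \<otimes> \<alpha> z)"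
    proof (rule linear_eq_on_span[OF _ _ _ s[unfolded gr_tensor_def],
          where f = "\<lambda>s. tensor_map p id (tensor_map p id \<alpha>) (assoc (s \<otimes> z))"
          and g = "\<lambda>s. (-1) powi (p * k) *\<^sub>R assoc (s \<otimes> \<alpha> z)"])
      show "linear (\<lambda>s. tensor_map p id (tensor_map p id \<alpha>) (assoc (s \<otimes> z)))"
        using linear_compose[OF linear_compose[OF linear_bilin(1)[OF tensor_pure_bilin] linear_assoc] P(2)]
        by (simp add: o_def)
      show "linear (\<lambda>s. (-1) powi (p * k) *\<^sub>R assoc (s \<otimes> \<alpha> z))"
        by (simp add: linear_iff linear_simps[OF linear_assoc] tensor_pure_simps scaleR_add_right scaleR_left_commute)
      fix t :: "'a sym \<otimes> 'a sym" assume "t \<in> {a \<otimes> b | a b i. a \<in> gr i \<and> b \<in> gr (k - i)}"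
      then obtain a b i where t: "t = a \<otimes> b" and a: "a \<in> gr i" and b: "b \<in> gr (k - i)" by blast
      show "tensor_map p id (tensor_map p id \<alpha>) (assoc (t \<otimes> z)) = (-1) powi (p * k) *\<^sub>R assoc (t \<otimes> \<alpha> z)"
        by (simp add: t tensor_map_pure_id[OF linear_tensor_map_id'[OF \<alpha>] a] tensor_map_pure_id[OF \<alpha> b]
            tensor_pure_simps) (auto simp: sgn_powi)
    qed
    then show "tensor_map p id (tensor_map p id \<alpha>) (assoc (tensor_map 0 coprod id (x \<otimes> z))) =
        assoc (tensor_map 0 coprod id (tensor_map p id \<alpha> (x \<otimes> z)))"
      by (simp add: tensor_map_id_pure[OF linear_coprod x] tensor_map_pure_id[OF \<alpha> x]
          linear_simps[OF C] linear_simps[OF linear_assoc])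
  qed
  then show ?thesis by (rule fun_cong)
qed

text \<open>Coassociativity turns the doubly acting part into the second term of the equation for
  \<open>rho\<close> at (id \<otimes> \<alpha>)(\<Delta> x), and the co-Leibniz rule produces its
  first term. The rule also yields a term with \<alpha> \<circ> d inside the tensor, which cancels
  against the one from expanding the inner differential; the last term contains d twice.\<close>

lemma ruth_differential_square:
  fixes rho :: "'g::graded_vector shift sym \<otimes> 'v::graded_vector \<Rightarrow> 'v"
  assumes lam: "lam \<in> Hom 1" and dd: "\<And>x. coderivation lam (coderivation lam x) = 0"
    and rho: "ruth lam rho" and \<alpha>: "\<alpha> \<in> Hom p"
  shows "ruth_differential lam rho (p + 1) (ruth_differential lam rho p \<alpha>) = 0"
proof
  fix x :: "'g shift sym"
  let ?d = "coderivation lam" and ?D = "ruth_differential lam rho p \<alpha>"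
  have r: "rho \<in> Hom 1"
    and rr: "\<And>t. rho (tensor_map 0 ?d id t) + rho (tensor_map 1 id rho (assoc (tensor_map 0 coprod id t))) = 0"
    using rho by (auto simp: ruth_def)
  note lin = Hom_linear[OF \<alpha>] Hom_linear[OF r] Hom_linear[OF coderivation_Hom[OF lam]]
  note rlin = linear_simps[OF lin(2)] linear_diff[OF lin(2)]
  have T: "linear (tensor_map p id \<alpha>)" by (rule linear_tensor_map_id'[OF lin(1)])
  define \<beta> where "\<beta> = rho \<circ> tensor_map p id \<alpha> \<circ> coprod"
  define \<gamma> where "\<gamma> = \<alpha> \<circ> ?d"
  have \<beta>: "linear \<beta>" and \<gamma>: "linear \<gamma>"
    unfolding \<beta>_def \<gamma>_def by (auto intro!: linear_compose linear_coprod T lin)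
  have D: "?D = \<beta> - (-1) powi p *\<^sub>R \<gamma>" by (simp add: ruth_differential_def \<beta>_def \<gamma>_def)
  have Dlin: "linear ?D" by (rule Hom_linear[OF ruth_differential_Hom[OF lam r \<alpha>]])
  have 1: "(\<lambda>t :: 'g shift sym \<otimes> 'g shift sym. tensor_map (p + 1) id ?D t) =
      (\<lambda>t. tensor_map (p + 1) id \<beta> t - (-1) powi p *\<^sub>R tensor_map (p + 1) id \<gamma> t)"
  proof (rule tensor_eqI)
    note L = linear_simps[OF linear_tensor_map_id'[OF \<beta>]] linear_simps[OF linear_tensor_map_id'[OF \<gamma>]]
    show "linear (tensor_map (p + 1) id ?D)" by (rule linear_tensor_map_id'[OF Dlin])
    show "linear (\<lambda>t. tensor_map (p + 1) id \<beta> t - (-1) powi p *\<^sub>R tensor_map (p + 1) id \<gamma> t)"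
      by (auto simp: linear_iff L scaleR_add_right scaleR_diff_right scaleR_left_commute)
    show "tensor_map (p + 1) id ?D (v \<otimes> w) =
        tensor_map (p + 1) id \<beta> (v \<otimes> w) - (-1) powi p *\<^sub>R tensor_map (p + 1) id \<gamma> (v \<otimes> w)"
      if "v \<in> gr n" for n v w
      unfolding tensor_map_pure_id[OF Dlin that] tensor_map_pure_id[OF \<beta> that] tensor_map_pure_id[OF \<gamma> that]
      by (simp add: D scaleR_fun_def linear_diff[OF linear_bilin(2)[OF tensor_pure_bilin]] tensor_pure_simps
          scaleR_diff_right scaleR_left_commute)
  qed
  have 2: "(\<lambda>t. tensor_map p id \<alpha> (tensor_map 0 ?d id t)) = (\<lambda>t. (-1) powi p *\<^sub>R tensor_map 0 ?d id (tensor_map p id \<alpha> t))"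
  proof (rule tensor_eqI)
    note L = linear_simps[OF T] linear_simps[OF linear_tensor_map_id[OF lin(3)]]
    show "linear (\<lambda>t. tensor_map p id \<alpha> (tensor_map 0 ?d id t))"
      "linear (\<lambda>t. (-1) powi p *\<^sub>R tensor_map 0 ?d id (tensor_map p id \<alpha> t))"
      by (simp_all add: linear_iff L scaleR_add_right scaleR_left_commute)
    fix k and x w :: "'g shift sym" assume x: "x \<in> gr k"
    note dx = Hom_gr[OF coderivation_Hom[OF lam] x refl]
    show "tensor_map p id \<alpha> (tensor_map 0 ?d id (x \<otimes> w)) = (-1) powi p *\<^sub>R tensor_map 0 ?d id (tensor_map p id \<alpha> (x \<otimes> w))"
      by (simp add: tensor_map_id_pure[OF lin(3) x] tensor_map_pure_id[OF lin(1) x] tensor_map_pure_id[OF lin(1) dx] L)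
        (auto simp: sgn_powi)
  qed
  have 3: "(\<lambda>t :: 'g shift sym \<otimes> 'g shift sym. tensor_map p id \<alpha> (tensor_map 1 id ?d t)) = (\<lambda>t. tensor_map (p + 1) id \<gamma> t)"
  proof (rule tensor_eqI)
    note L = linear_simps[OF T] linear_simps[OF linear_tensor_map_id'[OF lin(3)]]
    show "linear (\<lambda>t. tensor_map p id \<alpha> (tensor_map 1 id ?d t))" "linear (\<lambda>t. tensor_map (p + 1) id \<gamma> t)"
      using linear_tensor_map_id'[OF \<gamma>, of "p + 1"] by (simp_all add: linear_iff L)
    fix k and x w :: "'g shift sym" assume x: "x \<in> gr k"
    show "tensor_map p id \<alpha> (tensor_map 1 id ?d (x \<otimes> w)) = tensor_map (p + 1) id \<gamma> (x \<otimes> w)"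
      unfolding tensor_map_pure_id[OF \<gamma> x]
      by (simp add: tensor_map_pure_id[OF lin(3) x] tensor_map_pure_id[OF lin(1) x] L \<gamma>_def)
        (auto simp: sgn_powi)
  qed
  have 4: "(\<lambda>t :: 'g shift sym \<otimes> 'g shift sym. tensor_map (p + 1) id \<beta> t) =
      (\<lambda>t. tensor_map 1 id rho (tensor_map p id (tensor_map p id \<alpha>) (tensor_map 0 id coprod t)))"
  proof (rule tensor_eqI)
    note L = linear_simps[OF linear_tensor_map_id'[OF T]] linear_simps[OF linear_tensor_map_id'[OF lin(2)]]
      linear_simps[OF linear_tensor_map_id'[OF linear_coprod]]
    show "linear (\<lambda>t. tensor_map (p + 1) id \<beta> t)"
      "linear (\<lambda>t. tensor_map 1 id rho (tensor_map p id (tensor_map p id \<alpha>) (tensor_map 0 id coprod t)))"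
      using linear_tensor_map_id'[OF \<beta>, of "p + 1"] by (simp_all add: linear_iff L)
    fix k and x w :: "'g shift sym" assume x: "x \<in> gr k"
    show "tensor_map (p + 1) id \<beta> (x \<otimes> w) =
        tensor_map 1 id rho (tensor_map p id (tensor_map p id \<alpha>) (tensor_map 0 id coprod (x \<otimes> w)))"
      unfolding tensor_map_pure_id[OF \<beta> x]
      by (simp add: tensor_map_pure_id[OF linear_coprod x] tensor_map_pure_id[OF T x] tensor_map_pure_id[OF lin(2) x] L \<beta>_def)
        (auto simp: sgn_powi)
  qed
  let ?t = "coprod x"
  have "rho (tensor_map (p + 1) id ?D ?t) =
      rho (tensor_map 1 id rho (assoc (tensor_map 0 coprod id (tensor_map p id \<alpha> ?t)))) -
      (-1) powi p *\<^sub>R rho (tensor_map (p + 1) id \<gamma> ?t)"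
    using fun_cong[OF 1, of ?t] fun_cong[OF 4, of ?t]
    by (simp add: rlin coprod_coassoc[symmetric] tensor_map_coassoc[OF lin(1)])
  moreover have "?D (?d x) =
      (-1) powi p *\<^sub>R rho (tensor_map 0 ?d id (tensor_map p id \<alpha> ?t)) + rho (tensor_map (p + 1) id \<gamma> ?t)"
    using fun_cong[OF 2, of ?t] fun_cong[OF 3, of ?t]
    by (simp add: ruth_differential_apply dd linear_0[OF lin(1)] coprod_coderivation[OF lam] linear_simps[OF T] rlin)
  moreover have "rho (tensor_map 1 id rho (assoc (tensor_map 0 coprod id (tensor_map p id \<alpha> ?t)))) =
      - rho (tensor_map 0 ?d id (tensor_map p id \<alpha> ?t))"
    using rr[of "tensor_map p id \<alpha> ?t"] by (simp add: eq_neg_iff_add_eq_0 add.commute)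
  ultimately show "ruth_differential lam rho (p + 1) ?D x = 0 x"
    by (subst ruth_differential_apply) (auto simp: sgn_powi)
qed

lemma cochain_complex_ruth:
  fixes lam :: "'g::graded_vector shift sym \<Rightarrow> 'g shift"
  assumes "L_infinity_algebra lam" "ruth lam rho"
  shows "cochain_complex ruth_cochains (ruth_differential lam rho)"
proof -
  have lam: "lam \<in> Hom 1" "\<And>x. coderivation lam (coderivation lam x) = 0" and rho: "rho \<in> Hom 1"
    using assms by (auto simp: L_infinity_algebra_def ruth_def)
  have tadd: "tensor_map p id (\<alpha> + \<beta>) t = tensor_map p id \<alpha> t + tensor_map p id \<beta> t"
    and tscale: "tensor_map p id (c *\<^sub>R \<alpha>) t = c *\<^sub>R tensor_map p id \<alpha> t"
    if "linear \<alpha>" "linear \<beta>" for p c \<alpha> \<beta> and t :: "'g shift sym \<otimes> 'g shift sym"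
  proof -
    have s: "linear (\<alpha> + \<beta>)" "linear (c *\<^sub>R \<alpha>)"
      using linear_compose_add[OF that] linear_compose_scale_right[OF that(1)]
      by (simp_all add: plus_fun_def scaleR_fun_def)
    note L = linear_tensor_map_id'[OF that(1)] linear_tensor_map_id'[OF that(2)]
    have "tensor_map p id (\<alpha> + \<beta>) = (\<lambda>t :: 'g shift sym \<otimes> 'g shift sym. tensor_map p id \<alpha> t + tensor_map p id \<beta> t)"
      by (rule tensor_eqI[OF linear_tensor_map_id'[OF s(1)] linear_compose_add[OF L]])
        (simp add: tensor_map_pure_id[OF s(1)] tensor_map_pure_id[OF that(1)] tensor_map_pure_id[OF that(2)]
          tensor_pure_simps scaleR_add_right)
    moreover have "tensor_map p id (c *\<^sub>R \<alpha>) = (\<lambda>t :: 'g shift sym \<otimes> 'g shift sym. c *\<^sub>R tensor_map p id \<alpha> t)"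
      by (rule tensor_eqI[OF linear_tensor_map_id'[OF s(2)] linear_compose_scale_right[OF L(1)]])
        (simp add: tensor_map_pure_id[OF s(2)] tensor_map_pure_id[OF that(1)] tensor_pure_simps
          scaleR_fun_apply mult.commute)
    ultimately show
      "tensor_map p id (\<alpha> + \<beta>) t = tensor_map p id \<alpha> t + tensor_map p id \<beta> t"
      "tensor_map p id (c *\<^sub>R \<alpha>) t = c *\<^sub>R tensor_map p id \<alpha> t" by simp_all
  qed
  note rlin = linear_simps[OF Hom_linear[OF rho]]
  show ?thesis
    unfolding cochain_complex_def ruth_cochains_def
  proof (intro allI conjI subspace_Hom ballI)
    fix p
    show "linear_map_on (Hom p) (ruth_differential lam rho p)"
      unfolding linear_map_on_def
      by (auto simp: fun_eq_iff ruth_differential_apply tadd[OF Hom_linear Hom_linear] tscale[OF Hom_linear Hom_linear]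
          rlin scaleR_fun_apply algebra_simps scaleR_diff_right)
    show "ruth_differential lam rho p ` Hom p \<subseteq> Hom (p + 1)"
      using ruth_differential_Hom[OF lam(1) rho] by blast
    show "ruth_differential lam rho (p + 1) (ruth_differential lam rho p \<alpha>) = 0" if "\<alpha> \<in> Hom p" for \<alpha>
      by (rule ruth_differential_square[OF lam assms(2) that])
  qed
qed

text \<open>Comultiplicativity brings F \<otimes> F behind the coproduct. Its right tensor factor is
  absorbed into \<alpha> \<circ> F, the left one stands in front of \<open>rho'\<close>, where the
  morphism equation trades it for \<open>f\<close> on the module side.\<close>

lemma cochain_map_ruth_pullback:
  fixes rho :: "'g::graded_vector shift sym \<otimes> 'v::graded_vector \<Rightarrow> 'v"
    and rho' :: "'h::graded_vector shift sym \<otimes> 'w::graded_vector \<Rightarrow> 'w"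
  assumes lam: "L_infinity_algebra lam" "ruth lam rho" and lam': "L_infinity_algebra lam'" "ruth lam' rho'"
    and Ff: "ruth_morphism lam rho lam' rho' F f"
  shows "cochain_map ruth_cochains (ruth_differential lam' rho') ruth_cochains (ruth_differential lam rho)
    (ruth_pullback F f)"
proof -
  have F: "F \<in> Hom 0" and f: "f \<in> Hom 0"
    and comult: "\<And>x. coprod (F x) = tensor_map 0 F F (coprod x)"
    and dF: "\<And>x. F (coderivation lam x) = coderivation lam' (F x)"
    and Ff: "\<And>t. f (rho' (tensor_map 0 F id t)) = rho (tensor_map 0 id f t)"
    using Ff unfolding ruth_morphism_def L_infinity_morphism_def by (auto simp: fun_eq_iff)
  note flin = Hom_linear[OF f] and Flin = Hom_linear[OF F]
  show ?thesis
    unfolding cochain_map_def ruth_cochains_def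
  proof (intro allI conjI ballI)
    fix p
    show "linear_map_on (Hom p) (ruth_pullback F f)"
      by (auto simp: linear_map_on_def ruth_pullback_def fun_eq_iff linear_simps[OF flin] scaleR_fun_def)
    show "ruth_pullback F f ` Hom p \<subseteq> Hom p"
      unfolding ruth_pullback_def using Hom_comp[OF F Hom_comp[OF _ f]] by (auto simp: comp_assoc)
    fix \<alpha> :: "'h shift sym \<Rightarrow> 'w" assume \<alpha>: "\<alpha> \<in> Hom p"
    note \<alpha>lin = Hom_linear[OF \<alpha>] and \<alpha>Flin = linear_compose[OF Flin Hom_linear[OF \<alpha>]]
    have fFlin: "linear (f \<circ> \<alpha> \<circ> F)"
      using linear_compose[OF \<alpha>Flin flin] by (simp add: comp_assoc)
    have 1: "(\<lambda>t. tensor_map p id \<alpha> (tensor_map 0 F F t)) = (\<lambda>t. tensor_map 0 F id (tensor_map p id (\<alpha> \<circ> F) t))"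
    proof (rule tensor_eqI)
      note L = linear_simps[OF linear_tensor_map_id'[OF \<alpha>lin]] linear_simps[OF linear_tensor_map[OF Flin Flin]]
        linear_simps[OF linear_tensor_map_id[OF Flin]] linear_simps[OF linear_tensor_map_id'[OF \<alpha>Flin]]
      show "linear (\<lambda>t. tensor_map p id \<alpha> (tensor_map 0 F F t))"
        "linear (\<lambda>t. tensor_map 0 F id (tensor_map p id (\<alpha> \<circ> F) t))"
        by (simp_all add: linear_iff L)
      fix k and x :: "'g shift sym" and z :: "'g shift sym" assume x: "x \<in> gr k"
      have Fx: "F x \<in> gr k" using Hom_gr[OF F x] by simp
      show "tensor_map p id \<alpha> (tensor_map 0 F F (x \<otimes> z)) = tensor_map 0 F id (tensor_map p id (\<alpha> \<circ> F) (x \<otimes> z))"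
        unfolding tensor_map_pure_id[OF \<alpha>Flin x]
        by (simp add: tensor_map_pure[OF Flin Flin x] tensor_map_pure_id[OF \<alpha>lin Fx] L tensor_map_id_pure[OF Flin x])
    qed
    have 2: "(\<lambda>t :: 'g shift sym \<otimes> 'g shift sym. tensor_map 0 id f (tensor_map p id (\<alpha> \<circ> F) t)) = (\<lambda>t. tensor_map p id (f \<circ> \<alpha> \<circ> F) t)"
    proof (rule tensor_eqI)
      note L = linear_simps[OF linear_tensor_map_id'[OF flin]] linear_simps[OF linear_tensor_map_id'[OF \<alpha>Flin]]
        linear_simps[OF linear_tensor_map_id'[OF fFlin]]
      show "linear (\<lambda>t. tensor_map 0 id f (tensor_map p id (\<alpha> \<circ> F) t))" "linear (\<lambda>t. tensor_map p id (f \<circ> \<alpha> \<circ> F) t)"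
        by (simp_all add: linear_iff L)
      fix k and x :: "'g shift sym" and z :: "'g shift sym" assume x: "x \<in> gr k"
      show "tensor_map 0 id f (tensor_map p id (\<alpha> \<circ> F) (x \<otimes> z)) = tensor_map p id (f \<circ> \<alpha> \<circ> F) (x \<otimes> z)"
        unfolding tensor_map_pure_id[OF \<alpha>Flin x] tensor_map_pure_id[OF fFlin x]
        by (simp add: L tensor_map_pure_id[OF flin x])
    qed
    show "ruth_pullback F f (ruth_differential lam' rho' p \<alpha>) = ruth_differential lam rho p (ruth_pullback F f \<alpha>)"
    proof
      fix x
      show "ruth_pullback F f (ruth_differential lam' rho' p \<alpha>) x = ruth_differential lam rho p (ruth_pullback F f \<alpha>) x"
        using fun_cong[OF 1, of "coprod x"] fun_cong[OF 2, of "coprod x"]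
        by (simp add: ruth_pullback_def ruth_differential_apply comult dF[symmetric] linear_diff[OF flin]
            linear_scale[OF flin] Ff)
    qed
  qed
qed

subsection \<open>Leading terms with respect to the length filtration\<close>

definition cochain_fil :: "nat \<Rightarrow> ('a::graded_vector sym \<Rightarrow> 'b::real_vector) set" where
  "cochain_fil n = {\<alpha>. \<forall>x\<in>sym_len n. \<alpha> x = 0}"

lemma subspace_cochain_fil: "subspace (cochain_fil n)"
  by (auto simp: subspace_def cochain_fil_def scaleR_fun_def)

text \<open>On \<open>sym_len M\<close> all \<open>x i\<close> with \<open>i \<ge> M\<close> vanish,
  so the series is finite at each argument.\<close>

lemma cochain_fil_complete:
  assumes x: "\<And>i. x i \<in> Hom p \<inter> cochain_fil i"
  shows "\<exists>s\<in>Hom p. \<forall>n. s - (\<Sum>i<n. x i) \<in> cochain_fil n"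
proof -
  have xl: "linear (x i)" for i using x Hom_linear by blast
  \<comment> \<open>\<open>LEAST\<close> fixes the number of summands for each argument; any larger
    bound gives the same value, so a common bound for two arguments proves additivity.\<close>
  define s where "s y = (\<Sum>i<(LEAST n. y \<in> sym_len n). x i y)" for y
  have s: "s y = (\<Sum>i<M. x i y)" if y: "y \<in> sym_len M" for y M
    unfolding s_def
  proof (rule sum.mono_neutral_left)
    let ?N = "LEAST n. y \<in> sym_len n"
    have N: "y \<in> sym_len ?N" by (rule LeastI[of "\<lambda>n. y \<in> sym_len n", OF y])
    show "\<forall>i\<in>{..<M} - {..<?N}. x i y = 0"
    proof
      fix i assume "i \<in> {..<M} - {..<?N}"
      then have "?N \<le> i" by (simp only: Diff_iff lessThan_iff not_less)
      then have "y \<in> sym_len i" using N by (rule sym_len_mono)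
      then show "x i y = 0" using x[of i] by (simp add: cochain_fil_def)
    qed
    show "{..<?N} \<subseteq> {..<M}"
      by (simp only: lessThan_subset_iff Least_le[of "\<lambda>n. y \<in> sym_len n", OF y])
  qed simp
  have "linear s"
  proof (rule linearI)
    fix y z :: "'a sym" and c :: real
    obtain m n where mn: "y \<in> sym_len m" "z \<in> sym_len n" using ex_sym_len by metis
    let ?M = "max m n"
    have y: "y \<in> sym_len ?M" and z: "z \<in> sym_len ?M"
      using mn sym_len_mono[of m ?M] sym_len_mono[of n ?M] by simp_all
    show "s (y + z) = s y + s z" "s (c *\<^sub>R y) = c *\<^sub>R s y"
      by (simp_all add: s[OF y] s[OF z] s[OF subspace_add[OF subspace_sym_len y z]]
          s[OF subspace_scale[OF subspace_sym_len y]] linear_simps[OF xl] sum.distrib scaleR_sum_right)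
  qed
  moreover have "s y \<in> gr (n + p)" if "y \<in> gr n" for n y
    unfolding s_def by (rule subspace_sum[OF subspace_gr]) (use x Hom_gr[OF _ that refl] in blast)
  ultimately have "s \<in> Hom p" by (rule HomI)
  moreover have "s - (\<Sum>i<n. x i) \<in> cochain_fil n" for n
  proof -
    have "(\<Sum>i<n. x i) y = (\<Sum>i<n. x i y)" for y by (induction n) auto
    then show ?thesis by (simp add: cochain_fil_def s)
  qed
  ultimately show ?thesis by blast
qed

text \<open>Unless the left tensor factor is empty, the right one is a word of length below
  \<open>n\<close>, on which \<alpha> vanishes. Only 1 \<otimes> vs survives, which the counit picks
  out linearly.\<close>

lemma tensor_map_coprod_leading_term:
  fixes \<alpha> :: "'a::graded_vector sym \<Rightarrow> 'b::real_vector"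
  assumes \<alpha>: "linear \<alpha>" "\<alpha> \<in> cochain_fil n" and vs: "homogeneous ds vs" "length vs \<le> n"
  shows "tensor_map p id \<alpha> (coprod (word vs)) = sym_one \<otimes> \<alpha> (word vs)"
proof -
  have lin: "linear (\<lambda>t. sym_one \<otimes> \<alpha> (counit_left t))"
    using linear_compose[OF linear_compose[OF linear_counit_left \<alpha>(1)] linear_bilin(2)[OF tensor_pure_bilin]]
    by (simp add: o_def)
  have "tensor_map p id \<alpha> (coprod (word vs)) = sym_one \<otimes> \<alpha> (counit_left (coprod (word vs)))"
  proof (rule linear_eq_on_span[OF linear_tensor_map_id'[OF \<alpha>(1)] lin _ coprod_tensor_len[OF vs(1), unfolded tensor_len_def]])
    fix t :: "'a sym \<otimes> 'a sym"
    assume "t \<in> {word xs \<otimes> word ys | xs ys ds es.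
      homogeneous ds xs \<and> homogeneous es ys \<and> length xs + length ys = length vs}"
    then obtain xs ys ds es where t: "t = word xs \<otimes> word ys" and xs: "homogeneous ds xs"
      and ys: "homogeneous es ys" and len: "length xs + length ys = length vs" by blast
    show "tensor_map p id \<alpha> t = sym_one \<otimes> \<alpha> (counit_left t)"
    proof (cases xs)
      case Nil
      then have "t = sym_one \<otimes> word ys" by (simp add: t sym_one_def)
      then show ?thesis by (simp add: tensor_map_pure_id[OF \<alpha>(1) sym_one_gr] counit_one)
    next
      case (Cons v us)
      then have "word ys \<in> sym_len n" using len vs(2) by (intro word_sym_len[OF ys]) simp
      then have "\<alpha> (word ys) = 0" using \<alpha>(2) by (simp add: cochain_fil_def)
      moreover have "counit (word xs) = 0" using counit_cons[of v "word us"] Cons by simp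
      ultimately show ?thesis
        unfolding t tensor_map_pure_id[OF \<alpha>(1) word_gr[OF xs]]
        by (simp add: tensor_pure_simps linear_0[OF \<alpha>(1)])
    qed
  qed
  then show ?thesis by (simp add: counit_left_coprod)
qed

text \<open>The differential of the internal Hom complex from \<open>(X, d)\<close> to
  \<open>(Y, e)\<close>, in degree \<open>p\<close>.\<close>

definition hom_diff ::
    "('a::real_vector \<Rightarrow> 'a) \<Rightarrow> ('b::real_vector \<Rightarrow> 'b) \<Rightarrow> int \<Rightarrow> ('a \<Rightarrow> 'b) \<Rightarrow> 'a \<Rightarrow> 'b" where
  "hom_diff d e p \<alpha> x = e (\<alpha> x) - (-1) powi p *\<^sub>R \<alpha> (d x)"

text \<open>On words of length at most \<open>n\<close>, the coderivation differs from the
  derivation by words shorter than \<open>n\<close>, which \<alpha> kills, and \<open>rho\<close>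
  receives only 1 \<otimes> \<alpha>(x).\<close>

lemma ruth_differential_leading_term:
  assumes lam: "lam \<in> Hom 1" "lam sym_one = 0" and rho: "rho \<in> Hom 1"
    and \<alpha>: "\<alpha> \<in> Hom p" "\<alpha> \<in> cochain_fil n" and x: "x \<in> sym_len (Suc n)"
  shows "ruth_differential lam rho p \<alpha> x =
    hom_diff (sym_der 1 (lam \<circ> sym_incl)) (ruth_underlying_differential rho) p \<alpha> x"
proof -
  have l: "lam \<circ> sym_incl \<in> Hom 1" using Hom_comp[OF sym_incl_Hom lam(1)] by simp
  note \<alpha>lin = Hom_linear[OF \<alpha>(1)] and rlin = Hom_linear[OF rho]
  let ?D = "ruth_differential lam rho p \<alpha>"
  let ?E = "hom_diff (sym_der 1 (lam \<circ> sym_incl)) (ruth_underlying_differential rho) p \<alpha>"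
  have Dlin: "linear ?D" by (rule Hom_linear[OF ruth_differential_Hom[OF lam(1) rho \<alpha>(1)]])
  have D0lin: "linear ?E"
  proof -
    have "linear (\<lambda>x. rho (sym_one \<otimes> \<alpha> x))"
      using linear_compose[OF \<alpha>lin linear_compose[OF linear_bilin(2)[OF tensor_pure_bilin] rlin]]
      by (simp add: o_def)
    moreover have "linear (\<lambda>x. (-1) powi p *\<^sub>R \<alpha> (sym_der 1 (lam \<circ> sym_incl) x))"
      using linear_compose_scale_right[OF linear_compose[OF linear_sym_der[OF l] \<alpha>lin], of "(-1) powi p"]
      by (simp add: o_def)
    ultimately show ?thesis
      unfolding hom_diff_def[abs_def] ruth_underlying_differential_def by (rule linear_compose_sub)
  qed
  show ?thesis
  proof (rule linear_eq_on_span[OF Dlin D0lin _ x[unfolded sym_len_def]])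
    fix y :: "'a shift sym" assume "y \<in> {word vs | vs ds. homogeneous ds vs \<and> length vs < Suc n}"
    then obtain vs ds where y: "y = word vs" and vs: "homogeneous ds vs" "length vs \<le> n" by auto
    have "coderivation lam y - sym_der 1 (lam \<circ> sym_incl) y \<in> sym_len n"
      unfolding y by (rule sym_len_mono[OF vs(2) coderivation_leading_term[OF vs(1) lam]])
    then have "\<alpha> (coderivation lam y) = \<alpha> (sym_der 1 (lam \<circ> sym_incl) y)"
      using \<alpha>(2) linear_diff[OF \<alpha>lin] by (force simp: cochain_fil_def)
    then show "?D y = ?E y"
      using tensor_map_coprod_leading_term[OF \<alpha>lin \<alpha>(2) vs]
      by (simp add: ruth_differential_apply hom_diff_def ruth_underlying_differential_def y)
  qed
qed

lemma ruth_pullback_leading_term: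
  fixes F :: "'g::graded_vector shift sym \<Rightarrow> 'h::graded_vector shift sym"
  assumes F: "F \<in> Hom 0" "\<And>x. coprod (F x) = tensor_map 0 F F (coprod x)" "F sym_one = sym_one"
    and \<alpha>: "linear \<alpha>" "\<alpha> \<in> cochain_fil n" and x: "x \<in> sym_len (Suc n)"
  shows "\<alpha> (F x) = \<alpha> (sym_map (sym_proj \<circ> F \<circ> sym_incl) x)"
proof -
  have \<phi>: "sym_proj \<circ> F \<circ> sym_incl \<in> Hom 0"
    by (rule Hom_comp[OF sym_incl_Hom Hom_comp[OF F(1) sym_proj_Hom]]) simp_all
  show ?thesis
  proof (rule linear_eq_on_span[OF _ _ _ x[unfolded sym_len_def],
        where f = "\<lambda>x. \<alpha> (F x)" and g = "\<lambda>x. \<alpha> (sym_map (sym_proj \<circ> F \<circ> sym_incl) x)"])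
    show "linear (\<lambda>x. \<alpha> (F x))" "linear (\<lambda>x. \<alpha> (sym_map (sym_proj \<circ> F \<circ> sym_incl) x))"
      using linear_compose[OF Hom_linear[OF F(1)] \<alpha>(1)] linear_compose[OF linear_sym_map[OF \<phi>] \<alpha>(1)]
      by (simp_all add: o_def)
    fix y :: "'g shift sym" assume "y \<in> {word vs | vs ds. homogeneous ds vs \<and> length vs < Suc n}"
    then obtain vs ds where y: "y = word vs" and vs: "homogeneous ds vs" "length vs \<le> n" by auto
    have "F y - sym_map (sym_proj \<circ> F \<circ> sym_incl) y \<in> sym_len n"
      unfolding y by (rule sym_len_mono[OF vs(2) coalgebra_morphism_leading_term[OF F vs(1)]])
    then show "\<alpha> (F y) = \<alpha> (sym_map (sym_proj \<circ> F \<circ> sym_incl) y)"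
      using \<alpha>(2) linear_diff[OF \<alpha>(1)] by (force simp: cochain_fil_def)
  qed
qed

section \<open>The associated graded complexes\<close>

text \<open>The usual homotopy for a tensor product of two contractions, written for Hom: contract
  the target by \<open>h\<close>, and on the part retained by the projection \<open>q\<close>
  contract the source by \<open>k\<close>. The sign comes from moving \<open>k\<close> past
  \<alpha>.\<close>

definition hom_htp ::
    "('b::real_vector \<Rightarrow> 'b) \<Rightarrow> ('a::real_vector \<Rightarrow> 'a) \<Rightarrow> ('b \<Rightarrow> 'b) \<Rightarrow> int \<Rightarrow> ('a \<Rightarrow> 'b) \<Rightarrow> 'a \<Rightarrow> 'b" where
  "hom_htp h k q p \<alpha> x = h (\<alpha> x) + (-1) powi p *\<^sub>R q (\<alpha> (k x))"

text \<open>Terms joining a differential of Y to the second summand vanish because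
  \<open>dY pY = 0 = pY dY\<close>; those joining \<open>hY\<close> to \<open>dX\<close> cancel by
  the sign of the degree.\<close>

lemma hom_homotopy:
  assumes cX: "contraction dX pX kX" and cY: "contraction dY pY hY" and \<alpha>: "linear \<alpha>"
  shows "\<alpha> x = pY (\<alpha> (pX x)) + hom_diff dX dY (p - 1) (hom_htp hY kX pY p \<alpha>) x +
    hom_htp hY kX pY (p + 1) (hom_diff dX dY p \<alpha>) x"
proof -
  have X: "dX \<in> Hom 1" "pX x = x - dX (kX x) - kX (dX x)"
    using cX unfolding contraction_def by blast+
  have Y: "dY \<in> Hom 1" "pY \<in> Hom 0" "hY \<in> Hom (-1)" and dp: "\<And>y. dY (pY y) = 0" "\<And>y. pY (dY y) = 0"
    and hom: "\<And>y. pY y = y - dY (hY y) - hY (dY y)"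
    using cY unfolding contraction_def by blast+
  note lin = Y[THEN Hom_linear] \<alpha>
  note L = lin[THEN linear_add] lin[THEN linear_diff] lin[THEN linear_scale]
  have 1: "pY (\<alpha> (pX x)) = pY (\<alpha> x) - pY (\<alpha> (dX (kX x))) - pY (\<alpha> (kX (dX x)))"
    by (simp add: X(2) L)
  show ?thesis
    unfolding hom_diff_def hom_htp_def 1 hom[of "\<alpha> x"]
    by (simp add: L dp) (auto simp: sgn_powi)
qed

text \<open>
  The complexes of homogeneous maps \<open>X \<Rightarrow> Y\<close> and \<open>X' \<Rightarrow> Y'\<close> are compared by \<open>\<alpha> \<mapsto> f \<circ> \<alpha> \<circ> s\<close>, and
  \<open>s\<close> and \<open>f\<close> have the inverses up to homotopy \<open>t\<close> and \<open>g\<close>. The sets \<open>L\<close> and \<open>L'\<close> allow to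
  calculate modulo maps that vanish on them.
\<close>

locale hom_comparison =
  fixes dX pX kX :: "'x::graded_vector \<Rightarrow> 'x" and dX' pX' kX' :: "'x1::graded_vector \<Rightarrow> 'x1"
    and dY pY hY :: "'y::graded_vector \<Rightarrow> 'y" and dY' pY' hY' :: "'y1::graded_vector \<Rightarrow> 'y1"
    and s :: "'x \<Rightarrow> 'x1" and t :: "'x1 \<Rightarrow> 'x" and f :: "'y1 \<Rightarrow> 'y" and g :: "'y \<Rightarrow> 'y1"
    and L :: "'x set" and L' :: "'x1 set"
  assumes cX: "contraction dX pX kX" and cX': "contraction dX' pX' kX'"
    and cY: "contraction dY pY hY" and cY': "contraction dY' pY' hY'"
    and st: "linear s" "linear t" "\<And>x. s (dX x) = dX' (s x)" "\<And>x. dX (t x) = 0" "\<And>x. t (dX' x) = 0"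
      "\<And>x. t (s (pX x)) = pX x" "\<And>x. pX' (s (t x)) = pX' x"
    and fg: "linear f" "linear g" "\<And>y. f (dY' y) = dY (f y)" "\<And>y. g (dY y) = 0" "\<And>y. dY' (g y) = 0"
      "\<And>y. g (f (pY' y)) = pY' y" "\<And>y. pY (f (g y)) = pY y"
    and L: "\<And>x. x \<in> L \<Longrightarrow> s x \<in> L'" "\<And>x. x \<in> L' \<Longrightarrow> t x \<in> L"
      "\<And>x. x \<in> L \<Longrightarrow> kX x \<in> L" "\<And>x. x \<in> L' \<Longrightarrow> kX' x \<in> L'"
begin

lemma lin: "linear dX" "linear pX" "linear kX" "linear dX'" "linear pX'" "linear kX'"
    "linear dY" "linear pY" "linear hY" "linear dY'" "linear pY'" "linear hY'"
proof -
  have *: "linear d \<and> linear p \<and> linear h" if "contraction d p h" for d p h :: "'a::graded_vector \<Rightarrow> 'a"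
    using that Hom_linear unfolding contraction_def by blast
  show "linear dX" "linear pX" "linear kX" "linear dX'" "linear pX'" "linear kX'"
    "linear dY" "linear pY" "linear hY" "linear dY'" "linear pY'" "linear hY'"
    using *[OF cX] *[OF cX'] *[OF cY] *[OF cY'] by blast+
qed

lemmas zero = lin[THEN linear_0] st(1,2)[THEN linear_0] fg(1,2)[THEN linear_0]

text \<open>Up to a boundary, \<open>a\<close> equals \<open>pY' a pX'\<close>. Inserting
  \<open>s t\<close> before \<open>pX'\<close> and \<open>g f\<close> after \<open>pY'\<close>
  expresses this through the pulled back cochain \<open>f a s\<close>. The latter is a coboundary,
  and coboundaries die under \<open>g\<close> and \<open>t\<close> since \<open>g dY = 0\<close> and
  \<open>dX t = 0\<close>.\<close>

lemma injective:
  assumes a: "linear a" and b: "linear b"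
    and cocycle: "\<And>x. x \<in> L' \<Longrightarrow> hom_diff dX' dY' p a x = 0"
    and cobound: "\<And>x. x \<in> L \<Longrightarrow> f (a (s x)) = hom_diff dX dY (p - 1) b x"
    and x: "x \<in> L'"
  shows "a x = hom_diff dX' dY' (p - 1) (hom_htp hY' kX' pY' p a) x"
proof -
  let ?u = "hom_htp hY' kX' pY' p a"
  let ?D = "hom_diff dX' dY' (p - 1) ?u"
  have htp: "a y = pY' (a (pX' y)) + ?D y" if "y \<in> L'" for y
    using hom_homotopy[OF cX' cY' a, of y p] cocycle[OF that] cocycle[OF L(4)[OF that]]
    by (simp add: hom_htp_def[of _ _ _ "p + 1"] zero)
  have "?u 0 = 0" by (simp add: hom_htp_def zero linear_0[OF a])
  moreover have "dX' (s (t x)) = 0" by (simp add: st(3)[symmetric] st(4) zero)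
  ultimately have gfD: "g (f (?D (s (t x)))) = 0"
    by (simp add: hom_diff_def fg(3,4) zero)
  have "pY' (a (pX' x)) = g (f (pY' (a (pX' (s (t x))))))"
    by (simp add: fg(6) st(7))
  also have "pY' (a (pX' (s (t x)))) = a (s (t x)) - ?D (s (t x))"
    using htp[OF L(1)[OF L(2)[OF x]]] by simp
  also have "g (f (a (s (t x)) - ?D (s (t x)))) = g (hom_diff dX dY (p - 1) b (t x))"
    by (simp add: linear_diff[OF fg(1)] linear_diff[OF fg(2)] gfD cobound[OF L(2)[OF x]])
  also have "\<dots> = 0"
    by (simp add: hom_diff_def st(4) fg(4) linear_0[OF b])
  finally show ?thesis using htp[OF x] by simp
qed

text \<open>\<open>g c t\<close> is a cocycle because differentials vanish next to \<open>g\<close>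
  and \<open>t\<close>. The error \<open>c - f g c t s\<close> is again a cocycle on
  \<open>L\<close>, and sandwiched between \<open>pY\<close> and \<open>pX\<close> it is zero, so
  the homotopy formula displays it as a coboundary.\<close>

lemma surjective:
  assumes c: "linear c" and cocycle: "\<And>x. x \<in> L \<Longrightarrow> hom_diff dX dY p c x = 0"
  shows "hom_diff dX' dY' p (\<lambda>x. g (c (t x))) y = 0"
    and "x \<in> L \<Longrightarrow> c x - f (g (c (t (s x)))) =
      hom_diff dX dY (p - 1) (hom_htp hY kX pY p (\<lambda>x. c x - f (g (c (t (s x)))))) x"
proof -
  show "hom_diff dX' dY' p (\<lambda>x. g (c (t x))) y = 0"
    by (simp add: hom_diff_def fg(5) st(5) zero linear_0[OF c])
  assume x: "x \<in> L"
  define e where "e x = c x - f (g (c (t (s x))))" for x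
  have e: "linear e"
    unfolding e_def[abs_def] using linear_compose[OF linear_compose[OF linear_compose[OF linear_compose[OF st(1,2)] c] fg(2)] fg(1)]
    by (intro linear_compose_sub c) (simp add: o_def)
  have De: "hom_diff dX dY p e y = 0" if "y \<in> L" for y
  proof -
    have "hom_diff dX dY p e y = hom_diff dX dY p c y"
      by (simp add: hom_diff_def e_def linear_diff[OF lin(7)] fg(3)[symmetric] fg(5) st(3,5) zero linear_0[OF c])
    then show ?thesis using cocycle[OF that] by simp
  qed
  have "pY (e (pX x)) = 0"
    by (simp add: e_def linear_diff[OF lin(8)] st(6) fg(7))
  then have "e x = hom_diff dX dY (p - 1) (hom_htp hY kX pY p e) x"
    using hom_homotopy[OF cX cY e, of x p] De[OF x] De[OF L(3)[OF x]]
    by (simp add: hom_htp_def[of _ _ _ "p + 1"] zero)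
  then show "c x - f (g (c (t (s x)))) = hom_diff dX dY (p - 1) (hom_htp hY kX pY p (\<lambda>x. c x - f (g (c (t (s x)))))) x"
    by (simp add: e_def[abs_def])
qed

end

lemma hom_htp_Hom:
  assumes "h \<in> Hom (-1)" "k \<in> Hom (-1)" "q \<in> Hom 0" "\<alpha> \<in> Hom p"
  shows "hom_htp h k q p \<alpha> \<in> Hom (p - 1)"
proof -
  have "hom_htp h k q p \<alpha> = (h \<circ> \<alpha>) + (-1) powi p *\<^sub>R (q \<circ> (\<alpha> \<circ> k))"
    by (simp add: fun_eq_iff hom_htp_def scaleR_fun_apply)
  also have "\<dots> \<in> Hom (p - 1)"
    by (intro subspace_add[OF subspace_Hom] subspace_scale[OF subspace_Hom]
        Hom_comp[OF assms(4,1)] Hom_comp[OF Hom_comp[OF assms(2,4) refl] assms(3)]) auto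
  finally show ?thesis .
qed

lemma hom_htp_fil:
  assumes "linear h" "linear q" "\<And>x. x \<in> sym_len n \<Longrightarrow> k x \<in> sym_len n" "\<alpha> \<in> cochain_fil n"
  shows "hom_htp h k q p \<alpha> \<in> cochain_fil n"
  using assms by (auto simp: cochain_fil_def hom_htp_def linear_0)

theorem theorem3p27:
  fixes lam_g :: "'g::graded_vector shift sym \<Rightarrow> 'g shift"
    and lam_h :: "'h::graded_vector shift sym \<Rightarrow> 'h shift"
    and rho :: "'g shift sym \<otimes> 'v::graded_vector \<Rightarrow> 'v"
    and tau :: "'h shift sym \<otimes> 'w::graded_vector \<Rightarrow> 'w"
    and F :: "'g shift sym \<Rightarrow> 'h shift sym"
    and f :: "'w \<Rightarrow> 'v"
  assumes "L_infinity_algebra lam_g"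
    and "L_infinity_algebra lam_h"
    and "ruth lam_g rho"
    and "ruth lam_h tau"
    and "ruth_quasi_isomorphism lam_g rho lam_h tau F f"
  shows "quasi_isomorphism ruth_cochains (ruth_differential lam_h tau)
           ruth_cochains (ruth_differential lam_g rho) (ruth_pullback F f)"
proof -
  note cx_g = cochain_complex_ruth[OF assms(1,3)] and cx_h = cochain_complex_ruth[OF assms(2,4)]
  have morph: "ruth_morphism lam_g rho lam_h tau F f"
    and qF: "quasi_isomorphism gr (\<lambda>_. lam_g \<circ> sym_incl) gr (\<lambda>_. lam_h \<circ> sym_incl) (sym_proj \<circ> F \<circ> sym_incl)"
    and qf: "quasi_isomorphism gr (\<lambda>_. ruth_underlying_differential tau) gr (\<lambda>_. ruth_underlying_differential rho) f"
    using assms(5) unfolding ruth_quasi_isomorphism_def L_infinity_quasi_isomorphism_def by auto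
  note map = cochain_map_ruth_pullback[OF assms(1,3,2,4) morph]
  have F: "F \<in> Hom 0" "\<And>x. coprod (F x) = tensor_map 0 F F (coprod x)" "F sym_one = sym_one" and f: "f \<in> Hom 0"
    using morph unfolding ruth_morphism_def L_infinity_morphism_def by (auto simp: fun_eq_iff)
  have lam_g: "lam_g \<in> Hom 1" "lam_g sym_one = 0" and lam_h: "lam_h \<in> Hom 1" "lam_h sym_one = 0"
    and rho: "rho \<in> Hom 1" and tau: "tau \<in> Hom 1"
    using assms(1-4) by (auto simp: L_infinity_algebra_def ruth_def)
  define l l' \<phi> where "l = lam_g \<circ> sym_incl" and "l' = lam_h \<circ> sym_incl" and "\<phi> = sym_proj \<circ> F \<circ> sym_incl"
  define eV eW where "eV = ruth_underlying_differential rho" and "eW = ruth_underlying_differential tau"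
  note qF = qF[folded l_def l'_def \<phi>_def] and qf = qf[folded eV_def eW_def]
  have l: "l \<in> Hom 1" and l': "l' \<in> Hom 1" and \<phi>: "\<phi> \<in> Hom 0"
    unfolding l_def l'_def \<phi>_def
    using Hom_comp[OF sym_incl_Hom lam_g(1)] Hom_comp[OF sym_incl_Hom lam_h(1)]
      Hom_comp[OF sym_incl_Hom Hom_comp[OF F(1) sym_proj_Hom refl] refl] by (simp_all add: comp_assoc)
  have under: "ruth_underlying_differential r \<in> Hom 1" if r: "r \<in> Hom 1"
    for r :: "'a::graded_vector shift sym \<otimes> 'b::graded_vector \<Rightarrow> 'b"
  proof (rule HomI)
    show "linear (ruth_underlying_differential r)"
      using linear_compose[OF linear_bilin(2)[OF tensor_pure_bilin] Hom_linear[OF r]]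
      by (simp add: ruth_underlying_differential_def[abs_def] o_def)
    show "ruth_underlying_differential r v \<in> gr (n + 1)" if "v \<in> gr n" for n v
      unfolding ruth_underlying_differential_def
      by (rule Hom_gr[OF r tensor_gr[OF sym_one_gr that refl]]) simp
  qed
  have eV: "eV \<in> Hom 1" and eW: "eW \<in> Hom 1"
    unfolding eV_def eW_def by (rule under[OF rho] under[OF tau])+
  \<comment> \<open>\<open>cochain_complex\<close> speaks about homogeneous elements only; linearity
    spreads the identity over the whole space. The same applies to \<open>chain\<close>.\<close>
  have square: "d (d x) = 0" if "d \<in> Hom 1" "cochain_complex gr (\<lambda>_. d)"
    for d :: "'a::graded_vector \<Rightarrow> 'a" and x
  proof (rule linear_gr_eqI[where f = "\<lambda>x. d (d x)" and g = "\<lambda>_. 0" and x = x])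
    show "linear (\<lambda>x. d (d x))"
      using linear_compose[OF Hom_linear[OF that(1)] Hom_linear[OF that(1)]] by (simp add: o_def)
    show "linear (\<lambda>_ :: 'a. 0 :: 'a)" by (simp add: linear_iff)
    show "d (d x) = 0" if "x \<in> gr n" for n x
      using \<open>cochain_complex gr (\<lambda>_. d)\<close> that unfolding cochain_complex_def by blast
  qed
  have chain: "q (d x) = d' (q x)" if "q \<in> Hom 0" "d \<in> Hom 1" "d' \<in> Hom 1" "cochain_map gr (\<lambda>_. d) gr (\<lambda>_. d') q"
    for q :: "'a::graded_vector \<Rightarrow> 'b::graded_vector" and d d' x
  proof (rule linear_gr_eqI[where f = "\<lambda>x. q (d x)" and g = "\<lambda>x. d' (q x)" and x = x])
    note lin = that(1-3)[THEN Hom_linear]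
    show "linear (\<lambda>x. q (d x))" "linear (\<lambda>x. d' (q x))"
      using linear_compose[OF lin(2,1)] linear_compose[OF lin(1,3)] by (simp_all add: o_def)
    show "q (d x) = d' (q x)" if "x \<in> gr n" for n x
      using \<open>cochain_map gr (\<lambda>_. d) gr (\<lambda>_. d') q\<close> that unfolding cochain_map_def by blast
  qed
  have chain_\<phi>: "\<phi> (l x) = l' (\<phi> x)" for x
    by (rule chain[OF \<phi> l l']) (use qF in \<open>simp add: quasi_isomorphism_def\<close>)
  have chain_f: "f (eW y) = eV (f y)" for y
    by (rule chain[OF f eW eV]) (use qf in \<open>simp add: quasi_isomorphism_def\<close>)
  obtain p h where c: "contraction l p h"
    using ex_contraction[OF l square[OF l]] qF unfolding quasi_isomorphism_def by blast
  obtain p' h' where c': "contraction l' p' h'"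
    using ex_contraction[OF l' square[OF l']] qF unfolding quasi_isomorphism_def by blast
  obtain pV hV where cV: "contraction eV pV hV"
    using ex_contraction[OF eV square[OF eV]] qf unfolding quasi_isomorphism_def by blast
  obtain pW hW where cW: "contraction eW pW hW"
    using ex_contraction[OF eW square[OF eW]] qf unfolding quasi_isomorphism_def by blast
  obtain \<theta> where \<theta>: "\<theta> \<in> Hom 0" "\<And>x. \<theta> (\<phi> (p x)) = p x" "\<And>y. p' (\<phi> (\<theta> y)) = p' y"
      "\<And>y. l (\<theta> y) = 0" "\<And>y. \<theta> (l' y) = 0"
    using contraction_inverse[OF c c' \<phi> qF] by blast
  \<comment> \<open>\<open>f\<close> runs from W to V, so W takes the role of the source here and
    \<open>g\<close> runs from V to W.\<close>
  obtain g where g: "g \<in> Hom 0" "\<And>x. g (f (pW x)) = pW x" "\<And>y. pV (f (g y)) = pV y"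
      "\<And>y. eW (g y) = 0" "\<And>y. g (eV y) = 0"
    using contraction_inverse[OF cW cV f qf] by blast
  have ph: "p \<in> Hom 0" "h \<in> Hom (-1)" "p' \<in> Hom 0" "h' \<in> Hom (-1)"
    and VW: "pV \<in> Hom 0" "hV \<in> Hom (-1)" "pW \<in> Hom 0" "hW \<in> Hom (-1)"
    using c c' cV cW unfolding contraction_def by blast+
  define k where "k = sym_der (-1) h \<circ> sym_split p (\<lambda>v. v - p v) (\<lambda>k. 1 / real k)"
  define k' where "k' = sym_der (-1) h' \<circ> sym_split p' (\<lambda>v. v - p' v) (\<lambda>k. 1 / real k)"
  have ck: "contraction (sym_der 1 l) (sym_map p) k" and ck': "contraction (sym_der 1 l') (sym_map p') k'"
    unfolding k_def k'_def by (rule contraction_sym[OF c] contraction_sym[OF c'])+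
  have compl: "(\<lambda>v. v - q v) \<in> Hom 0" if "q \<in> Hom 0" for q :: "'a::graded_vector \<Rightarrow> 'a"
    using subspace_diff[OF subspace_Hom id_in_Hom that] by (simp add: fun_diff_def)
  have k_len: "k x \<in> sym_len n" if "x \<in> sym_len n" for x n
    unfolding k_def o_apply by (intro sym_der_len[OF ph(2)] sym_split_len[OF ph(1) compl[OF ph(1)]] that)
  have k'_len: "k' x \<in> sym_len n" if "x \<in> sym_len n" for x n
    unfolding k'_def o_apply by (intro sym_der_len[OF ph(4)] sym_split_len[OF ph(3) compl[OF ph(3)]] that)
  have kk': "k \<in> Hom (-1)" "k' \<in> Hom (-1)" using ck ck' unfolding contraction_def by blast+
  \<comment> \<open>X and X' are S(g[1]) and S(h[1]), Y and Y' are V and W; \<open>s\<close> and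
    \<open>t\<close> are induced by \<open>\<phi>\<close> and \<open>\<theta>\<close>. All source
    maps that occur respect \<open>sym_len n\<close>, so the comparison works modulo every
    filtration step.\<close>
  have comparison: "hom_comparison (sym_der 1 l) (sym_map p) k (sym_der 1 l') (sym_map p') k'
      eV pV hV eW pW hW (sym_map \<phi>) (sym_map \<theta>) f g (sym_len n) (sym_len n)" for n
  proof (rule hom_comparison.intro)
    show "sym_map \<phi> (sym_der 1 l x) = sym_der 1 l' (sym_map \<phi> x)" for x
      by (rule sym_map_der[OF \<phi> l l' chain_\<phi>])
    show "sym_der 1 l (sym_map \<theta> x) = 0" for x
      by (rule sym_der_map_eq_0[OF \<theta>(1) l \<theta>(4)])
    then show "sym_map \<theta> (sym_der 1 l' x) = 0" for x
      using sym_map_der[OF \<theta>(1) l' l, of x] \<theta>(4,5) by simp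
    show "sym_map \<theta> (sym_map \<phi> (sym_map p x)) = sym_map p x" for x
      using sym_map_compose[OF ph(1) \<phi>, of x] sym_map_compose[OF Hom_comp[OF ph(1) \<phi> refl, simplified] \<theta>(1), of x]
      by (simp add: o_def \<theta>(2))
    show "sym_map p' (sym_map \<phi> (sym_map \<theta> x)) = sym_map p' x" for x
      using sym_map_compose[OF \<theta>(1) \<phi>, of x] sym_map_compose[OF Hom_comp[OF \<theta>(1) \<phi> refl, simplified] ph(3), of x]
      by (simp add: o_def \<theta>(3))
  qed (use ck ck' cV cW in \<open>simp_all add: linear_sym_map[OF \<phi>] linear_sym_map[OF \<theta>(1)] Hom_linear[OF f] Hom_linear[OF g(1)]
      chain_f g(2-5) k_len k'_len sym_map_len[OF \<phi>] sym_map_len[OF \<theta>(1)]\<close>)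
  note lead_g = ruth_differential_leading_term[OF lam_g rho, folded l_def eV_def]
  note lead_h = ruth_differential_leading_term[OF lam_h tau, folded l'_def eW_def]
  note lead_F = ruth_pullback_leading_term[OF F, folded \<phi>_def]
  \<comment> \<open>The leading-term formulas hold on \<open>sym_len (Suc n)\<close>; restricted to
    \<open>sym_len n\<close> they show that the differentials and the pullback preserve the
    filtration.\<close>
  have up: "x \<in> sym_len n \<Longrightarrow> x \<in> sym_len (Suc n)" for n and x :: "'a::graded_vector sym"
    by (rule sym_len_mono[of n "Suc n"]) simp
  have fil_0: "Hom q \<subseteq> cochain_fil 0" for q
    by (auto simp: cochain_fil_def sym_len_0 linear_0 Hom_linear)
  have separated: "\<alpha> = 0" if "\<And>n. \<alpha> \<in> cochain_fil n" for \<alpha> :: "'a::graded_vector sym \<Rightarrow> 'b::real_vector"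
    using that ex_sym_len by (fastforce simp: cochain_fil_def)
  have Hom: "ruth_cochains = (Hom :: int \<Rightarrow> ('a::graded_vector shift sym \<Rightarrow> 'b::graded_vector) set)"
    by (simp add: fun_eq_iff ruth_cochains_def)
  show ?thesis
    unfolding Hom
  proof (rule quasi_isomorphism_complete_filtration[OF cx_h[unfolded Hom] cx_g[unfolded Hom] map[unfolded Hom],
        where FC = cochain_fil and FC' = cochain_fil])
    show "ruth_differential lam_h tau q \<alpha> \<in> cochain_fil n" if "\<alpha> \<in> Hom q" "\<alpha> \<in> cochain_fil n" for n q \<alpha>
      using that sym_der_len[OF l'] lead_h[OF that up] linear_0[OF Hom_linear[OF eW]]
      by (simp add: cochain_fil_def hom_diff_def)
    show "ruth_differential lam_g rho q \<alpha> \<in> cochain_fil n" if "\<alpha> \<in> Hom q" "\<alpha> \<in> cochain_fil n" for n q \<alpha>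
      using that sym_der_len[OF l] lead_g[OF that up] linear_0[OF Hom_linear[OF eV]]
      by (simp add: cochain_fil_def hom_diff_def)
    show "ruth_pullback F f \<alpha> \<in> cochain_fil n" if "\<alpha> \<in> Hom q" "\<alpha> \<in> cochain_fil n" for n q \<alpha>
      using that sym_map_len[OF \<phi>] lead_F[OF Hom_linear[OF that(1)] that(2) up] linear_0[OF Hom_linear[OF f]]
      by (simp add: cochain_fil_def ruth_pullback_def)
  next
    fix n q a b
    assume a: "a \<in> Hom q" "a \<in> cochain_fil n" and da: "ruth_differential lam_h tau q a \<in> cochain_fil (Suc n)"
      and b: "b \<in> Hom (q - 1)" "b \<in> cochain_fil n"
      and ab: "ruth_pullback F f a - ruth_differential lam_g rho (q - 1) b \<in> cochain_fil (Suc n)"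
    \<comment> \<open>The level is \<open>Suc n\<close>: a difference of cochains lies in
      \<open>cochain_fil (Suc n)\<close> exactly when the cochains agree on
      \<open>sym_len (Suc n)\<close>, where the leading-term formulas apply.\<close>
    interpret hom_comparison "sym_der 1 l" "sym_map p" k "sym_der 1 l'" "sym_map p'" k'
      eV pV hV eW pW hW "sym_map \<phi>" "sym_map \<theta>" f g "sym_len (Suc n)" "sym_len (Suc n)"
      by (rule comparison)
    \<comment> \<open>The primitive is the homotopy applied to \<open>a\<close> itself;
      \<open>b\<close> certifies that the pullback of \<open>a\<close> bounds modulo the next
      step.\<close>
    let ?u = "hom_htp hW k' pW q a"
    have u: "?u \<in> Hom (q - 1)" "?u \<in> cochain_fil n"
      by (rule hom_htp_Hom[OF VW(4) kk'(2) VW(3) a(1)])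
        (rule hom_htp_fil[OF Hom_linear[OF VW(4)] Hom_linear[OF VW(3)] k'_len a(2)])
    have "a x = hom_diff (sym_der 1 l') eW (q - 1) ?u x" if "x \<in> sym_len (Suc n)" for x
    proof (rule injective[OF Hom_linear[OF a(1)] Hom_linear[OF b(1)] _ _ that])
      show "hom_diff (sym_der 1 l') eW q a x = 0" if "x \<in> sym_len (Suc n)" for x
        using da lead_h[OF a that] that by (simp add: cochain_fil_def)
      show "f (a (sym_map \<phi> x)) = hom_diff (sym_der 1 l) eV (q - 1) b x" if "x \<in> sym_len (Suc n)" for x
      proof -
        have "f (a (F x)) = ruth_differential lam_g rho (q - 1) b x"
          using ab that by (simp add: cochain_fil_def ruth_pullback_def)
        then show ?thesis
          by (simp only: lead_g[OF b that] lead_F[OF Hom_linear[OF a(1)] a(2) that])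
      qed
    qed
    then have "a - ruth_differential lam_h tau (q - 1) ?u \<in> cochain_fil (Suc n)"
      using lead_h[OF u] by (simp add: cochain_fil_def)
    with u show "\<exists>u\<in>Hom (q - 1) \<inter> cochain_fil n. a - ruth_differential lam_h tau (q - 1) u \<in> cochain_fil (Suc n)"
      by blast
  next
    fix n q c
    assume c: "c \<in> Hom q" "c \<in> cochain_fil n" and dc: "ruth_differential lam_g rho q c \<in> cochain_fil (Suc n)"
    interpret hom_comparison "sym_der 1 l" "sym_map p" k "sym_der 1 l'" "sym_map p'" k'
      eV pV hV eW pW hW "sym_map \<phi>" "sym_map \<theta>" f g "sym_len (Suc n)" "sym_len (Suc n)"
      by (rule comparison)
    \<comment> \<open>\<open>?z\<close> transports \<open>c\<close> back along the homotopy
      inverses, \<open>?e\<close> is the error of the round trip, and \<open>?w\<close> bounds it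
      modulo the next step.\<close>
    let ?z = "\<lambda>x. g (c (sym_map \<theta> x))" and ?e = "\<lambda>x. c x - f (g (c (sym_map \<theta> (sym_map \<phi> x))))"
    let ?w = "hom_htp hV k pV q ?e"
    have cocycle: "hom_diff (sym_der 1 l) eV q c x = 0" if "x \<in> sym_len (Suc n)" for x
      using dc lead_g[OF c that] that by (simp add: cochain_fil_def)
    have z: "?z \<in> Hom q" "?z \<in> cochain_fil n"
      using Hom_comp[OF sym_map_Hom[OF \<theta>(1)] Hom_comp[OF c(1) g(1) refl] refl] c(2) sym_map_len[OF \<theta>(1)]
        linear_0[OF Hom_linear[OF g(1)]]
      by (simp_all add: o_def cochain_fil_def)
    have "?e = c - (f \<circ> ?z \<circ> sym_map \<phi>)" by (simp add: fun_eq_iff)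
    also have "\<dots> \<in> Hom q"
      using Hom_comp[OF sym_map_Hom[OF \<phi>] Hom_comp[OF z(1) f refl] refl]
      by (intro subspace_diff[OF subspace_Hom] c(1)) (simp add: comp_assoc)
    finally have e: "?e \<in> Hom q" "?e \<in> cochain_fil n"
      using z(2) c(2) sym_map_len[OF \<phi>] linear_0[OF Hom_linear[OF f]] by (simp_all add: cochain_fil_def)
    have w: "?w \<in> Hom (q - 1)" "?w \<in> cochain_fil n"
      by (rule hom_htp_Hom[OF VW(2) kk'(1) VW(1) e(1)])
        (rule hom_htp_fil[OF Hom_linear[OF VW(2)] Hom_linear[OF VW(1)] k_len e(2)])
    have "ruth_differential lam_h tau q ?z \<in> cochain_fil (Suc n)"
      using lead_h[OF z] surjective(1)[OF Hom_linear[OF c(1)] cocycle] by (simp add: cochain_fil_def)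
    moreover have "c - ruth_pullback F f ?z - ruth_differential lam_g rho (q - 1) ?w \<in> cochain_fil (Suc n)"
      using lead_g[OF w] lead_F[OF Hom_linear[OF z(1)] z(2)] surjective(2)[OF Hom_linear[OF c(1)] cocycle]
      by (simp add: cochain_fil_def ruth_pullback_def)
    ultimately show "\<exists>z\<in>Hom q \<inter> cochain_fil n. \<exists>w\<in>Hom (q - 1) \<inter> cochain_fil n.
        ruth_differential lam_h tau q z \<in> cochain_fil (Suc n) \<and>
        c - ruth_pullback F f z - ruth_differential lam_g rho (q - 1) w \<in> cochain_fil (Suc n)"
      using z w by blast
  qed (rule subspace_cochain_fil fil_0 separated cochain_fil_complete, assumption?)+
qed

end
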